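(* Let $\Omega$ be a domain in $\mathbb{R}^m$ and let $\Gamma\subset\Omega$ be an $(m-1)$-dimensional, orientable, $C^1$-smooth submanifold. Let $B\subset\subset\Omega$ be an open neighborhood of a point in $\Gamma$ with $C^1$-smooth boundary and with $\bar B$ compact. Suppose $\Gamma\cap B$ divides $B$ into two disjoint parts, i.e. $B\setminus\Gamma=B^+\cup B^-$ where $B^+$ and $B^-$ are disjoint domains (proper, open and connected). Let $\vec F\in C^1(\Omega)$ be a vector field. Suppose $u$ is $C^2$-smooth in $\Omega\setminus\Gamma$ and has no singular points in $\Omega\setminus\Gamma$, and $u\in W^1(B)$. Suppose also that $N^+(u)$ and $N^-(u)$ (the restrictions of $N(u)$ to $B^+$ and $B^-$, respectively) are continuous up to $\Gamma\cap B$, i.e. $N^+(u)\in C^0(\overline{B^+})$ and $N^-(u)\in C^0(\overline{B^-})$, and that $\operatorname{div}N^{\pm}(u)=H$ in $B^{\pm}$, respectively, where $H\in C^0(B\setminus\Gamma)\cap L^\infty(B)$. Let $\nu^+$ and $\nu^-=-\nu^+$ denote the outward unit normals to $\Gamma\cap B$ with respect to $B^+$ and $B^-$, respectively. Then $u$ is a weak solution to $\operatorname{div}\frac{\nabla u+\vec F}{|\nabla u+\vec F|}=H$ on $B$ if and only if along $\Gamma\cap B$ there holds $$(N^+(u)-N^-(u))\cdot\nu^+=(N^+(u)-N^-(u))\cdot\nu^-=0.$$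
   Context: $W^1(B)$ is the space of weakly differentiable functions on $B$. $S(u)=\{\nabla u+\vec F=0\}$ is the singular set of $u$, whose points are called singular points, and $N(u)=\frac{\nabla u+\vec F}{|\nabla u+\vec F|}$ away from $S(u)$. Both are used with $\nabla u$ the weak gradient, so they are defined up to null sets on $B$. $u\in W^1(B)$ is a weak solution to $\operatorname{div}N(u)=H$ on $B$ if for every $\varphi\in C_0^\infty(B)$ $$\int_{S(u)\cap B}|\nabla\varphi|+\int_{B\setminus S(u)}N(u)\cdot\nabla\varphi+\int_BH\varphi\ge0.$$ *)

theory Defs
  imports "HOL-Analysis.Analysis"
begin

text \<open>Derivatives are taken within \<open>S\<close>, so that \<open>Ck_on\<close> depends only on the values of \<open>f\<close> on
  \<open>S\<close>. For open \<open>S\<close> they are ordinary derivatives. They are also unique when \<open>S\<close> is an open set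
  minus a hypersurface, even if the hypersurface is not relatively closed.\<close>

primrec Ck_on :: "nat \<Rightarrow> ('a::euclidean_space \<Rightarrow> 'b::real_normed_vector) \<Rightarrow> 'a set \<Rightarrow> bool" where
  "Ck_on 0 f S \<longleftrightarrow> continuous_on S f"
| "Ck_on (Suc k) f S \<longleftrightarrow> f differentiable_on S \<and>
     (\<forall>v. Ck_on k (\<lambda>x. frechet_derivative f (at x within S) v) S)"

definition grad_within :: "'a::euclidean_space set \<Rightarrow> ('a \<Rightarrow> real) \<Rightarrow> 'a \<Rightarrow> 'a" where
  "grad_within S f x = (\<Sum>i\<in>Basis. frechet_derivative f (at x within S) i *\<^sub>R i)"

abbreviation grad :: "('a::euclidean_space \<Rightarrow> real) \<Rightarrow> 'a \<Rightarrow> 'a" where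
  "grad \<equiv> grad_within UNIV"

definition divergence :: "('a::euclidean_space \<Rightarrow> 'a) \<Rightarrow> 'a \<Rightarrow> real" where
  "divergence V x = (\<Sum>i\<in>Basis. frechet_derivative V (at x) i \<bullet> i)"

definition C1_chart :: "'a::euclidean_space set \<Rightarrow> ('a \<Rightarrow> 'a) \<Rightarrow> bool" where
  "C1_chart U \<psi> \<longleftrightarrow> open U \<and> open (\<psi> ` U) \<and> inj_on \<psi> U \<and> Ck_on 1 \<psi> U \<and>
     Ck_on 1 (inv_into U \<psi>) (\<psi> ` U)"

text \<open>Embedded hypersurface without boundary, by slice charts. It need not be closed.\<close>

definition C1_hypersurface :: "'a::euclidean_space set \<Rightarrow> bool" where
  "C1_hypersurface M \<longleftrightarrow> (\<forall>p\<in>M. \<exists>U \<psi>. \<exists>e\<in>Basis. p \<in> U \<and> C1_chart U \<psi> \<and>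
     \<psi> ` (M \<inter> U) = {y \<in> \<psi> ` U. y \<bullet> e = 0})"

definition C1_boundary :: "'a::euclidean_space set \<Rightarrow> bool" where
  "C1_boundary D \<longleftrightarrow> (\<forall>p\<in>frontier D. \<exists>U \<psi>. \<exists>e\<in>Basis. p \<in> U \<and> C1_chart U \<psi> \<and>
     \<psi> ` (D \<inter> U) = {y \<in> \<psi> ` U. y \<bullet> e > 0} \<and>
     \<psi> ` (frontier D \<inter> U) = {y \<in> \<psi> ` U. y \<bullet> e = 0})"

definition tangent_space :: "'a::euclidean_space set \<Rightarrow> 'a \<Rightarrow> 'a set" where
  "tangent_space M p = {v. \<exists>\<gamma>. \<exists>\<epsilon>>0. \<gamma> C1_differentiable_on {-\<epsilon><..<\<epsilon>} \<and> \<gamma> ` {-\<epsilon><..<\<epsilon>} \<subseteq> M \<and>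
     \<gamma> 0 = p \<and> (\<gamma> has_vector_derivative v) (at 0)}"

definition unit_normal :: "'a::euclidean_space set \<Rightarrow> 'a \<Rightarrow> 'a \<Rightarrow> bool" where
  "unit_normal M p n \<longleftrightarrow> norm n = 1 \<and> (\<forall>v\<in>tangent_space M p. n \<bullet> v = 0)"

text \<open>Orientability of a hypersurface, as the existence of a global continuous unit normal.\<close>

definition orientable_hypersurface :: "'a::euclidean_space set \<Rightarrow> bool" where
  "orientable_hypersurface M \<longleftrightarrow> (\<exists>n. continuous_on M n \<and> (\<forall>p\<in>M. unit_normal M p (n p)))"

text \<open>No outward normal with respect to \<open>D\<close> exists at a point where \<open>D\<close> lies on both sides of \<open>M\<close>.\<close>

definition outward_unit_normal :: "'a::euclidean_space set \<Rightarrow> 'a set \<Rightarrow> 'a \<Rightarrow> 'a \<Rightarrow> bool" where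
  "outward_unit_normal M D p n \<longleftrightarrow> unit_normal M p n \<and>
     (\<exists>\<epsilon>>0. \<forall>t\<in>{0<..<\<epsilon>}. p - t *\<^sub>R n \<in> D \<and> p + t *\<^sub>R n \<notin> D)"

definition test_functions :: "'a::euclidean_space set \<Rightarrow> ('a \<Rightarrow> real) set" where
  "test_functions B = {\<phi>. (\<forall>k. Ck_on k \<phi> UNIV) \<and>
     compact (closure {x. \<phi> x \<noteq> 0}) \<and> closure {x. \<phi> x \<noteq> 0} \<subseteq> B}"

definition locally_integrable_on :: "('a::euclidean_space \<Rightarrow> 'b::euclidean_space) \<Rightarrow> 'a set \<Rightarrow> bool" where
  "locally_integrable_on f B \<longleftrightarrow> (\<forall>K. compact K \<and> K \<subseteq> B \<longrightarrow> f absolutely_integrable_on K)"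

definition Linfinity_on :: "('a::euclidean_space \<Rightarrow> real) \<Rightarrow> 'a set \<Rightarrow> bool" where
  "Linfinity_on f B \<longleftrightarrow> f \<in> borel_measurable (lebesgue_on B) \<and>
     (\<exists>C. AE x in lebesgue_on B. \<bar>f x\<bar> \<le> C)"

definition has_weak_gradient :: "'a::euclidean_space set \<Rightarrow> ('a \<Rightarrow> real) \<Rightarrow> ('a \<Rightarrow> 'a) \<Rightarrow> bool" where
  "has_weak_gradient B u g \<longleftrightarrow> locally_integrable_on u B \<and> locally_integrable_on g B \<and>
     (\<forall>\<phi>\<in>test_functions B.
        (LINT x:B|lebesgue. u x *\<^sub>R grad \<phi> x) = - (LINT x:B|lebesgue. \<phi> x *\<^sub>R g x))"

definition W1 :: "'a::euclidean_space set \<Rightarrow> ('a \<Rightarrow> real) set" where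
  "W1 B = {u. \<exists>g. has_weak_gradient B u g}"

text \<open>The singular set and \<open>N\<close> take the gradient field \<open>g\<close> of \<open>u\<close> as an argument, because it is the
  weak gradient in the notion of weak solution and the classical one where \<open>u\<close> is smooth.\<close>

definition singular_set :: "('a::euclidean_space \<Rightarrow> 'a) \<Rightarrow> ('a \<Rightarrow> 'a) \<Rightarrow> 'a set" where
  "singular_set F g = {x. g x + F x = 0}"

definition N_field :: "('a::euclidean_space \<Rightarrow> 'a) \<Rightarrow> ('a \<Rightarrow> 'a) \<Rightarrow> 'a \<Rightarrow> 'a" where
  "N_field F g x = (g x + F x) /\<^sub>R norm (g x + F x)"

text \<open>Weak gradients are determined up to null sets, so the choice of \<open>g\<close> does not affect the
  integrals.\<close>

definition weak_solution ::
    "('a::euclidean_space \<Rightarrow> 'a) \<Rightarrow> ('a \<Rightarrow> real) \<Rightarrow> 'a set \<Rightarrow> ('a \<Rightarrow> real) \<Rightarrow> bool" where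
  "weak_solution F H B u \<longleftrightarrow> u \<in> W1 B \<and>
     (\<forall>g. has_weak_gradient B u g \<longrightarrow> (\<forall>\<phi>\<in>test_functions B.
        (LINT x:singular_set F g \<inter> B|lebesgue. norm (grad \<phi> x)) +
        (LINT x:B - singular_set F g|lebesgue. N_field F g x \<bullet> grad \<phi> x) +
        (LINT x:B|lebesgue. H x * \<phi> x) \<ge> 0))"

end

theory Submission
  imports Defs
begin

text \<open>The interface is negligible and the weak gradient agrees almost everywhere with the classical one
  off it, so the weak formulation tests the functional
  \<open>L \<phi> = (\<integral> N\<^sup>+ \<bullet> \<nabla>\<phi> + H \<phi>) + (\<integral> N\<^sup>- \<bullet> \<nabla>\<phi> + H \<phi>)\<close>, which is linear, so that \<open>L \<ge> 0\<close> means
  \<open>L = 0\<close>. Surface integrals are avoided: let \<open>d\<close> be the coordinate of a slice chart that vanishes on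
  the interface, and multiply \<open>\<phi>\<close> by a cutoff \<open>\<eta>(n d)\<close> that vanishes near the interface. The
  divergence theorem for compactly supported \<open>C\<^sup>1\<close> fields then turns one half of \<open>L \<phi>\<close> into
  minus the limit of the integrals of \<open>\<phi> (N \<bullet> \<nabla>d) n \<eta>'(n d)\<close>, which live on a thin layer.
  Changing variables to the chart and reflecting one side onto the other, the density of the layer
  integral of \<open>L \<phi>\<close> is continuous up to the interface, where it is a positive multiple of
  \<open>\<phi> (N\<^sup>+ - N\<^sup>-) \<bullet> \<nabla>d\<close>, and \<open>\<nabla>d\<close> is parallel to the normal. If the jump vanishes, the layer integrals
  tend to 0; if not, a bump at a point with a jump keeps them away from 0.\<close>

subsection \<open>Smooth test functions\<close>

text \<open>The fields are continuous up to the interface, but their derivatives are controlled only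
  inside each side. The divergence theorem is therefore used only for fields that vanish near the
  boundary of the region, and for these it follows from the translation invariance of Lebesgue
  measure.

  The layer integrals are never evaluated. Only the vanishing or the sign of a limit is at stake, so
  it is enough to bound the mass of the layer from above and away from 0. Folding one side onto the
  other puts both fluxes under one integral, where their difference can be estimated pointwise. The
  price is that a test function is not symmetric under the reflection. The resulting error vanishes
  on the hyperplane and becomes small on thin layers.

  The two directions differ in scope. A jump is detected by a single bump in a single chart. Without
  a jump, each chart handles only test functions supported in it, and additivity of the functional
  carries the result to all test functions. The auxiliary cutoffs have one continuous derivative, so
  this direction works with a class larger than the smooth functions.\<close>

definition exp_bump :: "nat \<Rightarrow> real \<Rightarrow> real" where
  "exp_bump k t = (if t \<le> 0 then 0 else exp (- inverse t) * inverse t ^ k)"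

lemma exp_bump_tendsto_0: "(exp_bump k \<longlongrightarrow> 0) (at 0)"
proof -
  have "((\<lambda>s. s ^ k / exp s) \<longlongrightarrow> 0) (at_top :: real filter)"
    by (rule tendsto_power_div_exp_0)
  then have "((\<lambda>t. inverse t ^ k / exp (inverse t)) \<longlongrightarrow> 0) (at_right (0::real))"
    by (rule filterlim_compose) (rule filterlim_inverse_at_top_right)
  then have "(exp_bump k \<longlongrightarrow> 0) (at_right 0)"
    by (rule Lim_transform_eventually)
      (auto simp: exp_bump_def eventually_at_filter exp_minus field_simps)
  moreover have "(exp_bump k \<longlongrightarrow> 0) (at_left 0)"
    by (rule Lim_transform_eventually[of "\<lambda>_. 0"]) (auto simp: exp_bump_def eventually_at_filter)
  ultimately show ?thesis
    by (simp add: filterlim_at_split)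
qed

text \<open>The powers of \<open>inverse t\<close> in \<open>exp_bump\<close> are there for this
  rule: differentiation maps the family into its own linear combinations, which turns smoothness
  into an induction.\<close>

lemma DERIV_exp_bump:
  "(exp_bump k has_field_derivative exp_bump (k + 2) t - real k * exp_bump (k + 1) t) (at t)"
proof (cases t "0::real" rule: linorder_cases)
  case less
  have "((\<lambda>t. 0) has_field_derivative 0) (at t)" by simp
  then have "(exp_bump k has_field_derivative 0) (at t)"
    by (rule has_field_derivative_transform_within_open[where S="{..<0}"])
      (use less in \<open>auto simp: exp_bump_def\<close>)
  then show ?thesis using less by (simp add: exp_bump_def)
next
  case equal
  \<comment> \<open>At the origin the difference quotient of \<open>exp_bump k\<close> is
    \<open>exp_bump (Suc k)\<close>, whose limit is known.\<close>
  have "((\<lambda>h. (exp_bump k (0 + h) - exp_bump k 0) / h) \<longlongrightarrow> 0) (at 0)"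
    by (rule Lim_transform_eventually[OF exp_bump_tendsto_0[of "Suc k"]])
      (auto simp: exp_bump_def eventually_at_filter field_simps)
  then show ?thesis using equal by (simp add: DERIV_def exp_bump_def)
next
  case greater
  have "((\<lambda>t. exp (- inverse t) * inverse t ^ k) has_field_derivative
      exp_bump (k + 2) t - real k * exp_bump (k + 1) t) (at t)"
    using greater
  proof -
    have "((\<lambda>t. exp (- inverse t) * inverse t ^ k) has_field_derivative
        exp (- inverse t) * inverse t ^ 2 * inverse t ^ k +
        exp (- inverse t) * (real k * inverse t ^ (k - 1) * - (inverse t ^ 2))) (at t)"
      using greater by (auto intro!: derivative_eq_intros simp: power2_eq_square)
    also have "exp (- inverse t) * inverse t ^ 2 * inverse t ^ k +
        exp (- inverse t) * (real k * inverse t ^ (k - 1) * - (inverse t ^ 2)) =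
        exp_bump (k + 2) t - real k * exp_bump (k + 1) t"
      using greater by (cases k) (simp_all add: exp_bump_def power2_eq_square algebra_simps)
    finally show ?thesis .
  qed
  then show ?thesis
    by (rule has_field_derivative_transform_within_open[where S="{0<..}"])
      (use greater in \<open>auto simp: exp_bump_def\<close>)
qed

text \<open>A class of functions closed under directional derivatives. Since \<open>Ck_on\<close>
  recurses over directional derivatives, membership gives every order of smoothness at once, and no
  formula for higher derivatives is needed.\<close>

inductive bump_algebra :: "('a::euclidean_space \<Rightarrow> real) \<Rightarrow> bool" where
  const: "bump_algebra (\<lambda>x. c)"
| add: "bump_algebra f \<Longrightarrow> bump_algebra g \<Longrightarrow> bump_algebra (\<lambda>x. f x + g x)"
| mult: "bump_algebra f \<Longrightarrow> bump_algebra g \<Longrightarrow> bump_algebra (\<lambda>x. f x * g x)"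
| bump: "bump_algebra (\<lambda>x. exp_bump k (c + x \<bullet> v))"

lemma bump_algebra_derivative:
  "bump_algebra f \<Longrightarrow> \<exists>f'. (\<forall>x. (f has_derivative f' x) (at x)) \<and> (\<forall>v. bump_algebra (\<lambda>x. f' x v))"
proof (induction rule: bump_algebra.induct)
  case (const c)
  show ?case
    by (intro exI[of _ "\<lambda>x v. 0"]) (auto intro: bump_algebra.const)
next
  case (add f g)
  then obtain f' g' where "\<forall>x. (f has_derivative f' x) (at x)" "\<forall>v. bump_algebra (\<lambda>x. f' x v)"
    "\<forall>x. (g has_derivative g' x) (at x)" "\<forall>v. bump_algebra (\<lambda>x. g' x v)"
    by blast
  then show ?case
    by (intro exI[of _ "\<lambda>x v. f' x v + g' x v"]) (auto intro: bump_algebra.add has_derivative_add)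
next
  case (mult f g)
  then obtain f' g' where "\<forall>x. (f has_derivative f' x) (at x)" "\<forall>v. bump_algebra (\<lambda>x. f' x v)"
    "\<forall>x. (g has_derivative g' x) (at x)" "\<forall>v. bump_algebra (\<lambda>x. g' x v)"
    by blast
  with mult.hyps show ?case
    by (intro exI[of _ "\<lambda>x v. f x * g' x v + f' x v * g x"])
      (auto intro!: bump_algebra.add bump_algebra.mult has_derivative_mult)
next
  case (bump k c v)
  define D where "D x w = (exp_bump (k + 2) (c + x \<bullet> v) - real k * exp_bump (k + 1) (c + x \<bullet> v)) * (w \<bullet> v)"
    for x w :: 'a
  have "((\<lambda>x. exp_bump k (c + x \<bullet> v)) has_derivative D x) (at x)" for x
    unfolding D_def
    by (rule has_derivative_eq_rhs, rule has_derivative_compose[of "\<lambda>x. c + x \<bullet> v"])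
      (rule derivative_eq_intros refl
        DERIV_exp_bump[unfolded has_field_derivative_def] | simp)+
  moreover have "bump_algebra (\<lambda>x. D x w)" for w
  proof -
    have "bump_algebra (\<lambda>x. (exp_bump (k + 2) (c + x \<bullet> v) +
       (- real k) * exp_bump (k + 1) (c + x \<bullet> v)) * (w \<bullet> v))"
      by (intro bump_algebra.intros)
    then show ?thesis by (simp add: D_def)
  qed
  ultimately show ?case by blast
qed

lemma bump_algebra_Ck_on: "bump_algebra f \<Longrightarrow> Ck_on k f UNIV"
proof (induction k arbitrary: f)
  case 0
  then show ?case
    using bump_algebra_derivative[OF 0]
    by (metis Ck_on.simps(1) continuous_at_imp_continuous_on has_derivative_continuous)
next
  case (Suc k)
  obtain f' where f': "\<forall>x. (f has_derivative f' x) (at x)" "\<forall>v. bump_algebra (\<lambda>x. f' x v)"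
    using bump_algebra_derivative[OF Suc.prems] by blast
  have "frechet_derivative f (at x) = f' x" for x
    using f'(1) by (metis frechet_derivative_at)
  with f' Suc.IH show ?case
    by (auto simp: differentiable_on_def differentiable_def)
qed

lemma bump_algebra_prod:
  "finite I \<Longrightarrow> (\<And>i. i \<in> I \<Longrightarrow> bump_algebra (f i)) \<Longrightarrow> bump_algebra (\<lambda>x. \<Prod>i\<in>I. f i x)"
  by (induction rule: finite_induct) (auto intro: bump_algebra.intros)

text \<open>The factor \<open>Suc n\<close> steepens the bump, so that the sequence tends to the
  indicator of the open box. Each coordinate contributes one factor that dies at the lower face and
  one that dies at the upper face.\<close>

definition box_bump :: "'a::euclidean_space \<Rightarrow> 'a \<Rightarrow> nat \<Rightarrow> 'a \<Rightarrow> real" where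
  "box_bump a b n x = (\<Prod>i\<in>Basis. exp_bump 0 (Suc n * (x \<bullet> i - a \<bullet> i)) * exp_bump 0 (Suc n * (b \<bullet> i - x \<bullet> i)))"

lemma exp_bump_0_bounds: "0 \<le> exp_bump 0 t" "exp_bump 0 t \<le> 1" "exp_bump 0 t > 0 \<longleftrightarrow> t > 0"
  by (auto simp: exp_bump_def)

lemma box_bump_bounds: "0 \<le> box_bump a b n x" "box_bump a b n x \<le> 1"
  unfolding box_bump_def
  by (auto intro!: prod_nonneg prod_le_1 mult_le_one simp: exp_bump_0_bounds)

lemma box_bump_pos: "box_bump a b n x > 0 \<longleftrightarrow> x \<in> box a b"
proof
  show "x \<in> box a b" if "box_bump a b n x > 0"
  proof (rule ccontr)
    assume "x \<notin> box a b"
    then obtain i where "i \<in> Basis" "x \<bullet> i \<le> a \<bullet> i \<or> b \<bullet> i \<le> x \<bullet> i"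
      by (auto simp: box_def not_less)
    then have "box_bump a b n x = 0"
      unfolding box_bump_def
      by (intro prod_zero bexI[of _ i]) (auto simp: exp_bump_def mult_le_0_iff)
    with that show False by simp
  qed
  show "box_bump a b n x > 0" if "x \<in> box a b"
    using that unfolding box_bump_def
    by (auto intro!: prod_pos mult_pos_pos simp: exp_bump_0_bounds box_def simp del: of_nat_Suc)
qed

lemma box_bump_eq_0: "x \<notin> box a b \<Longrightarrow> box_bump a b n x = 0"
  using box_bump_pos box_bump_bounds(1) by (metis less_eq_real_def)

lemma box_bump_test_function:
  assumes "cbox a b \<subseteq> S"
  shows "box_bump a b n \<in> test_functions S"
proof -
  have bump: "bump_algebra (box_bump a b n)"
  proof -
    have "bump_algebra (\<lambda>x. \<Prod>i\<in>Basis. exp_bump 0 (- (Suc n * (a \<bullet> i)) + x \<bullet> (real (Suc n) *\<^sub>R i)) *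
        exp_bump 0 (Suc n * (b \<bullet> i) + x \<bullet> (- real (Suc n) *\<^sub>R i)))"
      by (intro bump_algebra_prod bump_algebra.intros finite_Basis)
    moreover have "box_bump a b n = (\<lambda>x. \<Prod>i\<in>Basis. exp_bump 0 (- (Suc n * (a \<bullet> i)) + x \<bullet> (real (Suc n) *\<^sub>R i)) *
        exp_bump 0 (Suc n * (b \<bullet> i) + x \<bullet> (- real (Suc n) *\<^sub>R i)))"
      by (auto simp: box_bump_def right_diff_distrib simp del: of_nat_Suc)
    ultimately show ?thesis
      by (simp del: of_nat_Suc)
  qed
  have "{x. box_bump a b n x \<noteq> 0} \<subseteq> cbox a b"
    using box_bump_eq_0 box_subset_cbox by blast
  then have sub: "closure {x. box_bump a b n x \<noteq> 0} \<subseteq> cbox a b"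
    by (intro closure_minimal closed_cbox)
  then have "compact (closure {x. box_bump a b n x \<noteq> 0})"
    by (meson bounded_cbox bounded_subset closed_closure compact_eq_bounded_closed)
  with bump sub assms show ?thesis
    by (auto simp: test_functions_def bump_algebra_Ck_on)
qed

lemma box_bump_tendsto_indicator: "(\<lambda>n. box_bump a b n x) \<longlonglongrightarrow> indicator (box a b) x"
proof (cases "x \<in> box a b")
  case True
  have lim: "(\<lambda>n. exp_bump 0 (Suc n * t)) \<longlonglongrightarrow> 1" if "t > 0" for t :: real
  proof -
    have "(\<lambda>n. exp (- (inverse t * inverse (real (Suc n))))) \<longlonglongrightarrow> exp (- (inverse t * 0))"
      by (intro tendsto_intros LIMSEQ_inverse_real_of_nat)
    then have "(\<lambda>n. exp (- inverse (Suc n * t))) \<longlonglongrightarrow> 1"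
      by (simp add: mult.commute del: of_nat_Suc)
    moreover have "exp_bump 0 (Suc n * t) = exp (- inverse (Suc n * t))" for n
      using that by (simp add: exp_bump_def mult_le_0_iff del: of_nat_Suc)
    ultimately show ?thesis by (simp del: of_nat_Suc)
  qed
  have "(\<lambda>n. box_bump a b n x) \<longlonglongrightarrow> (\<Prod>i\<in>(Basis :: 'a set). 1 * 1)"
    unfolding box_bump_def
    by (intro tendsto_prod tendsto_mult lim) (use True in \<open>auto simp: box_def\<close>)
  with True show ?thesis by simp
qed (simp add: box_bump_eq_0)

subsection \<open>The fundamental lemma of the calculus of variations\<close>

text \<open>Completion keeps the measure of Borel sets, so a countable cover for
  \<open>lborel\<close> serves again. Sigma-finiteness is what allows the conclusion that a function
  with vanishing set integrals is 0 almost everywhere.\<close>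

lemma sigma_finite_lebesgue: "sigma_finite_measure (lebesgue :: 'a::euclidean_space measure)"
proof
  obtain A :: "'a set set" where "countable A" "A \<subseteq> sets lborel" "\<Union>A = space lborel"
    "\<forall>a\<in>A. emeasure lborel a \<noteq> \<infinity>"
    using lborel.sigma_finite_countable by blast
  then show "\<exists>A :: 'a set set. countable A \<and> A \<subseteq> sets lebesgue \<and> \<Union>A = space lebesgue \<and>
      (\<forall>a\<in>A. emeasure lebesgue a \<noteq> \<infinity>)"
    by (intro exI[of _ A]) (auto simp: emeasure_completion subset_iff)
qed

text \<open>Boxes form an intersection stable generator of the Borel sets, so a Dynkin argument
  spreads the vanishing of the integral from boxes to Borel sets. Null sets lead on to Lebesgue
  sets, and then the density itself vanishes almost everywhere.\<close>

lemma integrable_cbox_AE_0: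
  fixes f :: "'a::euclidean_space \<Rightarrow> 'b::euclidean_space"
  assumes f: "f absolutely_integrable_on cbox a b"
    and zero: "\<And>c d. cbox c d \<subseteq> cbox a b \<Longrightarrow> (LINT x:box c d|lebesgue. f x) = 0"
  shows "AE x in lebesgue. x \<in> box a b \<longrightarrow> f x = 0"
proof -
  have f': "set_integrable lebesgue (box a b) f"
    using f by (rule set_integrable_subset) (auto simp: box_subset_cbox)
  \<comment> \<open>Truncation to the box gives a globally integrable function, so that complements
    and unions can be taken in the whole space.\<close>
  define w where "w x = indicator (box a b) x *\<^sub>R f x" for x
  have w: "integrable lebesgue w"
    using f' by (simp add: set_integrable_def w_def[abs_def])
  have wA: "set_integrable lebesgue A w" if "A \<in> sets lebesgue" for A
    using w that by (simp add: integrable_mult_indicator set_integrable_def)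
  have box0: "(LINT x:box c d|lebesgue. w x) = 0" for c d
  proof -
    obtain c' d' where cd: "box a b \<inter> box c d = box c' d'"
      by (simp add: box_Int_box)
    have "(LINT x:box c d|lebesgue. w x) = (LINT x:box c' d'|lebesgue. f x)"
      unfolding set_lebesgue_integral_def w_def cd[symmetric]
      by (auto intro!: Bochner_Integration.integral_cong split: split_indicator)
    also have "\<dots> = 0"
    proof (cases "box c' d' = {}")
      case False
      then have "cbox c' d' \<subseteq> cbox a b"
        using cd closure_box box_subset_cbox
        by (metis Int_lower1 closed_cbox closure_minimal subset_trans)
      then show ?thesis by (rule zero)
    qed (simp add: set_lebesgue_integral_def)
    finally show ?thesis .
  qed
  have borel: "(LINT x:A|lebesgue. w x) = 0" if "A \<in> sets borel" for A
  proof -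
    have mem: "A \<in> sigma_sets UNIV (range (\<lambda>(a, b). box a b))"
      using that by (simp add: borel_eq_box)
    have stable: "Int_stable (range (\<lambda>(a, b). box a b :: 'a set))"
      by (auto simp: Int_stable_def box_Int_box)
    have sub: "range (\<lambda>(a, b). box a b :: 'a set) \<subseteq> Pow UNIV"
      by simp
    from stable sub mem show ?thesis
    proof (induction rule: sigma_sets_induct_disjoint)
      case (compl A)
      then have A: "A \<in> sets lebesgue"
        by (metis borel_eq_box sets_completionI_sets sets_lborel sets_measure_of top_greatest UNIV_I Pow_UNIV)
      \<comment> \<open>The total integral of \<open>w\<close> is its integral over one box and
        hence 0. This settles complements.\<close>
      have "(LINT x:UNIV|lebesgue. w x) = (LINT x:box a b|lebesgue. w x)"
        unfolding set_lebesgue_integral_def w_def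
        by (auto intro!: Bochner_Integration.integral_cong split: split_indicator)
      then have "0 = (LINT x:(UNIV - A) \<union> A|lebesgue. w x)"
        using box0 by (simp add: Compl_partition2 flip: Compl_eq_Diff_UNIV)
      also have "\<dots> = (LINT x:(UNIV - A)|lebesgue. w x) + (LINT x:A|lebesgue. w x)"
        using A by (intro set_integral_Un wA) auto
      finally show ?case using compl by simp
    next
      case (union A)
      then have A: "A i \<in> sets lebesgue" for i
        by (metis borel_eq_box sets_completionI_sets sets_lborel sets_measure_of top_greatest UNIV_I Pow_UNIV range_subsetD)
      have "(LINT x:(\<Union>i. A i)|lebesgue. w x) = (\<Sum>i. (LINT x:(A i)|lebesgue. w x))"
        using A union by (intro lebesgue_integral_countable_add wA) (auto simp: disjoint_family_on_def)
      with union show ?case by simp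
    qed (use box0 in \<open>auto simp: set_lebesgue_integral_def\<close>)
  qed
  have "(LINT x:A|lebesgue. w x) = 0" if A: "A \<in> sets lebesgue" for A
  proof -
    obtain S N' N where SN: "A = S \<union> N" "N \<subseteq> N'" "N' \<in> null_sets lborel" "S \<in> sets lborel"
      using A unfolding sets_completion by blast
    have N': "N' \<in> null_sets lebesgue"
      using SN by (simp add: null_sets_completionI)
    have "(LINT x:A|lebesgue. w x) = (LINT x:S|lebesgue. w x)"
    proof (rule set_integral_null_delta[OF w A])
      show "S \<in> sets lebesgue" using SN by simp
      show "A - S \<union> (S - A) \<in> null_sets lebesgue"
        by (rule null_sets_completion_subset[OF _ N']) (use SN in auto)
    qed
    with borel SN show ?thesis by simp
  qed
  then have "AE x in lebesgue. w x = 0"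
    by (rule sigma_finite_measure.density_zero[OF sigma_finite_lebesgue w])
  then show ?thesis
    by eventually_elim (auto simp: w_def)
qed

text \<open>The steepening bumps of a box whose closure lies in \<open>S\<close> are admissible and
  tend boundedly to its indicator. By dominated convergence the integral over every such box is 0,
  and countably many boxes cover \<open>S\<close>.\<close>

lemma fundamental_lemma_of_variations:
  fixes f :: "'a::euclidean_space \<Rightarrow> 'b::euclidean_space"
  assumes "open S" and f: "locally_integrable_on f S"
    and zero: "\<And>\<phi>. \<phi> \<in> test_functions S \<Longrightarrow> (LINT x:S|lebesgue. \<phi> x *\<^sub>R f x) = 0"
  shows "AE x in lebesgue. x \<in> S \<longrightarrow> f x = 0"
proof -
  have cb: "AE x in lebesgue. x \<in> box a b \<longrightarrow> f x = 0" if ab: "cbox a b \<subseteq> S" for a b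
  proof (rule integrable_cbox_AE_0)
    show "f absolutely_integrable_on cbox a b"
      using f ab by (auto simp: locally_integrable_on_def)
    fix c d assume "cbox c d \<subseteq> cbox a b"
    with ab have cd: "cbox c d \<subseteq> S" by simp
    then have fcd: "f absolutely_integrable_on cbox c d"
      using f by (auto simp: locally_integrable_on_def)
    let ?w = "\<lambda>x. indicator (cbox c d) x *\<^sub>R f x"
    have int: "integrable lebesgue ?w"
      using fcd by (simp add: set_integrable_def)
    have bump: "box_bump c d n \<in> borel_measurable borel" for n
    proof -
      have "Ck_on 0 (box_bump c d n) UNIV"
        using box_bump_test_function[of c d UNIV n] by (auto simp: test_functions_def)
      then show ?thesis by (simp add: borel_measurable_continuous_onI)
    qed
    have "(\<lambda>n. LINT x|lebesgue. box_bump c d n x *\<^sub>R ?w x) \<longlonglongrightarrow> (LINT x|lebesgue. indicator (box c d) x *\<^sub>R ?w x)"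
    proof (rule integral_dominated_convergence)
      show "integrable lebesgue (\<lambda>x. norm (?w x))" using int by (rule integrable_norm)
      show "(\<lambda>x. box_bump c d n x *\<^sub>R ?w x) \<in> borel_measurable lebesgue" for n
        by (rule borel_measurable_scaleR[OF _ borel_measurable_integrable[OF int]])
          (use bump[of n] in \<open>simp add: measurable_completion\<close>)
      show "(\<lambda>x. indicator (box c d) x *\<^sub>R ?w x) \<in> borel_measurable lebesgue"
        by (rule borel_measurable_scaleR[OF _ borel_measurable_integrable[OF int]])
          (simp add: measurable_completion)
      show "AE x in lebesgue. (\<lambda>n. box_bump c d n x *\<^sub>R ?w x) \<longlonglongrightarrow> indicator (box c d) x *\<^sub>R ?w x"
        by (intro AE_I2 tendsto_scaleR box_bump_tendsto_indicator tendsto_const)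
      show "AE x in lebesgue. norm (box_bump c d n x *\<^sub>R ?w x) \<le> norm (?w x)" for n
        using box_bump_bounds[of c d n] by (intro AE_I2) (simp add: mult_left_le_one_le mult.assoc)
    qed
    moreover have "(LINT x|lebesgue. box_bump c d n x *\<^sub>R ?w x) = 0" for n
    proof -
      have "(LINT x|lebesgue. box_bump c d n x *\<^sub>R ?w x) = (LINT x:S|lebesgue. box_bump c d n x *\<^sub>R f x)"
        unfolding set_lebesgue_integral_def
        using cd box_bump_eq_0[of _ c d n] box_subset_cbox[of c d]
        by (intro Bochner_Integration.integral_cong) (auto split: split_indicator)
      with zero box_bump_test_function[OF cd] show ?thesis by simp
    qed
    ultimately have "(LINT x|lebesgue. indicator (box c d) x *\<^sub>R ?w x) = 0"
      by (simp add: LIMSEQ_const_iff)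
    moreover have "(LINT x|lebesgue. indicator (box c d) x *\<^sub>R ?w x) = (LINT x:box c d|lebesgue. f x)"
      unfolding set_lebesgue_integral_def using box_subset_cbox[of c d]
      by (intro Bochner_Integration.integral_cong) (auto split: split_indicator)
    ultimately show "(LINT x:box c d|lebesgue. f x) = 0" by simp
  qed
  obtain \<D> where D: "countable \<D>" "\<D> \<subseteq> Pow S" "\<And>X. X \<in> \<D> \<Longrightarrow> \<exists>a b. X = cbox a b" "\<Union>\<D> = S"
    using open_countable_Union_open_cbox[OF \<open>open S\<close>] by metis
  have "AE x in lebesgue. x \<in> X \<longrightarrow> f x = 0" if XD: "X \<in> \<D>" for X
  proof -
    obtain a b where X: "X = cbox a b" using D(3)[OF XD] by blast
    \<comment> \<open>The cover consists of closed boxes while the vanishing is known on open ones.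
      The faces are negligible.\<close>
    have "negligible (cbox a b - box a b)"
      by (simp add: negligible_frontier_interval)
    then have "AE x in lebesgue. x \<notin> cbox a b - box a b"
      unfolding negligible_iff_null_sets by (rule AE_not_in)
    moreover have "AE x in lebesgue. x \<in> box a b \<longrightarrow> f x = 0"
      using cb D XD X by blast
    ultimately show ?thesis
      by eventually_elim (auto simp: X)
  qed
  then have "AE x in lebesgue. \<forall>X\<in>\<D>. x \<in> X \<longrightarrow> f x = 0"
    using D(1) by (subst AE_ball_countable) auto
  then show ?thesis
    by eventually_elim (use D(4) in auto)
qed

subsection \<open>Integration by parts\<close>

text \<open>The difference quotients of \<open>f\<close> along \<open>v\<close> have integral 0
  because Lebesgue measure is translation invariant. They converge to the derivative and are
  dominated through the mean value theorem. No iterated integrals are involved.\<close>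

lemma integral_directional_derivative_eq_0:
  fixes f :: "'a::euclidean_space \<Rightarrow> real"
  assumes f': "\<And>x. (f has_derivative f' x) (at x)"
    and cont: "continuous_on UNIV (\<lambda>x. f' x v)"
    and K: "compact K" "\<And>x. x \<notin> K \<Longrightarrow> f x = 0"
  shows "((\<lambda>x. f' x v) has_integral 0) UNIV" "(\<lambda>x. f' x v) absolutely_integrable_on UNIV"
proof -
  have deriv0: "f' x v = 0" if "x \<notin> K" for x
  proof -
    have "open (- K)" using K(1) by (simp add: compact_imp_closed open_Compl)
    then have "(f has_derivative (\<lambda>_. 0)) (at x)"
      by (rule has_derivative_transform_within_open[of "\<lambda>_. 0", rotated]) (use that K(2) in auto)
    then show ?thesis using f'[of x] has_derivative_unique by metis
  qed
  obtain M where M: "\<And>x. \<bar>f' x v\<bar> \<le> M"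
  proof -
    have "bounded ((\<lambda>x. f' x v) ` K)"
      using K(1) cont by (intro compact_imp_bounded compact_continuous_image) (auto intro: continuous_on_subset)
    then obtain M where "M > 0" "\<And>x. x \<in> K \<Longrightarrow> \<bar>f' x v\<bar> \<le> M"
      by (auto simp: bounded_pos)
    then have "\<bar>f' x v\<bar> \<le> M" for x
      using deriv0[of x] by (cases "x \<in> K") auto
    then show ?thesis by (rule that)
  qed
  obtain r where r: "\<And>x. x \<in> K \<Longrightarrow> norm x \<le> r"
    using compact_imp_bounded[OF K(1)] by (auto simp: bounded_iff)
  have contf: "continuous_on UNIV f"
    using f' by (meson continuous_at_imp_continuous_on has_derivative_continuous)
  then have [measurable]: "f \<in> borel_measurable borel"
    by (rule borel_measurable_continuous_onI)
  define h where "h n = inverse (real (Suc n))" for n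
  have h: "h n > 0" "h n \<le> 1" for n
    by (auto simp: h_def inverse_le_1_iff)
  have hlim: "h \<longlonglongrightarrow> 0"
    unfolding h_def by (rule LIMSEQ_inverse_real_of_nat)
  define q where "q n x = (f (x + h n *\<^sub>R v) - f x) / h n" for n x
  have line: "((\<lambda>t. f (x + t *\<^sub>R v)) has_real_derivative f' (x + t *\<^sub>R v) v) (at t)" for x t
  proof -
    have "((\<lambda>t. f (x + t *\<^sub>R v)) has_derivative (\<lambda>s. f' (x + t *\<^sub>R v) (s *\<^sub>R v))) (at t)"
      by (rule has_derivative_compose[OF _ f']) (auto intro!: derivative_eq_intros)
    moreover have "f' (x + t *\<^sub>R v) (s *\<^sub>R v) = f' (x + t *\<^sub>R v) v * s" for s
      using f'[of "x + t *\<^sub>R v"] by (simp add: has_derivative_def linear_simps mult.commute)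
    ultimately show ?thesis by (simp add: has_field_derivative_def)
  qed
  have lim: "(\<lambda>n. q n x) \<longlonglongrightarrow> f' x v" for x
  proof -
    have "((\<lambda>t. (f (x + t *\<^sub>R v) - f x) / t) \<longlongrightarrow> f' x v) (at 0)"
      using line[of x 0] by (simp add: DERIV_def)
    then show ?thesis
      unfolding q_def
      by (rule filterlim_compose) (use h hlim in \<open>auto simp: filterlim_at intro!: always_eventually less_imp_neq[symmetric]\<close>)
  qed
  \<comment> \<open>The steps \<open>h n\<close> are at most 1, so the shifted supports stay in a
    ball whose radius exceeds that of \<open>K\<close> by the length of \<open>v\<close>.\<close>
  have bound: "\<bar>q n x\<bar> \<le> M * indicator (cball 0 (r + norm v)) x" for n x
  proof (cases "x \<in> cball 0 (r + norm v)")
    case True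
    obtain t where "f (x + h n *\<^sub>R v) - f (x + 0 *\<^sub>R v) = (h n - 0) * f' (x + t *\<^sub>R v) v"
      using MVT2[OF h(1)[of n], of "\<lambda>t. f (x + t *\<^sub>R v)" "\<lambda>t. f' (x + t *\<^sub>R v) v"] line by blast
    then have "q n x = f' (x + t *\<^sub>R v) v"
      using h(1)[of n] by (simp add: q_def)
    with M True show ?thesis by simp
  next
    case False
    have "norm (h n *\<^sub>R v) \<le> norm v"
      using h[of n] by (auto intro!: mult_left_le_one_le)
    then have "norm x \<le> norm (x + h n *\<^sub>R v) + norm v"
      using norm_triangle_ineq4[of "x + h n *\<^sub>R v" "h n *\<^sub>R v"] by simp
    then have "x \<notin> K" "x + h n *\<^sub>R v \<notin> K"
      using False r[of x] r[of "x + h n *\<^sub>R v"] norm_ge_zero[of v]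
      by (auto simp: not_le simp del: norm_ge_zero)
    with K(2) False show ?thesis by (simp add: q_def)
  qed
  have meas[measurable]: "q n \<in> borel_measurable borel" for n
    unfolding q_def by measurable
  have dom: "integrable lborel (\<lambda>x. M * indicator (cball 0 (r + norm v)) x)"
    by (intro integrable_mult_right integrable_real_indicator) (auto simp: emeasure_compact_finite[unfolded infinity_ennreal_def])
  have meas': "(\<lambda>x. f' x v) \<in> borel_measurable lborel"
    using cont by (simp add: borel_measurable_continuous_onI)
  have ae: "AE x in lborel. (\<lambda>n. q n x) \<longlonglongrightarrow> f' x v"
    "AE x in lborel. norm (q n x) \<le> M * indicator (cball 0 (r + norm v)) x" for n
    using lim bound by auto
  note dc = meas' _ dom ae
  have int: "integrable lborel (\<lambda>x. f' x v)"
    by (rule integrable_dominated_convergence[OF dc]) simp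
  have "(\<lambda>n. LINT x|lborel. q n x) \<longlonglongrightarrow> (LINT x|lborel. f' x v)"
    by (rule integral_dominated_convergence[OF dc]) simp
  moreover have "(LINT x|lborel. q n x) = 0" for n
  proof -
    have fint: "integrable lborel f"
    proof -
      have "f = (\<lambda>x. indicator K x *\<^sub>R f x)"
        using K(2) by (fastforce simp: indicator_def)
      with borel_integrable_compact[OF K(1), of f] contf show ?thesis
        by (metis continuous_on_subset subset_UNIV)
    qed
    have "(LINT x|lborel. f (h n *\<^sub>R v + x)) = (LINT x|distr lborel borel ((+) (h n *\<^sub>R v)). f x)"
      by (subst integral_distr) auto
    moreover have "integrable lborel (\<lambda>x. f (h n *\<^sub>R v + x))"
      using fint lborel_distr_plus[of "h n *\<^sub>R v"] by (subst integrable_distr_eq[of "(+) (h n *\<^sub>R v)" _ borel, symmetric]) auto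
    ultimately show ?thesis
      using fint by (simp add: q_def lborel_distr_plus add.commute)
  qed
  ultimately have "(LINT x|lborel. f' x v) = 0"
    by (simp add: LIMSEQ_const_iff)
  with int show "((\<lambda>x. f' x v) has_integral 0) UNIV"
    by (metis has_integral_integral_lborel)
  show "(\<lambda>x. f' x v) absolutely_integrable_on UNIV"
    using int meas' by (simp add: set_integrable_def integrable_completion)
qed

subsection \<open>Change of variables over an arbitrary finite index type\<close>

text \<open>A well-ordered type with as many elements as \<open>'m\<close>, so that vectors over an
  unordered index type can be reindexed by an ordered one.\<close>

typedef ('m::finite) index_order = "{..<CARD('m)}"
  by (rule exI[of _ 0]) simp

instantiation index_order :: (finite) linorder
begin
definition less_eq_index_order :: "'a index_order \<Rightarrow> 'a index_order \<Rightarrow> bool" where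
  "less_eq_index_order x y \<longleftrightarrow> Rep_index_order x \<le> Rep_index_order y"
definition less_index_order :: "'a index_order \<Rightarrow> 'a index_order \<Rightarrow> bool" where
  "less_index_order x y \<longleftrightarrow> Rep_index_order x < Rep_index_order y"
instance
  by standard (auto simp: less_eq_index_order_def less_index_order_def Rep_index_order_inject)
end

instance index_order :: (finite) finite
proof
  show "finite (UNIV :: 'a index_order set)"
  proof (rule finite_imageD[of Rep_index_order])
    show "finite (range (Rep_index_order :: 'a index_order \<Rightarrow> nat))"
      by (rule finite_subset[of _ "{..<CARD('a)}"]) (use Rep_index_order in auto)
  qed (simp add: inj_on_def Rep_index_order_inject)
qed

instance index_order :: (finite) wellorder
proof
  fix P :: "'a index_order \<Rightarrow> bool" and a
  assume step: "\<And>x. (\<And>y. y < x \<Longrightarrow> P y) \<Longrightarrow> P x"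
  show "P a"
    by (induction a rule: measure_induct_rule[of Rep_index_order])
      (rule step, simp add: less_index_order_def)
qed

lemma index_order_bij: "\<exists>f :: 'm::finite index_order \<Rightarrow> 'm. bij f"
proof -
  interpret type_definition "Rep_index_order :: 'm index_order \<Rightarrow> nat" Abs_index_order "{..<CARD('m)}"
    by (rule type_definition_index_order)
  have "CARD('m index_order) = CARD('m)" using card by simp
  then show ?thesis
    by (metis finite bij_betw_iff_card)
qed

definition reindex :: "('n \<Rightarrow> 'm) \<Rightarrow> real ^ 'm \<Rightarrow> real ^ 'n" where
  "reindex f x = (\<chi> j. x $ f j)"

lemma linear_reindex: "linear (reindex f)"
  by (auto simp: reindex_def vec_eq_iff intro!: linearI)

lemma reindex_inv1: "bij f \<Longrightarrow> reindex (inv f) (reindex f x) = x"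
  by (simp add: reindex_def bij_is_surj surj_f_inv_f)

lemma reindex_inv2: "bij f \<Longrightarrow> reindex f (reindex (inv f) x) = x"
  by (simp add: reindex_def bij_is_inj)

lemma inner_reindex: 
  fixes f :: "'n::finite \<Rightarrow> 'm::finite"
  assumes "bij f"
  shows "reindex f x \<bullet> reindex f y = x \<bullet> y"
  unfolding reindex_def inner_vec_def using sum.reindex_bij_betw[OF assms] by fastforce

lemma norm_reindex: 
  fixes f :: "'n::finite \<Rightarrow> 'm::finite"
  shows "bij f \<Longrightarrow> norm (reindex f x) = norm x"
  by (simp add: norm_eq_sqrt_inner inner_reindex)

lemma reindex_cbox:
  fixes f :: "'n::finite \<Rightarrow> 'm::finite"
  assumes "bij f"
  shows "reindex f ` cbox a b = cbox (reindex f a) (reindex f b)"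
proof (intro equalityI subsetI)
  fix y assume y: "y \<in> cbox (reindex f a) (reindex f b)"
  have "a $ i \<le> reindex (inv f) y $ i \<and> reindex (inv f) y $ i \<le> b $ i" for i
    using y assms by (auto simp: mem_box_cart reindex_def bij_is_surj surj_f_inv_f dest: spec[of _ "inv f i"])
  then have "reindex (inv f) y \<in> cbox a b" by (simp add: mem_box_cart)
  moreover have "y = reindex f (reindex (inv f) y)"
    using assms by (simp add: reindex_inv1 reindex_inv2)
  ultimately show "y \<in> reindex f ` cbox a b" by blast
qed (auto simp: mem_box_cart reindex_def)

lemma content_reindex_cbox:
  fixes f :: "'n::finite \<Rightarrow> 'm::finite"
  assumes "bij f"
  shows "measure lborel (reindex f ` cbox a b) = measure lborel (cbox a b)"
proof (cases "cbox a b = {}")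
  case False
  then have "cbox (reindex f a) (reindex f b) \<noteq> {}"
    by (metis assms image_is_empty reindex_cbox)
  then have "measure lborel (reindex f ` cbox a b) = (\<Prod>j\<in>UNIV. b $ f j - a $ f j)"
    using reindex_cbox[OF assms, of a b] content_cbox_cart[of "reindex f a" "reindex f b"]
    by (simp add: reindex_def)
  also have "\<dots> = (\<Prod>i\<in>UNIV. b $ i - a $ i)"
    by (rule prod.reindex_bij_betw[OF assms])
  finally show ?thesis using False by (simp add: content_cbox_cart)
qed simp

text \<open>Permuting coordinates maps boxes to boxes of the same content, which settles integrals
  over boxes. It is also an isometry, so the exhausting balls in the definition of the integral over
  an arbitrary set correspond to each other.\<close>

lemma has_integral_reindex:
  fixes f :: "'n::finite \<Rightarrow> 'm::finite" and h :: "real ^ 'n \<Rightarrow> 'b::euclidean_space"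
  assumes f: "bij f" and h: "(h has_integral i) S"
  shows "((\<lambda>x. h (reindex f x)) has_integral i) (reindex f -` S)"
proof -
  have f': "bij (inv f)" using f by (rule bij_imp_bij_inv)
  let ?h = "\<lambda>y. if y \<in> S then h y else 0"
  have cb: "((\<lambda>x. ?h (reindex f x)) has_integral k) (cbox (reindex (inv f) a) (reindex (inv f) b))"
    if "(?h has_integral k) (cbox a b)" for a b k
  proof -
    have "((\<lambda>x. ?h (reindex f x)) has_integral (1 / 1) *\<^sub>R k) (reindex (inv f) ` cbox a b)"
    proof (rule has_integral_twiddle[OF _ _ _ _ _ _ _ that])
      show "reindex (inv f) (reindex f x) = x" for x using f by (simp add: reindex_inv1 reindex_inv2)
      show "reindex f (reindex (inv f) x) = x" for x using f by (simp add: reindex_inv1 reindex_inv2)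
      show "continuous (at x) (reindex f)" for x by (simp add: linear_reindex linear_continuous_at linear_linear)
      show "\<exists>w z. reindex f ` cbox u v = cbox w z" for u v using reindex_cbox[OF f] by blast
      show "\<exists>w z. reindex (inv f) ` cbox u v = cbox w z" for u v using reindex_cbox[OF f'] by blast
      show "measure lborel (reindex f ` cbox u v) = 1 * measure lborel (cbox u v)" for u v
        using content_reindex_cbox[OF f] by simp
    qed simp
    then show ?thesis by (simp add: reindex_cbox f')
  qed
  note h' = has_integral_alt'[THEN iffD1, OF h]
  have int: "((\<lambda>x. ?h (reindex f x)) integrable_on cbox a b) \<and>
     integral (cbox a b) (\<lambda>x. ?h (reindex f x)) = integral (cbox (reindex f a) (reindex f b)) ?h" for a b
  proof -
    have "?h integrable_on cbox (reindex f a) (reindex f b)"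
      using h' by blast
    then have "((\<lambda>x. ?h (reindex f x)) has_integral integral (cbox (reindex f a) (reindex f b)) ?h) (cbox a b)"
      using cb[OF integrable_integral, of "reindex f a" "reindex f b"] by (simp only: reindex_inv1[OF f])
    then show ?thesis by (simp only: has_integral_iff)
  qed
  show ?thesis
    unfolding has_integral_alt'
  proof (intro conjI allI impI)
    fix e :: real assume "e > 0"
    then obtain B where B: "B > 0" "\<And>a b. ball 0 B \<subseteq> cbox a b \<Longrightarrow> norm (integral (cbox a b) ?h - i) < e"
      using h' by blast
    show "\<exists>B>0. \<forall>a b. ball 0 B \<subseteq> cbox a b \<longrightarrow>
       norm (integral (cbox a b) (\<lambda>x. if x \<in> reindex f -` S then h (reindex f x) else 0) - i) < e"
    proof (intro exI conjI allI impI)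
      show "B > 0" by fact
      fix a b :: "real ^ 'm" assume ab: "ball 0 B \<subseteq> cbox a b"
      have "ball 0 B \<subseteq> cbox (reindex f a) (reindex f b)"
      proof
        fix y :: "real ^ 'n" assume "y \<in> ball 0 B"
        then have "reindex (inv f) y \<in> cbox a b" using ab by (simp add: norm_reindex[OF f'] subset_iff)
        then have "reindex f (reindex (inv f) y) \<in> cbox (reindex f a) (reindex f b)"
          using reindex_cbox[OF f, of a b] by blast
        then show "y \<in> cbox (reindex f a) (reindex f b)" using f by (simp add: reindex_inv1 reindex_inv2)
      qed
      from B(2)[OF this] show "norm (integral (cbox a b) (\<lambda>x. if x \<in> reindex f -` S then h (reindex f x) else 0) - i) < e"
        using int[of a b] by (simp only: vimage_eq)
    qed
  qed (simp only: vimage_eq int)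
qed

lemma absolutely_integrable_reindex:
  fixes f :: "'n::finite \<Rightarrow> 'm::finite" and h :: "real ^ 'n \<Rightarrow> 'b::euclidean_space"
  assumes f: "bij f" and h: "h absolutely_integrable_on S"
  shows "(\<lambda>x. h (reindex f x)) absolutely_integrable_on (reindex f -` S)"
  using h has_integral_reindex[OF f, of h _ S] has_integral_reindex[OF f, of "\<lambda>x. norm (h x)" _ S]
  unfolding absolutely_integrable_on_def integrable_on_def by blast

text \<open>The change of variables theorem of the library wants a well-ordered index type, so it is
  transported along an enumeration of the indices. The coordinates are permuted in the determinant
  below, which does not change its value.\<close>

definition index_enum :: "'m::finite index_order \<Rightarrow> 'm" where
  "index_enum = (SOME f. bij f)"

lemma bij_index_enum: "bij index_enum"
  unfolding index_enum_def using index_order_bij by (rule someI_ex)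

definition jacobian_matrix :: "(real ^ 'm \<Rightarrow> real ^ 'm) \<Rightarrow> real ^ ('m::finite index_order) ^ ('m index_order)" where
  "jacobian_matrix L = matrix (reindex index_enum \<circ> L \<circ> reindex (inv index_enum))"

definition jacobian :: "(real ^ 'm::finite \<Rightarrow> real ^ 'm) \<Rightarrow> real" where
  "jacobian L = \<bar>det (jacobian_matrix L)\<bar>"

theorem change_of_variables_open:
  fixes G :: "real ^ 'm::finite \<Rightarrow> real ^ 'm" and h :: "real ^ 'm \<Rightarrow> real"
  assumes S: "open S" and G': "\<And>y. y \<in> S \<Longrightarrow> (G has_derivative G' y) (at y)" and inj: "inj_on G S"
    and h: "h absolutely_integrable_on G ` S"
  shows "(\<lambda>y. jacobian (G' y) * h (G y)) absolutely_integrable_on S"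
    and "integral S (\<lambda>y. jacobian (G' y) * h (G y)) = integral (G ` S) h"
proof -
  let ?f = "index_enum :: 'm index_order \<Rightarrow> 'm"
  let ?T = "reindex ?f" and ?U = "reindex (inv ?f)"
  have f: "bij ?f" by (rule bij_index_enum)
  then have f': "bij (inv ?f)" by (rule bij_imp_bij_inv)
  have UT: "?U (?T x) = x" and TU: "?T (?U z) = z" for x z
    using f by (simp_all add: reindex_inv1 reindex_inv2)
  define g where "g = ?T \<circ> G \<circ> ?U"
  define S' where "S' = ?U -` S"
  \<comment> \<open>The integrand is viewed as a vector with one coordinate, the form in which the
    change of variables theorem takes it. The coordinate is read off again at the end.\<close>
  define h' :: "_ \<Rightarrow> real ^ 1" where "h' x = vec (h (?U x))" for x
  have contU: "continuous_on UNIV ?U"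
    by (simp add: linear_continuous_on linear_reindex linear_linear)
  have S': "open S'"
    unfolding S'_def using S contU by (rule open_vimage)
  have g': "(g has_derivative (?T \<circ> G' (?U z) \<circ> ?U)) (at z within S')" if "z \<in> S'" for z
    unfolding g_def comp_def using that
    by (intro has_derivative_compose[OF _ linear_imp_has_derivative[OF linear_reindex]]
        has_derivative_compose[OF linear_imp_has_derivative[OF linear_reindex] G'])
      (simp add: S'_def)
  have inj': "inj_on g S'"
    using inj UT TU unfolding inj_on_def g_def S'_def by (metis comp_apply vimage_eq)
  have img: "g ` S' = ?U -` (G ` S)"
    unfolding g_def S'_def by (auto simp: UT) (metis TU UT comp_apply image_eqI vimage_eq)
  have bl: "bounded_linear (vec :: real \<Rightarrow> real ^ 1)" "bounded_linear (\<lambda>v :: real ^ 1. v $ 1)"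
    by (auto simp: vec_eq_iff linear_linear intro!: linearI bounded_linear_vec_nth)
  have hi: "(h has_integral integral (G ` S) h) (G ` S)"
    using set_lebesgue_integral_eq_integral(1)[OF h] by (simp add: integrable_integral)
  have "h' absolutely_integrable_on g ` S'"
    unfolding img h'_def
    using absolutely_integrable_linear[OF absolutely_integrable_reindex[OF f' h] bl(1)] by (simp add: o_def)
  moreover have hv: "(h' has_integral vec (integral (G ` S) h)) (g ` S')"
    unfolding img h'_def
    using has_integral_linear[OF has_integral_reindex[OF f' hi] bl(1)] by (simp add: o_def)
  ultimately have "(\<lambda>x. \<bar>det (matrix (?T \<circ> G' (?U x) \<circ> ?U))\<bar> *\<^sub>R h' (g x)) absolutely_integrable_on S' \<and>
     integral S' (\<lambda>x. \<bar>det (matrix (?T \<circ> G' (?U x) \<circ> ?U))\<bar> *\<^sub>R h' (g x)) = vec (integral (G ` S) h)"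
    using has_absolute_integral_change_of_variables[OF _ g' inj', of h' "vec (integral (G ` S) h)"] S'
    by (simp add: integral_unique)
  moreover have "\<bar>det (matrix (?T \<circ> G' (?U x) \<circ> ?U))\<bar> *\<^sub>R h' (g x) = vec (jacobian (G' (?U x)) * h (G (?U x)))" for x
    by (simp add: h'_def g_def UT jacobian_def jacobian_matrix_def vec_eq_iff)
  ultimately have A: "(\<lambda>x. vec (jacobian (G' (?U x)) * h (G (?U x))) :: real ^ 1) absolutely_integrable_on S'"
    and I: "integral S' (\<lambda>x. vec (jacobian (G' (?U x)) * h (G (?U x))) :: real ^ 1) = vec (integral (G ` S) h)"
    by simp_all
  have SS: "?T -` S' = S"
    by (simp add: S'_def vimage_def UT)
  from absolutely_integrable_linear[OF A bl(2)]
  have A': "(\<lambda>x. jacobian (G' (?U x)) * h (G (?U x))) absolutely_integrable_on S'"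
    by (simp add: o_def)
  from absolutely_integrable_reindex[OF f A']
  show "(\<lambda>y. jacobian (G' y) * h (G y)) absolutely_integrable_on S"
    by (simp add: UT SS)
  have "((\<lambda>x. vec (jacobian (G' (?U x)) * h (G (?U x))) :: real ^ 1) has_integral vec (integral (G ` S) h)) S'"
    using set_lebesgue_integral_eq_integral(1)[OF A] I by (simp only: has_integral_iff)
  from has_integral_linear[OF this bl(2)]
  have "((\<lambda>x. jacobian (G' (?U x)) * h (G (?U x))) has_integral integral (G ` S) h) S'"
    by (simp add: o_def)
  from has_integral_reindex[OF f this]
  show "integral S (\<lambda>y. jacobian (G' y) * h (G y)) = integral (G ` S) h"
    by (simp add: UT SS integral_unique)
qed

text \<open>The determinants of a map and of its left inverse multiply to 1. Positivity makes the
  density on the interface a nonzero multiple of the jump.\<close>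

lemma jacobian_pos:
  fixes L :: "real ^ 'm::finite \<Rightarrow> real ^ 'm"
  assumes "linear L" "linear M" "\<And>x. M (L x) = x"
  shows "jacobian L > 0"
proof -
  have lin: "linear (reindex index_enum \<circ> K \<circ> reindex (inv index_enum))" if "linear K" for K :: "real ^ 'm \<Rightarrow> real ^ 'm"
    using that by (intro linear_compose linear_reindex)
  have "jacobian_matrix M ** jacobian_matrix L =
     matrix ((reindex index_enum \<circ> M \<circ> reindex (inv index_enum)) \<circ> (reindex index_enum \<circ> L \<circ> reindex (inv index_enum)))"
    unfolding jacobian_matrix_def using lin assms by (simp only: matrix_compose)
  also have "\<dots> = matrix id"
    by (rule arg_cong[of _ _ matrix]) (auto simp: fun_eq_iff assms(3) reindex_inv1[OF bij_index_enum] reindex_inv2[OF bij_index_enum])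
  finally have "det (jacobian_matrix M ** jacobian_matrix L) = 1"
    by (simp add: matrix_id_mat_1)
  then show ?thesis
    by (auto simp: det_mul jacobian_def)
qed

text \<open>An orthogonal map has determinant 1 or -1. Applied to a reflection, this lets the
  integrals over the two sides of a chart be compared with the same weight.\<close>

lemma jacobian_comp_orthogonal:
  fixes L R :: "real ^ 'm::finite \<Rightarrow> real ^ 'm"
  assumes "linear L" "orthogonal_transformation R"
  shows "jacobian (L \<circ> R) = jacobian L"
proof -
  have R: "linear R" using assms(2) by (simp add: orthogonal_transformation_linear)
  have lin: "linear (reindex index_enum \<circ> K \<circ> reindex (inv index_enum))" if "linear K" for K :: "real ^ 'm \<Rightarrow> real ^ 'm"
    using that by (intro linear_compose linear_reindex)
  have "orthogonal_transformation (reindex index_enum \<circ> R \<circ> reindex (inv index_enum))"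
    using assms(2) lin[OF R]
    by (simp add: orthogonal_transformation norm_reindex[OF bij_index_enum] norm_reindex[OF bij_imp_bij_inv[OF bij_index_enum]])
  then have 1: "\<bar>det (jacobian_matrix R)\<bar> = 1"
    unfolding jacobian_matrix_def by simp
  have "jacobian_matrix (L \<circ> R) = jacobian_matrix L ** jacobian_matrix R"
    unfolding jacobian_matrix_def matrix_compose[OF lin[OF R] lin[OF assms(1)], symmetric]
    by (rule arg_cong[of _ _ matrix]) (auto simp: fun_eq_iff reindex_inv1[OF bij_index_enum] reindex_inv2[OF bij_index_enum])
  with 1 show ?thesis
    by (simp add: jacobian_def det_mul abs_mult)
qed

lemma continuous_on_jacobian:
  fixes G' :: "'a::topological_space \<Rightarrow> real ^ 'm::finite \<Rightarrow> real ^ 'm"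
  assumes "\<And>v. continuous_on S (\<lambda>y. G' y v)"
  shows "continuous_on S (\<lambda>y. jacobian (G' y))"
proof -
  have "continuous_on S (\<lambda>y. jacobian_matrix (G' y) $ i $ j)" for i j
    unfolding jacobian_matrix_def matrix_def reindex_def comp_def vec_lambda_beta
    by (intro continuous_on_component assms)
  then show ?thesis
    unfolding jacobian_def det_def
    by (intro continuous_on_rabs continuous_on_sum continuous_on_mult continuous_on_const continuous_on_prod)
qed

subsection \<open>Cutoffs and boundary layers\<close>

text \<open>A quadratic spline that rises from 0 to 1 on the interval from 1 to 2. It is the
  antiderivative of the tent with height 2 and apex 3/2, and has the one continuous derivative that
  the divergence theorem asks for.\<close>

definition cutoff :: "real \<Rightarrow> real" where
  "cutoff t = 2 * (max 0 (t - 1))\<^sup>2 - 4 * (max 0 (t - 3/2))\<^sup>2 + 2 * (max 0 (t - 2))\<^sup>2"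

definition cutoff_deriv :: "real \<Rightarrow> real" where
  "cutoff_deriv t = 4 * max 0 (t - 1) - 8 * max 0 (t - 3/2) + 4 * max 0 (t - 2)"

lemma DERIV_pos_part_squared: "((\<lambda>t. (max 0 (t - a))\<^sup>2) has_real_derivative 2 * max 0 (t - a)) (at t)"
proof -
  consider "t < a" | "t = a" | "t > a" by linarith
  then show ?thesis
  proof cases
    case 1
    have "((\<lambda>t. 0) has_real_derivative 0) (at t)" by simp
    then have "((\<lambda>t. (max 0 (t - a))\<^sup>2) has_real_derivative 0) (at t)"
      by (rule has_field_derivative_transform_within_open[where S="{..<a}"]) (use 1 in auto)
    then show ?thesis using 1 by simp
  next
    case 2
    \<comment> \<open>At the kink the difference quotient is \<open>max 0 h\<close>.\<close>
    have "((\<lambda>h::real. max 0 h) \<longlongrightarrow> max 0 0) (at 0)"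
      by (intro tendsto_intros)
    then have "((\<lambda>h. ((max 0 (a + h - a))\<^sup>2 - (max 0 (a - a))\<^sup>2) / h) \<longlongrightarrow> 0) (at 0)"
      by (rule Lim_transform_eventually[OF tendsto_eq_rhs])
        (auto simp: eventually_at_filter power2_eq_square max_def)
    then show ?thesis using 2 by (simp add: DERIV_def)
  next
    case 3
    have "((\<lambda>t. (t - a)\<^sup>2) has_real_derivative 2 * (t - a)) (at t)"
      by (auto intro!: derivative_eq_intros)
    then have "((\<lambda>t. (max 0 (t - a))\<^sup>2) has_real_derivative 2 * (t - a)) (at t)"
      by (rule has_field_derivative_transform_within_open[where S="{a<..}"]) (use 3 in auto)
    then show ?thesis using 3 by simp
  qed
qed

lemma DERIV_cutoff: "(cutoff has_real_derivative cutoff_deriv t) (at t)"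
  unfolding cutoff_def[abs_def] cutoff_deriv_def
  by (rule DERIV_cong, (rule derivative_intros DERIV_pos_part_squared)+) simp

lemma cutoff_eq_0: "t \<le> 1 \<Longrightarrow> cutoff t = 0"
  by (simp add: cutoff_def)

lemma cutoff_eq_1: "t \<ge> 2 \<Longrightarrow> cutoff t = 1"
  by (simp add: cutoff_def power2_eq_square algebra_simps)

lemma cutoff_deriv_nonneg: "0 \<le> cutoff_deriv t"
  by (auto simp: cutoff_deriv_def max_def)

lemma cutoff_deriv_le: "cutoff_deriv t \<le> 2"
  by (auto simp: cutoff_deriv_def max_def)

text \<open>On the middle half of its support the tent has at least half of its height.\<close>

lemma cutoff_deriv_ge: "5/4 \<le> t \<Longrightarrow> t \<le> 7/4 \<Longrightarrow> 1 \<le> cutoff_deriv t"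
  by (auto simp: cutoff_deriv_def max_def)

lemma cutoff_deriv_eq_0: "t \<le> 1 \<or> 2 \<le> t \<Longrightarrow> cutoff_deriv t = 0"
  by (auto simp: cutoff_deriv_def max_def)

lemma cutoff_mono: "s \<le> t \<Longrightarrow> cutoff s \<le> cutoff t"
  by (rule DERIV_nonneg_imp_nondecreasing) (use DERIV_cutoff cutoff_deriv_nonneg in blast)+

lemma cutoff_bounds: "0 \<le> cutoff t" "cutoff t \<le> 1"
  using cutoff_mono[of "min t 1" t] cutoff_mono[of t "max t 2"]
  by (simp_all add: cutoff_eq_0 cutoff_eq_1)

lemma continuous_on_cutoff[continuous_intros]:
  "continuous_on S f \<Longrightarrow> continuous_on S (\<lambda>x. cutoff (f x))"
  "continuous_on S f \<Longrightarrow> continuous_on S (\<lambda>x. cutoff_deriv (f x))"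
  unfolding cutoff_def cutoff_deriv_def by (intro continuous_intros; assumption)+

text \<open>The derivative of the rescaled cutoff \<open>cutoff (Suc n * t)\<close>: a one-sided
  approximation of the Dirac mass at 0, supported at positive heights of order
  \<open>1 / Suc n\<close>.\<close>

definition layer :: "nat \<Rightarrow> real \<Rightarrow> real" where
  "layer n t = real (Suc n) * cutoff_deriv (real (Suc n) * t)"

lemma layer_nonneg: "0 \<le> layer n t"
  by (simp add: layer_def cutoff_deriv_nonneg)

lemma layer_support: "layer n t \<noteq> 0 \<Longrightarrow> 0 < t \<and> t < 2 / real (Suc n)"
proof -
  assume "layer n t \<noteq> 0"
  then have "1 < real (Suc n) * t" "real (Suc n) * t < 2"
    using cutoff_deriv_eq_0[of "real (Suc n) * t"] by (fastforce simp: layer_def simp del: of_nat_Suc)+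
  then show ?thesis
    using zero_less_mult_pos[of "real (Suc n)" t]
    by (simp add: pos_less_divide_eq mult.commute[of t] del: of_nat_Suc)
qed

lemma slab_content:
  fixes q e :: "'a::euclidean_space"
  assumes e: "e \<in> Basis" and "0 \<le> \<rho>" "\<alpha> \<le> \<beta>"
  defines "a \<equiv> (\<Sum>i\<in>Basis. (if i = e then \<alpha> else q \<bullet> i - \<rho>) *\<^sub>R i)"
    and "b \<equiv> (\<Sum>i\<in>Basis. (if i = e then \<beta> else q \<bullet> i + \<rho>) *\<^sub>R i)"
  shows "measure lborel (cbox a b) = (2 * \<rho>) ^ (DIM('a) - 1) * (\<beta> - \<alpha>)"
    and "x \<in> cbox a b \<longleftrightarrow> \<alpha> \<le> x \<bullet> e \<and> x \<bullet> e \<le> \<beta> \<and> (\<forall>i\<in>Basis - {e}. \<bar>x \<bullet> i - q \<bullet> i\<bar> \<le> \<rho>)"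
proof -
  have ai: "a \<bullet> i = (if i = e then \<alpha> else q \<bullet> i - \<rho>)" "b \<bullet> i = (if i = e then \<beta> else q \<bullet> i + \<rho>)" if "i \<in> Basis" for i
    using that by (simp_all add: a_def b_def inner_sum_left_Basis)
  then show "x \<in> cbox a b \<longleftrightarrow> \<alpha> \<le> x \<bullet> e \<and> x \<bullet> e \<le> \<beta> \<and> (\<forall>i\<in>Basis - {e}. \<bar>x \<bullet> i - q \<bullet> i\<bar> \<le> \<rho>)"
    using e unfolding mem_box by (force simp: abs_le_iff)
  have "measure lborel (cbox a b) = (\<Prod>i\<in>Basis. b \<bullet> i - a \<bullet> i)"
    using assms(2,3) ai by (intro content_cbox) auto
  also have "\<dots> = (\<Prod>i\<in>Basis. if i = e then \<beta> - \<alpha> else 2 * \<rho>)"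
    using ai by (intro prod.cong) (auto simp: inner_diff_left)
  also have "\<dots> = (2 * \<rho>) ^ (DIM('a) - 1) * (\<beta> - \<alpha>)"
    using e by (subst prod.remove[of _ e]) (auto simp: card_Diff_singleton)
  finally show "measure lborel (cbox a b) = (2 * \<rho>) ^ (DIM('a) - 1) * (\<beta> - \<alpha>)" .
qed

text \<open>With \<open>N = Suc n\<close>, the layer is at most \<open>2 * N\<close> on a slab of
  thickness \<open>1 / N\<close> and vanishes off it, and it is at least \<open>N\<close> on the
  middle half of that slab. The powers of \<open>N\<close> cancel, so both bounds are independent of
  \<open>n\<close>. The condition on \<open>n\<close> places the slab inside the cube.\<close>

lemma layer_integral_bounds:
  fixes q e :: "'a::euclidean_space"
  assumes e: "e \<in> Basis" and q: "q \<bullet> e = 0" and n: "2 \<le> real (Suc n) * \<rho>" and "\<rho> > 0"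
  defines "X \<equiv> cbox (q - \<rho> *\<^sub>R One) (q + \<rho> *\<^sub>R One)"
  shows "(2 * \<rho>) ^ (DIM('a) - 1) / 2 \<le> integral X (\<lambda>y. layer n (y \<bullet> e))"
    and "integral X (\<lambda>y. layer n (y \<bullet> e)) \<le> 2 * (2 * \<rho>) ^ (DIM('a) - 1)"
proof -
  define N where "N = real (Suc n)"
  have N: "N > 0" by (simp add: N_def)
  define slab where "slab \<alpha> \<beta> = cbox (\<Sum>i\<in>Basis. (if i = e then \<alpha> else q \<bullet> i - \<rho>) *\<^sub>R i)
      (\<Sum>i\<in>Basis. (if i = e then \<beta> else q \<bullet> i + \<rho>) *\<^sub>R i)" for \<alpha> \<beta>
  have slab: "measure lborel (slab \<alpha> \<beta>) = (2 * \<rho>) ^ (DIM('a) - 1) * (\<beta> - \<alpha>)"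
    "x \<in> slab \<alpha> \<beta> \<longleftrightarrow> \<alpha> \<le> x \<bullet> e \<and> x \<bullet> e \<le> \<beta> \<and> (\<forall>i\<in>Basis - {e}. \<bar>x \<bullet> i - q \<bullet> i\<bar> \<le> \<rho>)"
    if "\<alpha> \<le> \<beta>" for \<alpha> \<beta> x
    unfolding slab_def using slab_content[OF e _ that, of \<rho>] \<open>\<rho> > 0\<close> by auto
  have X: "x \<in> X \<longleftrightarrow> (\<forall>i\<in>Basis. \<bar>x \<bullet> i - q \<bullet> i\<bar> \<le> \<rho>)" for x
    unfolding X_def mem_box by (force simp: inner_diff_left inner_add_left abs_le_iff)
  have sub: "slab \<alpha> \<beta> \<subseteq> X" if "\<alpha> \<le> \<beta>" "0 \<le> \<alpha>" "\<beta> \<le> 2 / N" for \<alpha> \<beta>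
  proof
    fix x assume "x \<in> slab \<alpha> \<beta>"
    then have x: "\<alpha> \<le> x \<bullet> e" "x \<bullet> e \<le> \<beta>" "\<forall>i\<in>Basis - {e}. \<bar>x \<bullet> i - q \<bullet> i\<bar> \<le> \<rho>"
      using slab(2)[OF that(1)] by auto
    have "2 / N \<le> \<rho>" using n N by (simp add: N_def field_simps)
    then have "\<bar>x \<bullet> e - q \<bullet> e\<bar> \<le> \<rho>" using x that q by auto
    with x show "x \<in> X" by (auto simp: X)
  qed
  have cont: "continuous_on S (\<lambda>y. layer n (y \<bullet> e))" for S :: "'a set"
    unfolding layer_def by (intro continuous_intros)
  have int: "(\<lambda>y. layer n (y \<bullet> e)) integrable_on cbox a b" for a b
    using cont by (rule integrable_continuous)
  have "(2 * \<rho>) ^ (DIM('a) - 1) / 2 = measure lborel (slab (5/4/N) (7/4/N)) * N"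
    using N by (subst slab) (auto simp: field_simps)
  also have "\<dots> = integral (slab (5/4/N) (7/4/N)) (\<lambda>y. N)"
    by (simp add: slab_def)
  also have "\<dots> \<le> integral (slab (5/4/N) (7/4/N)) (\<lambda>y. layer n (y \<bullet> e))"
  proof (rule integral_le)
    show "N \<le> layer n (y \<bullet> e)" if "y \<in> slab (5/4/N) (7/4/N)" for y
    proof -
      have "5/4/N \<le> y \<bullet> e" "y \<bullet> e \<le> 7/4/N"
        using that slab(2)[of "5/4/N" "7/4/N"] N by (auto simp: divide_right_mono)
      then have "1 \<le> cutoff_deriv (N * (y \<bullet> e))"
        using N by (intro cutoff_deriv_ge) (auto simp: field_simps)
      then show ?thesis using N by (simp add: layer_def N_def[symmetric] del: of_nat_Suc)
    qed
  qed (auto simp: slab_def int)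
  also have "\<dots> \<le> integral X (\<lambda>y. layer n (y \<bullet> e))"
    using sub[of "5/4/N" "7/4/N"] N int
    by (intro integral_subset_le) (auto simp: slab_def X_def layer_nonneg field_simps)
  finally show "(2 * \<rho>) ^ (DIM('a) - 1) / 2 \<le> integral X (\<lambda>y. layer n (y \<bullet> e))" .
  have "integral X (\<lambda>y. layer n (y \<bullet> e)) = integral X (\<lambda>y. if y \<in> slab (1/N) (2/N) then layer n (y \<bullet> e) else 0)"
  proof (rule integral_cong)
    fix y assume y: "y \<in> X"
    show "layer n (y \<bullet> e) = (if y \<in> slab (1/N) (2/N) then layer n (y \<bullet> e) else 0)"
    proof (cases "y \<in> slab (1/N) (2/N)")
      case False
      then have "\<not> (1/N \<le> y \<bullet> e \<and> y \<bullet> e \<le> 2/N)"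
        using y slab(2)[of "1/N" "2/N"] N by (auto simp: X divide_right_mono)
      then have "N * (y \<bullet> e) \<le> 1 \<or> 2 \<le> N * (y \<bullet> e)"
        using N by (auto simp: field_simps)
      then show ?thesis using False by (simp add: layer_def N_def[symmetric] cutoff_deriv_eq_0 del: of_nat_Suc)
    qed simp
  qed
  also have "\<dots> = integral (slab (1/N) (2/N)) (\<lambda>y. layer n (y \<bullet> e))"
    using sub[of "1/N" "2/N"] N by (subst integral_restrict_Int) (simp add: Int_absorb2 inf.absorb1 inf.absorb2 divide_right_mono)
  also have "\<dots> \<le> integral (slab (1/N) (2/N)) (\<lambda>y. 2 * N)"
    proof (rule integral_le)
    show "layer n (y \<bullet> e) \<le> 2 * N" for y
      using cutoff_deriv_le N by (simp add: layer_def N_def[symmetric] mult.commute del: of_nat_Suc)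
  qed (auto simp: slab_def int)
  also have "\<dots> = measure lborel (slab (1/N) (2/N)) * (2 * N)"
    by (simp add: slab_def)
  also have "\<dots> = 2 * (2 * \<rho>) ^ (DIM('a) - 1)"
    using N by (subst slab) (auto simp: field_simps)
  finally show "integral X (\<lambda>y. layer n (y \<bullet> e)) \<le> 2 * (2 * \<rho>) ^ (DIM('a) - 1)" .
qed

section \<open>The divergence theorem for fields of compact support\<close>

lemma C1_extension_by_0:
  fixes f :: "'a::euclidean_space \<Rightarrow> 'b::real_normed_vector"
  assumes S: "open S" and f': "\<And>x. x \<in> S \<Longrightarrow> (f has_derivative f' x) (at x)"
    and cont: "continuous_on S (\<lambda>x. f' x v)"
    and zero: "\<And>x. x \<notin> S \<Longrightarrow> \<exists>U. open U \<and> x \<in> U \<and> (\<forall>y\<in>U \<inter> S. f y = 0)"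
  shows "((\<lambda>x. if x \<in> S then f x else 0) has_derivative (if x \<in> S then f' x else (\<lambda>v. 0))) (at x)"
    and "continuous_on UNIV (\<lambda>x. if x \<in> S then f' x v else 0)"
proof -
  show "((\<lambda>x. if x \<in> S then f x else 0) has_derivative (if x \<in> S then f' x else (\<lambda>v. 0))) (at x)"
  proof (cases "x \<in> S")
    case True
    have "((\<lambda>x. if x \<in> S then f x else 0) has_derivative f' x) (at x)"
      by (rule has_derivative_transform_within_open[OF f'[OF True] S True]) simp
    with True show ?thesis by simp
  next
    case False
    then obtain U where U: "open U" "x \<in> U" "\<forall>y\<in>U \<inter> S. f y = 0" using zero by blast
    have "((\<lambda>x. if x \<in> S then f x else 0) has_derivative (\<lambda>v. 0)) (at x)"
      by (rule has_derivative_transform_within_open[OF _ U(1,2), of "\<lambda>_. 0"]) (use U in auto)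
    with False show ?thesis by simp
  qed
  have "isCont (\<lambda>x. if x \<in> S then f' x v else 0) x" for x
  proof (cases "x \<in> S")
    case True
    have "isCont (\<lambda>x. f' x v) x"
      using cont S True by (simp add: continuous_on_eq_continuous_at)
    moreover have "isCont (\<lambda>x. f' x v) x = isCont (\<lambda>x. if x \<in> S then f' x v else 0) x"
      using eventually_nhds_in_open[OF S True]
      by (intro isCont_cong) (auto elim!: eventually_mono)
    ultimately show ?thesis by simp
  next
    case False
    then obtain U where U: "open U" "x \<in> U" "\<forall>y\<in>U \<inter> S. f y = 0" using zero by blast
    have "f' y v = 0" if "y \<in> U \<inter> S" for y
    proof -
      have "(f has_derivative (\<lambda>v. 0)) (at y)"
        by (rule has_derivative_transform_within_open[of "\<lambda>_. 0" _ _ _ "U \<inter> S"]) (use U S that in auto)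
      then show ?thesis using f'[of y] that has_derivative_unique by (metis IntD2)
    qed
    then have "isCont (\<lambda>x. 0 :: 'b) x = isCont (\<lambda>x. if x \<in> S then f' x v else 0) x"
      using eventually_nhds_in_open[OF U(1,2)] by (intro isCont_cong) (auto elim!: eventually_mono)
    then show ?thesis by simp
  qed
  then show "continuous_on UNIV (\<lambda>x. if x \<in> S then f' x v else 0)"
    by (simp add: continuous_at_imp_continuous_on)
qed

definition trace_of :: "('a::euclidean_space \<Rightarrow> 'a) \<Rightarrow> real" where
  "trace_of L = (\<Sum>i\<in>Basis. L i \<bullet> i)"

text \<open>Each component, extended by 0, is differentiated in its own direction, which integrates
  to 0. Vanishing near the points off \<open>S\<close> and vanishing off \<open>K\<close> are
  separate conditions because \<open>K\<close> may reach across the boundary of \<open>S\<close>, as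
  the support of a test function does at the interface.\<close>

lemma divergence_integral_eq_0:
  fixes W :: "'a::euclidean_space \<Rightarrow> 'a"
  assumes S: "open S" and W': "\<And>x. x \<in> S \<Longrightarrow> (W has_derivative W' x) (at x)"
    and cont: "\<And>v. continuous_on S (\<lambda>x. W' x v)"
    and zero: "\<And>x. x \<notin> S \<Longrightarrow> \<exists>U. open U \<and> x \<in> U \<and> (\<forall>y\<in>U \<inter> S. W y = 0)"
    and K: "compact K" "\<And>x. x \<in> S \<Longrightarrow> x \<notin> K \<Longrightarrow> W x = 0"
  shows "((\<lambda>x. trace_of (W' x)) has_integral 0) S" "(\<lambda>x. trace_of (W' x)) absolutely_integrable_on S"
proof -
  have *: "((\<lambda>x. if x \<in> S then W' x i \<bullet> i else 0) has_integral 0) UNIV"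
    "(\<lambda>x. if x \<in> S then W' x i \<bullet> i else 0) absolutely_integrable_on UNIV" for i
  proof -
    let ?f' = "\<lambda>x. if x \<in> S then (\<lambda>v. W' x v \<bullet> i) else (\<lambda>v. 0)"
    have d: "((\<lambda>x. if x \<in> S then W x \<bullet> i else 0) has_derivative ?f' x) (at x)" for x
      by (rule C1_extension_by_0(1)[OF S, of "\<lambda>x. W x \<bullet> i" "\<lambda>x v. W' x v \<bullet> i"])
        (use W' cont zero in \<open>fastforce intro!: has_derivative_inner_left continuous_intros\<close>)+
    have "continuous_on UNIV (\<lambda>x. if x \<in> S then W' x i \<bullet> i else 0)"
      by (rule C1_extension_by_0(2)[OF S, of "\<lambda>x. W x \<bullet> i" "\<lambda>x v. W' x v \<bullet> i"])
        (use W' cont zero in \<open>fastforce intro!: has_derivative_inner_left continuous_intros\<close>)+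
    then have c: "continuous_on UNIV (\<lambda>x. ?f' x i)"
      by (rule continuous_on_eq) simp
    have eq: "(\<lambda>x. if x \<in> S then W' x i \<bullet> i else 0) = (\<lambda>x. ?f' x i)" by auto
    show "((\<lambda>x. if x \<in> S then W' x i \<bullet> i else 0) has_integral 0) UNIV"
     "(\<lambda>x. if x \<in> S then W' x i \<bullet> i else 0) absolutely_integrable_on UNIV"
      unfolding eq
      using integral_directional_derivative_eq_0[of "\<lambda>x. if x \<in> S then W x \<bullet> i else 0" ?f' i K] d c K by auto
  qed
  have "((\<lambda>x. \<Sum>i\<in>Basis. if x \<in> S then W' x i \<bullet> i else 0) has_integral (\<Sum>i\<in>(Basis::'a set). 0)) UNIV"
    by (intro has_integral_sum *) simp
  moreover have eq: "(\<lambda>x. \<Sum>i\<in>Basis. if x \<in> S then W' x i \<bullet> i else 0) = (\<lambda>x. if x \<in> S then trace_of (W' x) else 0)"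
    by (auto simp: trace_of_def)
  ultimately show "((\<lambda>x. trace_of (W' x)) has_integral 0) S"
    by (simp add: has_integral_restrict_UNIV)
  have "(\<lambda>x. \<Sum>i\<in>Basis. if x \<in> S then W' x i \<bullet> i else 0) absolutely_integrable_on UNIV"
    by (intro absolutely_integrable_sum *) simp
  then show "(\<lambda>x. trace_of (W' x)) absolutely_integrable_on S"
    unfolding eq by (simp add: absolutely_integrable_restrict_UNIV)
qed

definition C1_field_on :: "'a::euclidean_space set \<Rightarrow> ('a \<Rightarrow> 'b::euclidean_space) \<Rightarrow> ('a \<Rightarrow> 'a \<Rightarrow> 'b) \<Rightarrow> bool" where
  "C1_field_on S f f' \<longleftrightarrow> (\<forall>x\<in>S. (f has_derivative f' x) (at x)) \<and> (\<forall>v. continuous_on S (\<lambda>x. f' x v))"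

lemma C1_field_on_continuous: "C1_field_on S f f' \<Longrightarrow> continuous_on S f"
  unfolding C1_field_on_def by (meson continuous_at_imp_continuous_on has_derivative_continuous)

text \<open>One derivative only, so that the class is stable under multiplication by functions built
  from \<open>cutoff\<close>. The gradient is carried as an argument, which spares computing it for
  sums and products.\<close>

definition C1_compact_in :: "'a::euclidean_space set \<Rightarrow> ('a \<Rightarrow> real) \<Rightarrow> ('a \<Rightarrow> 'a) \<Rightarrow> bool" where
  "C1_compact_in S \<phi> D\<phi> \<longleftrightarrow> (\<forall>x. (\<phi> has_derivative (\<lambda>v. D\<phi> x \<bullet> v)) (at x)) \<and> continuous_on UNIV D\<phi> \<and>
     (\<exists>K. compact K \<and> K \<subseteq> S \<and> (\<forall>x. x \<notin> K \<longrightarrow> \<phi> x = 0))"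

text \<open>The product rule for the divergence of a scalar times a field, at the level of the
  derivatives.\<close>

lemma trace_of_product:
  "trace_of (\<lambda>v. (a \<bullet> v) *\<^sub>R w + c *\<^sub>R L v) = w \<bullet> a + c * trace_of L"
  unfolding trace_of_def inner_add_left sum.distrib
  by (simp add: sum_distrib_left euclidean_inner[of w a] mult.commute)

lemma C1_compact_inD_gradient_0:
  assumes "\<And>x. (\<phi> has_derivative (\<lambda>v. D\<phi> x \<bullet> v)) (at x)" "compact K" "\<And>x. x \<notin> K \<Longrightarrow> \<phi> x = 0" "x \<notin> K"
  shows "D\<phi> x = (0 :: 'a::euclidean_space)"
proof -
  have "open (- K)" using assms by (simp add: compact_imp_closed open_Compl)
  then have "(\<phi> has_derivative (\<lambda>_. 0)) (at x)"
    by (rule has_derivative_transform_within_open[of "\<lambda>_. 0", rotated]) (use assms in auto)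
  then have "(\<lambda>v. D\<phi> x \<bullet> v) = (\<lambda>_. 0)"
    using assms(1) has_derivative_unique by blast
  then show ?thesis by (metis inner_eq_zero_iff)
qed

abbreviation weak_term :: "('a::euclidean_space \<Rightarrow> 'a) \<Rightarrow> ('a \<Rightarrow> 'a \<Rightarrow> 'a) \<Rightarrow> ('a \<Rightarrow> real) \<Rightarrow> ('a \<Rightarrow> 'a) \<Rightarrow> 'a \<Rightarrow> real" where
  "weak_term N N' \<phi> D\<phi> \<equiv> \<lambda>x. N x \<bullet> D\<phi> x + \<phi> x * trace_of (N' x)"

text \<open>The divergence theorem for the product of \<phi> and \<open>N\<close>, which extends by
  0 since \<phi> has compact support in \<open>S\<close>. It serves test functions supported on one
  side, and also the integration by parts that identifies the weak gradient.\<close>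

lemma interior_divergence:
  fixes N :: "'a::euclidean_space \<Rightarrow> 'a"
  assumes S: "open S" and N: "C1_field_on S N N'" and \<phi>: "C1_compact_in S \<phi> D\<phi>"
  shows "(weak_term N N' \<phi> D\<phi> has_integral 0) S"
proof -
  obtain K where K: "compact K" "K \<subseteq> S" "\<And>x. x \<notin> K \<Longrightarrow> \<phi> x = 0"
    using \<phi> unfolding C1_compact_in_def by blast
  have \<phi>': "(\<phi> has_derivative (\<lambda>v. D\<phi> x \<bullet> v)) (at x)" "continuous_on UNIV D\<phi>" for x
    using \<phi> unfolding C1_compact_in_def by blast+
  have N': "x \<in> S \<Longrightarrow> (N has_derivative N' x) (at x)" "continuous_on S (\<lambda>x. N' x v)" for x v
    using N unfolding C1_field_on_def by blast+
  have cont: "continuous_on S N" "continuous_on S \<phi>" "continuous_on S D\<phi>"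
    using N'(1) \<phi>' by (auto intro: continuous_at_imp_continuous_on has_derivative_continuous continuous_on_subset)
  let ?W' = "\<lambda>x v. (D\<phi> x \<bullet> v) *\<^sub>R N x + \<phi> x *\<^sub>R N' x v"
  have W: "((\<lambda>x. \<phi> x *\<^sub>R N x) has_derivative ?W' x) (at x)" if "x \<in> S" for x
    by (rule has_derivative_eq_rhs[OF has_derivative_scaleR[OF \<phi>'(1) N'(1)[OF that]]]) auto
  have zero: "\<exists>U. open U \<and> x \<in> U \<and> (\<forall>y\<in>U \<inter> S. \<phi> y *\<^sub>R N y = 0)" if "x \<notin> S" for x
    using K that by (intro exI[of _ "- K"]) (auto simp: open_Compl compact_imp_closed)
  have W'c: "continuous_on S (\<lambda>x. ?W' x v)" for v
    by (intro continuous_intros cont N')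
  have [simp]: "trace_of (?W' x) = N x \<bullet> D\<phi> x + \<phi> x * trace_of (N' x)" for x
    by (rule trace_of_product)
  show "(weak_term N N' \<phi> D\<phi> has_integral 0) S"
    using divergence_integral_eq_0(1)[OF S W W'c zero K(1)] K(3) by auto
qed

subsection \<open>The layer limit on one side\<close>

text \<open>The field is multiplied by \<phi> and by a cutoff in \<open>d\<close>. The divergence of
  the product is the weak term times the cutoff plus a layer term, and it integrates to 0, so the
  layer integrals tend to minus the integral of the weak term. The function \<open>d\<close> is kept
  general so that the other side is the same statement for \<open>- d\<close> and a reflected
  parametrization.\<close>

lemma layer_limit:
  fixes G N :: "real ^ 'm \<Rightarrow> real ^ 'm::finite" and d :: "real ^ 'm \<Rightarrow> real"
  assumes V: "open V" and d: "C1_field_on V d (\<lambda>x v. Dd x \<bullet> v)"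
    and N: "C1_field_on {x \<in> V. 0 < d x} N N'"
    and \<phi>: "C1_compact_in V \<phi> D\<phi>"
    and int: "(weak_term N N' \<phi> D\<phi>) absolutely_integrable_on {x \<in> V. 0 < d x}"
    and Q: "open Q" "inj_on G Q" "G ` Q = {x \<in> V. 0 < d x}"
    and G': "\<And>y. y \<in> Q \<Longrightarrow> (G has_derivative G' y) (at y)"
    and dG: "\<And>y. y \<in> Q \<Longrightarrow> d (G y) = y \<bullet> e"
  shows "(\<lambda>y. layer n (y \<bullet> e) * (jacobian (G' y) * (\<phi> (G y) * (N (G y) \<bullet> Dd (G y))))) absolutely_integrable_on Q"
    and "(\<lambda>n. integral Q (\<lambda>y. layer n (y \<bullet> e) * (jacobian (G' y) * (\<phi> (G y) * (N (G y) \<bullet> Dd (G y))))))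
      \<longlonglongrightarrow> - integral {x \<in> V. 0 < d x} (weak_term N N' \<phi> D\<phi>)"
proof -
  define S where "S = {x \<in> V. 0 < d x}"
  define g where "g x = N x \<bullet> D\<phi> x + \<phi> x * trace_of (N' x)" for x
  obtain K where K: "compact K" "K \<subseteq> V" "\<And>x. x \<notin> K \<Longrightarrow> \<phi> x = 0"
    using \<phi> unfolding C1_compact_in_def by blast
  have \<phi>': "(\<phi> has_derivative (\<lambda>v. D\<phi> x \<bullet> v)) (at x)" "continuous_on UNIV D\<phi>" for x
    using \<phi> unfolding C1_compact_in_def by blast+
  have N': "x \<in> S \<Longrightarrow> (N has_derivative N' x) (at x)" "continuous_on S (\<lambda>x. N' x v)" for x v
    using N unfolding C1_field_on_def S_def by blast+
  have d': "x \<in> V \<Longrightarrow> (d has_derivative (\<lambda>v. Dd x \<bullet> v)) (at x)" "continuous_on V (\<lambda>x. Dd x \<bullet> v)" for x v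
    using d unfolding C1_field_on_def by blast+
  have contd: "continuous_on V d"
    using d by (rule C1_field_on_continuous)
  have S: "open S"
    using continuous_open_preimage[OF contd V open_greaterThan[of 0]] by (simp add: S_def vimage_def Int_def)
  have SV: "S \<subseteq> V" by (auto simp: S_def)
  have cont: "continuous_on S N" "continuous_on S \<phi>" "continuous_on S D\<phi>" "continuous_on S d"
    "continuous_on S (\<lambda>x. Dd x \<bullet> v)" for v
    using N'(1) \<phi>' contd d'(2) SV
    by (auto intro: continuous_at_imp_continuous_on has_derivative_continuous continuous_on_subset)
  \<comment> \<open>The cutoff vanishes where \<open>d x\<close> is at most \<open>1 / Suc n\<close>
    and tends to 1 at every point with \<open>0 < d x\<close>. Its derivative with respect to
    \<open>d x\<close> is \<open>layer n (d x)\<close>.\<close>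
  define \<eta> where "\<eta> n x = cutoff (real (Suc n) * d x)" for n x
  define \<kappa> where "\<kappa> n x = layer n (d x) * (\<phi> x * (N x \<bullet> Dd x))" for n x
  have *: "((\<lambda>x. \<eta> n x * g x + \<kappa> n x) has_integral 0) S"
    "(\<lambda>x. \<eta> n x * g x + \<kappa> n x) absolutely_integrable_on S" for n
  proof -
    let ?W = "\<lambda>x. (\<phi> x * \<eta> n x) *\<^sub>R N x"
    let ?a = "\<lambda>x. \<eta> n x *\<^sub>R D\<phi> x + (\<phi> x * layer n (d x)) *\<^sub>R Dd x"
    let ?W' = "\<lambda>x v. (?a x \<bullet> v) *\<^sub>R N x + (\<phi> x * \<eta> n x) *\<^sub>R N' x v"
    have \<eta>': "(\<eta> n has_derivative (\<lambda>v. layer n (d x) * (Dd x \<bullet> v))) (at x)" if "x \<in> S" for x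
    proof -
      have "((\<lambda>x. real (Suc n) * d x) has_derivative (\<lambda>v. real (Suc n) * (Dd x \<bullet> v))) (at x)"
        using d'(1) SV that by (intro has_derivative_mult_right) auto
      from has_derivative_compose[OF this DERIV_cutoff[unfolded has_field_derivative_def]]
      show ?thesis
        unfolding \<eta>_def[abs_def]
        by (rule has_derivative_eq_rhs) (auto simp: layer_def fun_eq_iff simp del: of_nat_Suc)
    qed
    have W: "(?W has_derivative ?W' x) (at x)" if "x \<in> S" for x
      by (rule has_derivative_eq_rhs[OF has_derivative_scaleR[OF has_derivative_mult[OF \<phi>'(1) \<eta>'[OF that]] N'(1)[OF that]]])
        (auto simp: fun_eq_iff inner_add_left algebra_simps)
    have zero: "\<exists>U. open U \<and> x \<in> U \<and> (\<forall>y\<in>U \<inter> S. ?W y = 0)" if "x \<notin> S" for x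
    proof (cases "x \<in> K")
      case False
      then show ?thesis
        using K by (intro exI[of _ "- K"]) (auto simp: open_Compl compact_imp_closed)
    next
      \<comment> \<open>A point of \<open>K\<close> outside \<open>S\<close> has \<open>d x\<close>
        at most 0, and the cutoff kills the field on the whole neighborhood where \<open>d\<close>
        is below \<open>1 / Suc n\<close>.\<close>
      case True
      with that K have x: "x \<in> V" "d x < 1 / real (Suc n)"
        by (auto simp: S_def not_less intro: le_less_trans[of _ 0])
      let ?U = "{x \<in> V. d x < 1 / real (Suc n)}"
      have "open ?U"
        using continuous_open_preimage[OF contd V open_lessThan[of "1 / real (Suc n)"]]
        by (simp add: vimage_def Int_def)
      moreover have "?W y = 0" if "y \<in> ?U" for y
      proof -
        have "real (Suc n) * d y \<le> 1"
          using that by (simp add: pos_less_divide_eq mult.commute del: of_nat_Suc)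
        then show ?thesis by (simp add: \<eta>_def cutoff_eq_0 del: of_nat_Suc)
      qed
      ultimately show ?thesis using x by (intro exI[of _ ?U]) auto
    qed
    have W'c: "continuous_on S (\<lambda>x. ?W' x v)" for v
      unfolding inner_add_left inner_scaleR_left \<eta>_def layer_def
      by (intro continuous_intros cont N')
    have tr: "trace_of (?W' x) = \<eta> n x * g x + \<kappa> n x" for x
      unfolding trace_of_product g_def \<kappa>_def by (simp add: inner_add_right algebra_simps)
    show "((\<lambda>x. \<eta> n x * g x + \<kappa> n x) has_integral 0) S"
      "(\<lambda>x. \<eta> n x * g x + \<kappa> n x) absolutely_integrable_on S"
      using divergence_integral_eq_0[OF S W W'c zero K(1)] K(3) unfolding tr by auto
  qed
  have g: "g absolutely_integrable_on S"
    using int by (simp add: S_def g_def[abs_def])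
  have \<eta>g: "(\<lambda>x. \<eta> n x * g x) absolutely_integrable_on S" for n
  proof (rule absolutely_integrable_bounded_measurable_product[OF bilinear_times _ _ _ g])
    show "S \<in> sets lebesgue" using S by auto
    show "\<eta> n \<in> borel_measurable (lebesgue_on S)"
      unfolding \<eta>_def using S by (intro continuous_imp_measurable_on_sets_lebesgue continuous_intros cont) auto
    show "bounded (\<eta> n ` S)"
      unfolding bounded_iff \<eta>_def by (rule exI[of _ 1]) (auto simp: cutoff_bounds)
  qed
  have \<kappa>: "\<kappa> n absolutely_integrable_on S" for n
    using set_integral_diff(1)[OF *(2) \<eta>g, of n n] by simp
  have \<kappa>int: "integral S (\<kappa> n) = - integral S (\<lambda>x. \<eta> n x * g x)" for n
  proof -
    have "integral S (\<lambda>x. \<eta> n x * g x + \<kappa> n x) = integral S (\<lambda>x. \<eta> n x * g x) + integral S (\<kappa> n)"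
      using \<kappa>[of n] \<eta>g[of n] by (intro integral_add) (auto simp: set_lebesgue_integral_eq_integral(1))
    with *(1)[of n] show ?thesis by (simp add: integral_unique)
  qed
  \<comment> \<open>The cutoffs lie between 0 and 1, so the integrable weak term itself
    dominates.\<close>
  have "(\<lambda>n. integral S (\<lambda>x. \<eta> n x * g x)) \<longlonglongrightarrow> integral S g"
  proof (rule dominated_convergence(2))
    show "(\<lambda>x. \<eta> n x * g x) integrable_on S" for n
      using \<eta>g[of n] by (rule set_lebesgue_integral_eq_integral(1))
    show "(\<lambda>x. \<bar>g x\<bar>) integrable_on S"
      using g by (simp add: absolutely_integrable_on_def)
    show "norm (\<eta> n x * g x) \<le> \<bar>g x\<bar>" for n x
      by (simp add: abs_mult \<eta>_def cutoff_bounds mult_left_le_one_le)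
    show "(\<lambda>n. \<eta> n x * g x) \<longlonglongrightarrow> g x" if "x \<in> S" for x
    proof -
      have "d x > 0" using that by (simp add: S_def)
      then obtain M where M: "2 < real M * d x" by (rule reals_Archimedean3[THEN spec, THEN exE])
      have "\<eta> n x = 1" if "n \<ge> M" for n
      proof -
        have "real M * d x \<le> real (Suc n) * d x" using that \<open>d x > 0\<close> by (intro mult_right_mono) auto
        with M show ?thesis by (simp add: \<eta>_def cutoff_eq_1 del: of_nat_Suc)
      qed
      then show ?thesis
        by (intro tendsto_eventually) (auto simp: eventually_sequentially)
    qed
  qed
  then have lim: "(\<lambda>n. integral S (\<kappa> n)) \<longlonglongrightarrow> - integral S g"
    unfolding \<kappa>int by (rule tendsto_minus)
  have cv: "(\<lambda>y. jacobian (G' y) * \<kappa> n (G y)) absolutely_integrable_on Q"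
    "integral Q (\<lambda>y. jacobian (G' y) * \<kappa> n (G y)) = integral S (\<kappa> n)" for n
    using change_of_variables_open[OF Q(1) G' Q(2), of "\<kappa> n"] \<kappa>[of n] unfolding Q(3) S_def[symmetric] by auto
  have eq: "jacobian (G' y) * \<kappa> n (G y) =
     layer n (y \<bullet> e) * (jacobian (G' y) * (\<phi> (G y) * (N (G y) \<bullet> Dd (G y))))" if "y \<in> Q" for y n
    using dG[OF that] by (simp add: \<kappa>_def)
  show "(\<lambda>y. layer n (y \<bullet> e) * (jacobian (G' y) * (\<phi> (G y) * (N (G y) \<bullet> Dd (G y))))) absolutely_integrable_on Q"
    using cv(1)[of n] by (rule set_integrable_cong[THEN iffD1, rotated -1]) (auto simp: eq)
  have "integral Q (\<lambda>y. layer n (y \<bullet> e) * (jacobian (G' y) * (\<phi> (G y) * (N (G y) \<bullet> Dd (G y))))) = integral S (\<kappa> n)" for n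
    unfolding cv(2)[symmetric] by (rule integral_cong) (simp add: eq)
  with lim show "(\<lambda>n. integral Q (\<lambda>y. layer n (y \<bullet> e) * (jacobian (G' y) * (\<phi> (G y) * (N (G y) \<bullet> Dd (G y))))))
      \<longlonglongrightarrow> - integral {x \<in> V. 0 < d x} (weak_term N N' \<phi> D\<phi>)"
    by (simp add: S_def g_def[abs_def])
qed

subsection \<open>Flat charts\<close>

definition mirror :: "'a::euclidean_space \<Rightarrow> 'a \<Rightarrow> 'a" where
  "mirror e y = y - (2 * (y \<bullet> e)) *\<^sub>R e"

lemma mirror_inner: "e \<in> Basis \<Longrightarrow> mirror e y \<bullet> e = - (y \<bullet> e)"
  by (simp add: mirror_def inner_diff_left)

lemma mirror_mirror: "e \<in> Basis \<Longrightarrow> mirror e (mirror e y) = y"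
  by (simp add: mirror_def inner_diff_left)

lemma mirror_fixed: "y \<bullet> e = 0 \<Longrightarrow> mirror e y = y"
  by (simp add: mirror_def)

lemma linear_mirror: "linear (mirror e)"
  by (rule linearI) (simp_all add: mirror_def algebra_simps)

lemma orthogonal_transformation_mirror: "e \<in> Basis \<Longrightarrow> orthogonal_transformation (mirror e)"
  unfolding orthogonal_transformation_def
  by (simp add: linear_mirror) (simp add: mirror_def inner_diff_left inner_diff_right inner_commute)

lemma mirror_ball:
  assumes "e \<in> Basis" "q \<bullet> e = 0"
  shows "mirror e y \<in> ball q r \<longleftrightarrow> y \<in> ball q r"
proof -
  have "norm (mirror e (q - y)) = norm (q - y)"
    using orthogonal_transformation_mirror[OF assms(1)] by (simp add: orthogonal_transformation_norm)
  then show ?thesis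
    using linear_diff[OF linear_mirror, of e q y] by (simp add: dist_norm mirror_fixed assms(2))
qed

lemma continuous_on_mirror: "continuous_on S (mirror e)"
  by (simp add: linear_continuous_on linear_mirror linear_linear)

text \<open>The points of \<open>T\<close> with \<bar>D\<bar> at least \<delta> form a compact set
  that misses the hyperplane, hence stay at a positive distance above it. Thin layers do not reach
  that height.\<close>

lemma compact_small_near_hyperplane:
  fixes D :: "'a::euclidean_space \<Rightarrow> real"
  assumes T: "compact T" "continuous_on T D" and pos: "\<And>y. y \<in> T \<Longrightarrow> 0 \<le> y \<bullet> e"
    and zero: "\<And>y. y \<in> T \<Longrightarrow> y \<bullet> e = 0 \<Longrightarrow> D y = 0" and "\<delta> > 0"
  shows "\<forall>\<^sub>F n in sequentially. \<forall>y\<in>T. layer n (y \<bullet> e) \<noteq> 0 \<longrightarrow> \<bar>D y\<bar> \<le> \<delta>"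
proof -
  define T' where "T' = {y \<in> T. \<delta> \<le> \<bar>D y\<bar>}"
  have "compact T'"
    unfolding T'_def
    using closedin_compact[OF T(1) continuous_closedin_preimage[of T "\<lambda>y. \<bar>D y\<bar>" "{\<delta>..}"]] T(2)
    by (simp add: vimage_def Int_def continuous_on_rabs)
  obtain \<epsilon> where \<epsilon>: "\<epsilon> > 0" "\<And>y. y \<in> T' \<Longrightarrow> \<epsilon> \<le> y \<bullet> e"
  proof (cases "T' = {}")
    case True
    then show ?thesis using that[of 1] by simp
  next
    case False
    obtain y0 where y0: "y0 \<in> T'" "\<And>y. y \<in> T' \<Longrightarrow> y0 \<bullet> e \<le> y \<bullet> e"
    proof -
      have "continuous_on T' (\<lambda>y. y \<bullet> e)" by (intro continuous_intros)
      from continuous_attains_inf[OF \<open>compact T'\<close> False this] show ?thesis using that by blast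
    qed
    have "y0 \<bullet> e \<noteq> 0" using y0(1) zero \<open>\<delta> > 0\<close> by (auto simp: T'_def)
    then have "y0 \<bullet> e > 0" using pos y0(1) by (force simp: T'_def)
    then show ?thesis using that y0 by blast
  qed
  obtain M :: nat where M: "2 / \<epsilon> < real M" using reals_Archimedean2 by blast
  have "\<bar>D y\<bar> \<le> \<delta>" if "n \<ge> M" "y \<in> T" "layer n (y \<bullet> e) \<noteq> 0" for n y
  proof (rule ccontr)
    assume "\<not> \<bar>D y\<bar> \<le> \<delta>"
    then have "\<epsilon> \<le> y \<bullet> e" using \<epsilon>(2) that(2) by (auto simp: T'_def)
    also have "y \<bullet> e < 2 / real (Suc n)" using layer_support[OF that(3)] by blast
    finally have "\<epsilon> * real (Suc n) < 2" by (simp add: pos_less_divide_eq del: of_nat_Suc)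
    moreover have "2 < \<epsilon> * real M" using M \<epsilon>(1) by (simp add: divide_less_eq mult.commute)
    moreover have "\<epsilon> * real M \<le> \<epsilon> * real (Suc n)" using that(1) \<epsilon>(1) by (intro mult_left_mono) auto
    ultimately show False by simp
  qed
  then show ?thesis by (auto simp: eventually_sequentially)
qed

lemma eventually_layer_scale:
  assumes "\<rho> > 0"
  shows "\<forall>\<^sub>F n in sequentially. 2 \<le> real (Suc n) * \<rho>"
proof -
  obtain M :: nat where M: "2 / \<rho> < real M" using reals_Archimedean2 by blast
  have "2 \<le> real (Suc n) * \<rho>" if "n \<ge> M" for n
  proof -
    have "2 < real M * \<rho>" using M assms by (simp add: divide_less_eq)
    also have "\<dots> \<le> real (Suc n) * \<rho>" using that assms by (intro mult_right_mono) auto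
    finally show ?thesis by simp
  qed
  then show ?thesis unfolding eventually_sequentially by blast
qed

text \<open>The interface is straightened to the hyperplane where \<open>y \<bullet> e = 0\<close>,
  with \<open>G\<close> the inverse of the chart and \<open>Dd\<close> the gradient of the flattened
  coordinate. The image is a ball centered on the hyperplane: the reflection maps it to itself, and
  its halves are convex.\<close>

locale flat_chart =
  fixes V :: "(real ^ 'm::finite) set" and q e :: "real ^ 'm" and r :: real
    and \<Psi> G :: "real ^ 'm \<Rightarrow> real ^ 'm" and G' and Dd :: "real ^ 'm \<Rightarrow> real ^ 'm"
  assumes e: "e \<in> Basis" and q: "q \<bullet> e = 0" and r: "r > 0" and V: "open V"
    and \<Psi>: "continuous_on V \<Psi>" "\<Psi> ` V = ball q r" "\<And>x. x \<in> V \<Longrightarrow> G (\<Psi> x) = x"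
    and G\<Psi>: "\<And>y. y \<in> ball q r \<Longrightarrow> \<Psi> (G y) = y"
    and G': "C1_field_on (ball q r) G G'" and jac: "\<And>y. y \<in> ball q r \<Longrightarrow> jacobian (G' y) > 0"
    and surj: "\<And>y. y \<in> ball q r \<Longrightarrow> surj (G' y)"
    and Dd: "C1_field_on V (\<lambda>x. \<Psi> x \<bullet> e) (\<lambda>x v. Dd x \<bullet> v)"
begin

definition Vpos where "Vpos = {x \<in> V. 0 < \<Psi> x \<bullet> e}"
definition Vneg where "Vneg = {x \<in> V. \<Psi> x \<bullet> e < 0}"
text \<open>The Jacobian weight turns the flux across the level sets of the flat coordinate into a
  density for Lebesgue measure in the chart.\<close>

definition flux where "flux N y = jacobian (G' y) * (N (G y) \<bullet> Dd (G y))"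
text \<open>The lower half is folded onto the upper one. On the hyperplane both terms sit at the
  same point, and the difference is \<phi> times the Jacobian times the jump in the direction of
  \<open>Dd\<close>.\<close>

definition jump_density where
  "jump_density \<phi> Np Nm y = \<phi> (G y) * flux Np y - \<phi> (G (mirror e y)) * flux Nm (mirror e y)"
definition upper where "upper = {y \<in> ball q r. 0 \<le> y \<bullet> e}"

lemma GV: "y \<in> ball q r \<Longrightarrow> G y \<in> V"
  using \<Psi>(2,3) by (metis imageE)

lemma \<Psi>Q: "x \<in> V \<Longrightarrow> \<Psi> x \<in> ball q r"
  using \<Psi>(2) by blast

lemma mirror_q: "mirror e y \<in> ball q r \<longleftrightarrow> y \<in> ball q r"
  by (rule mirror_ball[OF e q])

lemma continuous_G: "continuous_on (ball q r) G"
  using G' by (rule C1_field_on_continuous)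

lemma continuous_flux:
  assumes "continuous_on S N" "G ` Y \<subseteq> S" "Y \<subseteq> ball q r"
  shows "continuous_on Y (flux N)"
proof -
  have "continuous_on V Dd"
    using Dd unfolding C1_field_on_def by (intro continuous_on_componentwise[THEN iffD2]) auto
  moreover have "G ` Y \<subseteq> V" using assms(3) GV by blast
  moreover have G: "continuous_on Y G" using continuous_G assms(3) continuous_on_subset by blast
  ultimately have "continuous_on Y (\<lambda>y. Dd (G y))" by (metis continuous_on_compose2)
  moreover have "continuous_on Y (\<lambda>y. N (G y))" by (rule continuous_on_compose2[OF assms(1) G assms(2)])
  moreover have "continuous_on Y (\<lambda>y. jacobian (G' y))"
    using G' assms(3) unfolding C1_field_on_def by (blast intro: continuous_on_jacobian continuous_on_subset)
  ultimately show ?thesis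
    unfolding flux_def by (intro continuous_on_mult continuous_on_inner)
qed

text \<open>The one-sided limit is used twice: as it stands above, and below with the negated
  coordinate and the parametrization composed with the reflection. Both then live on the same half
  ball with the same layer and can be added.\<close>

lemma two_sided_limit:
  assumes Np: "C1_field_on Vpos Np Np'" and Nm: "C1_field_on Vneg Nm Nm'"
    and \<phi>: "C1_compact_in V \<phi> D\<phi>"
    and intp: "(weak_term Np Np' \<phi> D\<phi>) absolutely_integrable_on Vpos"
    and intm: "(weak_term Nm Nm' \<phi> D\<phi>) absolutely_integrable_on Vneg"
  defines "D \<equiv> jump_density \<phi> Np Nm"
  shows "(\<lambda>y. layer n (y \<bullet> e) * D y) integrable_on {y \<in> ball q r. 0 < y \<bullet> e}"
    and "(\<lambda>n. integral {y \<in> ball q r. 0 < y \<bullet> e} (\<lambda>y. layer n (y \<bullet> e) * D y)) \<longlonglongrightarrow>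
       - (integral Vpos (weak_term Np Np' \<phi> D\<phi>) +
          integral Vneg (weak_term Nm Nm' \<phi> D\<phi>))"
proof -
  let ?Q = "{y \<in> ball q r. 0 < y \<bullet> e}"
  have openQ: "open ?Q"
    using open_Int[OF open_ball open_halfspace_gt[of 0 e], of q r] by (simp add: Int_def inner_commute)
  have injG: "inj_on G (ball q r)" using G\<Psi> by (metis inj_onI)
  have P: "open ?Q" "inj_on G ?Q" "G ` ?Q = {x \<in> V. 0 < \<Psi> x \<bullet> e}"
  proof -
    show "G ` ?Q = {x \<in> V. 0 < \<Psi> x \<bullet> e}"
      using GV G\<Psi> \<Psi>(3) \<Psi>Q by (force simp: image_iff)
  qed (use openQ injG in \<open>auto intro: inj_on_subset\<close>)
  have G'p: "(G has_derivative G' y) (at y)" if "y \<in> ball q r" for y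
    using G' that unfolding C1_field_on_def by blast
  note L1 = layer_limit[OF V Dd Np[unfolded Vpos_def] \<phi> intp[unfolded Vpos_def] P, where G' = G' and e = e]
  let ?Gm = "\<lambda>y. G (mirror e y)" and ?Gm' = "\<lambda>y. G' (mirror e y) \<circ> mirror e"
  have M: "inj_on ?Gm ?Q" "?Gm ` ?Q = {x \<in> V. 0 < - (\<Psi> x \<bullet> e)}"
  proof -
    show "inj_on ?Gm ?Q"
      using injG mirror_mirror[OF e] mirror_q unfolding inj_on_def by (metis (no_types, lifting) mem_Collect_eq)
    show "?Gm ` ?Q = {x \<in> V. 0 < - (\<Psi> x \<bullet> e)}"
    proof (intro equalityI subsetI)
      fix x assume x: "x \<in> {x \<in> V. 0 < - (\<Psi> x \<bullet> e)}"
      then have "mirror e (\<Psi> x) \<in> ?Q" "x = ?Gm (mirror e (\<Psi> x))"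
        using \<Psi>Q by (auto simp: mirror_q mirror_inner[OF e] mirror_mirror[OF e] \<Psi>(3) simp del: mem_ball)
      then show "x \<in> ?Gm ` ?Q" by blast
    qed (use GV G\<Psi> mirror_q mirror_inner[OF e] in auto)
  qed
  have G'm: "(?Gm has_derivative ?Gm' y) (at y)" if "y \<in> ?Q" for y
    unfolding comp_def using that mirror_q
    by (intro has_derivative_compose[OF linear_imp_has_derivative[OF linear_mirror] G'p]) auto
  \<comment> \<open>Negating the coordinate negates its gradient. This is the origin of the minus
    sign between the two fluxes.\<close>
  have dm: "C1_field_on V (\<lambda>x. - (\<Psi> x \<bullet> e)) (\<lambda>x v. (- Dd x) \<bullet> v)"
    using Dd unfolding C1_field_on_def inner_minus_left
    by (intro conjI ballI allI has_derivative_minus continuous_on_minus) auto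
  have neg: "Vneg = {x \<in> V. 0 < - (\<Psi> x \<bullet> e)}" by (auto simp: Vneg_def)
  note L2 = layer_limit[OF V dm Nm[unfolded neg] \<phi> intm[unfolded neg] openQ M G'm, where e = e]
  have A: "(\<lambda>y. layer n (y \<bullet> e) * (\<phi> (G y) * flux Np y)) absolutely_integrable_on ?Q"
    "(\<lambda>n. integral ?Q (\<lambda>y. layer n (y \<bullet> e) * (\<phi> (G y) * flux Np y))) \<longlonglongrightarrow>
       - integral Vpos (weak_term Np Np' \<phi> D\<phi>)" for n
    using L1 G'p G\<Psi> by (auto simp: flux_def Vpos_def mult.left_commute mult.assoc)
  have linG: "linear (G' y)" if "y \<in> ball q r" for y
    using G'p[OF that] has_derivative_linear by blast
  have J: "jacobian (?Gm' y) = jacobian (G' (mirror e y))" if "y \<in> ?Q" for y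
    using that mirror_q by (intro jacobian_comp_orthogonal linG orthogonal_transformation_mirror e) auto
  have eq: "layer n (y \<bullet> e) * (jacobian (?Gm' y) * (\<phi> (?Gm y) * (Nm (?Gm y) \<bullet> - Dd (?Gm y)))) =
       - (layer n (y \<bullet> e) * (\<phi> (G (mirror e y)) * flux Nm (mirror e y)))" if "y \<in> ?Q" for y n
    using J[OF that] by (simp add: flux_def)
  have B: "(\<lambda>y. - (layer n (y \<bullet> e) * (\<phi> (G (mirror e y)) * flux Nm (mirror e y)))) absolutely_integrable_on ?Q"
    "(\<lambda>n. integral ?Q (\<lambda>y. - (layer n (y \<bullet> e) * (\<phi> (G (mirror e y)) * flux Nm (mirror e y))))) \<longlonglongrightarrow>
       - integral Vneg (weak_term Nm Nm' \<phi> D\<phi>)" for n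
  proof -
    have dG: "- (\<Psi> (?Gm y) \<bullet> e) = y \<bullet> e" if "y \<in> ?Q" for y
      using that mirror_q G\<Psi> by (simp add: mirror_inner[OF e])
    show "(\<lambda>y. - (layer n (y \<bullet> e) * (\<phi> (G (mirror e y)) * flux Nm (mirror e y)))) absolutely_integrable_on ?Q"
      by (rule set_integrable_cong[THEN iffD1, OF refl refl eq L2(1)[of n]]) (use dG in auto)
    have "integral ?Q (\<lambda>y. - (layer n (y \<bullet> e) * (\<phi> (G (mirror e y)) * flux Nm (mirror e y)))) =
      integral ?Q (\<lambda>y. layer n (y \<bullet> e) * (jacobian (?Gm' y) * (\<phi> (?Gm y) * (Nm (?Gm y) \<bullet> - Dd (?Gm y)))))" for n
      by (rule integral_cong) (rule eq[symmetric])
    with L2(2)[OF _ dG] show "(\<lambda>n. integral ?Q (\<lambda>y. - (layer n (y \<bullet> e) * (\<phi> (G (mirror e y)) * flux Nm (mirror e y))))) \<longlonglongrightarrow>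
       - integral Vneg (weak_term Nm Nm' \<phi> D\<phi>)"
      by (simp add: neg)
  qed
  have Deq: "layer n (y \<bullet> e) * D y = layer n (y \<bullet> e) * (\<phi> (G y) * flux Np y) +
     - (layer n (y \<bullet> e) * (\<phi> (G (mirror e y)) * flux Nm (mirror e y)))" for n y
    by (simp add: D_def jump_density_def right_diff_distrib)
  have int: "(\<lambda>y. layer n (y \<bullet> e) * (\<phi> (G y) * flux Np y)) integrable_on ?Q"
    "(\<lambda>y. - (layer n (y \<bullet> e) * (\<phi> (G (mirror e y)) * flux Nm (mirror e y)))) integrable_on ?Q" for n
    using A(1) B(1) by (auto intro: set_lebesgue_integral_eq_integral(1))
  show "(\<lambda>y. layer n (y \<bullet> e) * D y) integrable_on ?Q"
    unfolding Deq by (intro integrable_add int)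
  show "(\<lambda>n. integral ?Q (\<lambda>y. layer n (y \<bullet> e) * D y)) \<longlonglongrightarrow>
       - (integral Vpos (weak_term Np Np' \<phi> D\<phi>) +
          integral Vneg (weak_term Nm Nm' \<phi> D\<phi>))"
    unfolding Deq integral_add[OF int]
    by (rule tendsto_eq_rhs[OF tendsto_add[OF A(2) B(2)]]) simp
qed


lemma continuous_flux_upper:
  assumes "continuous_on {x \<in> V. 0 \<le> \<Psi> x \<bullet> e} Np" "continuous_on {x \<in> V. \<Psi> x \<bullet> e \<le> 0} Nm"
  shows "continuous_on upper (flux Np)" "continuous_on upper (\<lambda>y. flux Nm (mirror e y))"
proof -
  show "continuous_on upper (flux Np)"
    by (rule continuous_flux[OF assms(1)]) (auto simp: upper_def GV G\<Psi> simp del: mem_ball)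
  have "continuous_on {y \<in> ball q r. y \<bullet> e \<le> 0} (flux Nm)"
    by (rule continuous_flux[OF assms(2)]) (auto simp: GV G\<Psi> simp del: mem_ball)
  then show "continuous_on upper (\<lambda>y. flux Nm (mirror e y))"
    by (rule continuous_on_compose2[OF _ continuous_on_mirror])
      (auto simp: upper_def mirror_q mirror_inner[OF e] simp del: mem_ball)
qed

lemma continuous_upper:
  assumes "continuous_on UNIV \<phi>"
  shows "continuous_on upper (\<lambda>y. \<phi> (G y))" "continuous_on upper (\<lambda>y. \<phi> (G (mirror e y)))"
proof -
  have "continuous_on (ball q r) (\<lambda>y. \<phi> (G y))"
    by (rule continuous_on_compose2[OF assms continuous_G]) simp
  moreover have "upper \<subseteq> ball q r" "mirror e ` upper \<subseteq> ball q r"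
    by (auto simp: upper_def mirror_q simp del: mem_ball)
  ultimately show "continuous_on upper (\<lambda>y. \<phi> (G y))" "continuous_on upper (\<lambda>y. \<phi> (G (mirror e y)))"
    by (auto intro: continuous_on_subset continuous_on_compose2[OF _ continuous_on_mirror])
qed

text \<open>The set is the image of the support together with its mirror image, cut off at the
  hyperplane, since the density evaluates \<phi> at both a point and its reflection.\<close>

lemma compact_upper_support:
  assumes K: "compact K" "K \<subseteq> V" "\<And>x. x \<notin> K \<Longrightarrow> \<phi> x = 0"
  obtains T where "compact T" "T \<subseteq> upper"
    "\<forall>y\<in>upper - T. \<phi> (G y) = 0 \<and> \<phi> (G (mirror e y)) = 0"
proof
  define C where "C = \<Psi> ` K"
  define T where "T = (C \<union> mirror e ` C) \<inter> {y. 0 \<le> y \<bullet> e}"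
  have C: "compact C" "C \<subseteq> ball q r"
    unfolding C_def using K \<Psi> by (auto intro: compact_continuous_image continuous_on_subset simp del: mem_ball)
  show "compact T"
    unfolding T_def using C(1)
    by (intro compact_Int_closed compact_Un compact_continuous_image continuous_on_mirror)
      (simp_all add: inner_commute[of _ e] closed_halfspace_ge)
  show "T \<subseteq> upper"
    using C(2) mirror_q unfolding T_def upper_def by blast
  show "\<forall>y\<in>upper - T. \<phi> (G y) = 0 \<and> \<phi> (G (mirror e y)) = 0"
  proof
    fix y assume "y \<in> upper - T"
    then have y: "y \<in> upper" "y \<notin> T" by auto
    have "z \<in> C" if "z \<in> ball q r" "\<phi> (G z) \<noteq> 0" for z
      using that K(3)[of "G z"] G\<Psi>[OF that(1)] unfolding C_def by force
    moreover have "y \<notin> C" "mirror e y \<notin> C"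
      using y mirror_mirror[OF e, of y] unfolding T_def upper_def by (auto simp: image_iff)
    ultimately show "\<phi> (G y) = 0 \<and> \<phi> (G (mirror e y)) = 0"
      using y(1) mirror_q unfolding upper_def by blast
  qed
qed

section \<open>Layer estimates without and with a jump\<close>

definition big where "big = cbox (q - r *\<^sub>R One) (q + r *\<^sub>R One)"

lemma ball_subset_big: "ball q r \<subseteq> big"
proof
  fix y assume "y \<in> ball q r"
  then have "\<bar>(y - q) \<bullet> i\<bar> \<le> r" if "i \<in> Basis" for i
    using Basis_le_norm[OF that, of "y - q"] by (simp add: dist_norm norm_minus_commute)
  then show "y \<in> big"
    unfolding big_def mem_box by (fastforce simp: inner_diff_left inner_add_left abs_le_iff)
qed

lemma integrable_layer: "(\<lambda>y. c * layer n (y \<bullet> e)) integrable_on cbox a b"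
  unfolding layer_def by (intro integrable_continuous continuous_intros)

text \<open>An upper bound for the mass of the layer over the ball, read off from a cube that
  contains it.\<close>

lemma integral_layer_big:
  "\<forall>\<^sub>F n in sequentially. integral big (\<lambda>y. layer n (y \<bullet> e)) \<le> 2 * (2 * r) ^ (DIM(real ^ 'm) - 1)"
  using layer_integral_bounds(2)[OF e q _ r] unfolding big_def
  by (intro eventually_mono[OF eventually_layer_scale[OF r]])

text \<open>The density is continuous up to the hyperplane and vanishes there, so it is uniformly
  small on thin layers, while the mass of the layers stays bounded. The limit is therefore
  0.\<close>

lemma no_jump_imp_zero:
  assumes Np: "C1_field_on Vpos Np Np'" "continuous_on {x \<in> V. 0 \<le> \<Psi> x \<bullet> e} Np"
    and Nm: "C1_field_on Vneg Nm Nm'" "continuous_on {x \<in> V. \<Psi> x \<bullet> e \<le> 0} Nm"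
    and \<phi>: "C1_compact_in V \<phi> D\<phi>"
    and intp: "(weak_term Np Np' \<phi> D\<phi>) absolutely_integrable_on Vpos"
    and intm: "(weak_term Nm Nm' \<phi> D\<phi>) absolutely_integrable_on Vneg"
    and jump: "\<And>x. x \<in> V \<Longrightarrow> \<Psi> x \<bullet> e = 0 \<Longrightarrow> (Np x - Nm x) \<bullet> Dd x = 0"
  shows "integral Vpos (weak_term Np Np' \<phi> D\<phi>) +
          integral Vneg (weak_term Nm Nm' \<phi> D\<phi>) = 0" (is "?L = 0")
proof -
  let ?Q = "{y \<in> ball q r. 0 < y \<bullet> e}" and ?D = "jump_density \<phi> Np Nm"
  note lim = two_sided_limit[OF Np(1) Nm(1) \<phi> intp intm]
  obtain K where K: "compact K" "K \<subseteq> V" "\<And>x. x \<notin> K \<Longrightarrow> \<phi> x = 0"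
    using \<phi> unfolding C1_compact_in_def by blast
  have \<phi>c: "continuous_on UNIV \<phi>"
    using \<phi> unfolding C1_compact_in_def
    by (meson continuous_at_imp_continuous_on has_derivative_continuous)
  obtain T where T: "compact T" "T \<subseteq> upper"
    "\<forall>y\<in>upper - T. \<phi> (G y) = 0 \<and> \<phi> (G (mirror e y)) = 0"
    by (rule compact_upper_support[OF K])
  have D0: "?D y = 0" if "y \<in> upper" "y \<notin> T" for y
    using T(3) that by (simp add: jump_density_def)
  have D00: "?D y = 0" if "y \<in> T" "y \<bullet> e = 0" for y
  proof -
    have "G y \<in> V" "\<Psi> (G y) = y" using that T(2) GV G\<Psi> unfolding upper_def by blast+
    then have "flux Np y = flux Nm y"
      using jump[of "G y"] that(2) by (simp add: flux_def inner_diff_left)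
    then show ?thesis using that(2) by (simp add: jump_density_def mirror_fixed)
  qed
  have contD: "continuous_on T ?D"
    unfolding jump_density_def using T(2)
    by (intro continuous_on_subset[OF _ T(2)] continuous_on_diff continuous_on_mult
        continuous_flux_upper[OF Np(2) Nm(2)] continuous_upper \<phi>c)
  define c where "c = 2 * (2 * r) ^ (DIM(real ^ 'm) - 1)"
  have c: "c > 0" using r by (simp add: c_def)
  have small: "\<forall>\<^sub>F n in sequentially. \<bar>integral ?Q (\<lambda>y. layer n (y \<bullet> e) * ?D y)\<bar> \<le> \<epsilon>" if "\<epsilon> > 0" for \<epsilon>
  proof -
    \<comment> \<open>The tolerance is divided by the bound \<open>c\<close> for the mass of the
      layer, so that the product comes out as \<epsilon>.\<close>
    have "\<epsilon> / c > 0" using that c by simp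
    then have "\<forall>\<^sub>F n in sequentially. \<forall>y\<in>T. layer n (y \<bullet> e) \<noteq> 0 \<longrightarrow> \<bar>?D y\<bar> \<le> \<epsilon> / c"
      using T(2) by (intro compact_small_near_hyperplane[OF T(1) contD _ D00]) (auto simp: upper_def)
    with integral_layer_big show ?thesis
    proof eventually_elim
      case (elim n)
      have "norm (integral UNIV (\<lambda>y. if y \<in> ?Q then layer n (y \<bullet> e) * ?D y else 0))
         \<le> integral UNIV (\<lambda>y. if y \<in> big then \<epsilon> / c * layer n (y \<bullet> e) else 0)"
      proof (rule integral_norm_bound_integral)
        show "(\<lambda>y. if y \<in> ?Q then layer n (y \<bullet> e) * ?D y else 0) integrable_on UNIV"
          using lim(1) by (simp only: integrable_restrict_UNIV)
        show "(\<lambda>y. if y \<in> big then \<epsilon> / c * layer n (y \<bullet> e) else 0) integrable_on UNIV"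
          unfolding integrable_restrict_UNIV big_def
          by (intro integrable_layer)
        fix y :: "real ^ 'm"
        have "\<bar>layer n (y \<bullet> e) * ?D y\<bar> \<le> \<epsilon> / c * layer n (y \<bullet> e)" if "y \<in> upper"
        proof (cases "layer n (y \<bullet> e) = 0")
          case False
          then have "\<bar>?D y\<bar> \<le> \<epsilon> / c"
            using D0[OF that] elim(2) c \<open>\<epsilon> > 0\<close> by (cases "y \<in> T") auto
          from mult_right_mono[OF this layer_nonneg[of n "y \<bullet> e"]] show ?thesis
            using layer_nonneg[of n "y \<bullet> e"] by (simp add: abs_mult mult.commute)
        qed simp
        then show "norm (if y \<in> ?Q then layer n (y \<bullet> e) * ?D y else 0) \<le> (if y \<in> big then \<epsilon> / c * layer n (y \<bullet> e) else 0)"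
          using ball_subset_big c \<open>\<epsilon> > 0\<close> layer_nonneg[of n "y \<bullet> e"] by (auto simp: upper_def)
      qed
      also have "\<dots> = \<epsilon> / c * integral big (\<lambda>y. layer n (y \<bullet> e))"
        by (simp only: integral_restrict_UNIV integral_mult_right)
      also have "\<dots> \<le> \<epsilon> / c * c"
        using elim(1) c \<open>\<epsilon> > 0\<close> by (intro mult_left_mono) (auto simp: c_def)
      finally show ?case using c by (simp only: integral_restrict_UNIV) simp
    qed
  qed
  have "(\<lambda>n. integral ?Q (\<lambda>y. layer n (y \<bullet> e) * ?D y)) \<longlonglongrightarrow> 0"
  proof (rule tendstoI)
    fix \<epsilon> :: real assume "\<epsilon> > 0"
    then have "\<epsilon> / 2 > 0" by simp
    from small[OF this] show "\<forall>\<^sub>F n in sequentially. dist (integral ?Q (\<lambda>y. layer n (y \<bullet> e) * ?D y)) 0 < \<epsilon>"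
      unfolding dist_real_def diff_zero by (rule eventually_mono) (use \<open>\<epsilon> > 0\<close> in linarith)
  qed
  with lim(2) have "- ?L = 0" by (rule LIMSEQ_unique)
  then show ?thesis by simp
qed

text \<open>The density splits into \<phi> times a flux difference, which is nonnegative and bounded
  below near \<open>q\<close>, and an error from the asymmetry of \<phi> under the reflection. The
  error vanishes on the hyperplane, so thin layers see it only as a fraction of the main part. The
  layer integrals approximate the negated sum, hence the sign in the conclusion.\<close>

lemma jump_imp_nonzero:
  assumes Np: "C1_field_on Vpos Np Np'" "continuous_on {x \<in> V. 0 \<le> \<Psi> x \<bullet> e} Np"
    and Nm: "C1_field_on Vneg Nm Nm'" "continuous_on {x \<in> V. \<Psi> x \<bullet> e \<le> 0} Nm"
    and \<phi>: "C1_compact_in V \<phi> D\<phi>" "\<And>x. 0 \<le> \<phi> x" "\<phi> (G q) > 0"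
    and intp: "(weak_term Np Np' \<phi> D\<phi>) absolutely_integrable_on Vpos"
    and intm: "(weak_term Nm Nm' \<phi> D\<phi>) absolutely_integrable_on Vneg"
    and jump: "a > 0" "\<And>y. y \<in> upper \<Longrightarrow> \<phi> (G y) \<noteq> 0 \<Longrightarrow> a \<le> flux Np y - flux Nm (mirror e y)"
  shows "integral Vpos (weak_term Np Np' \<phi> D\<phi>) +
          integral Vneg (weak_term Nm Nm' \<phi> D\<phi>) < 0" (is "?L < 0")
proof -
  let ?Q = "{y \<in> ball q r. 0 < y \<bullet> e}" and ?D = "jump_density \<phi> Np Nm"
  \<comment> \<open>The asymmetry error: \<open>jump_density\<close> is \<open>\<phi> (G y)\<close>
    times the flux difference plus this term.\<close>
  let ?E = "\<lambda>y. (\<phi> (G y) - \<phi> (G (mirror e y))) * flux Nm (mirror e y)"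
  note lim = two_sided_limit[OF Np(1) Nm(1) \<phi>(1) intp intm]
  obtain K where K: "compact K" "K \<subseteq> V" "\<And>x. x \<notin> K \<Longrightarrow> \<phi> x = 0"
    using \<phi>(1) unfolding C1_compact_in_def by blast
  have \<phi>c: "continuous_on UNIV \<phi>"
    using \<phi>(1) unfolding C1_compact_in_def
    by (meson continuous_at_imp_continuous_on has_derivative_continuous)
  obtain T where T: "compact T" "T \<subseteq> upper"
    "\<forall>y\<in>upper - T. \<phi> (G y) = 0 \<and> \<phi> (G (mirror e y)) = 0"
    by (rule compact_upper_support[OF K])
  have E0: "?E y = 0" if "y \<in> upper" "y \<notin> T" for y
    using T(3) that by simp
  have E00: "?E y = 0" if "y \<in> T" "y \<bullet> e = 0" for y
    using that(2) by (simp add: mirror_fixed)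
  have contE: "continuous_on T ?E"
    by (intro continuous_on_subset[OF _ T(2)] continuous_on_diff continuous_on_mult
        continuous_flux_upper[OF Np(2) Nm(2)] continuous_upper \<phi>c)
  have qQ: "q \<in> ball q r" using r by simp
  have "isCont (\<lambda>y. \<phi> (G y)) q"
    using continuous_on_compose2[OF \<phi>c continuous_G] qQ
    by (simp add: continuous_on_eq_continuous_at del: mem_ball)
  then have "\<forall>\<^sub>F y in nhds q. \<phi> (G q) / 2 < \<phi> (G y)"
    using \<phi>(3) tendsto_at_iff_tendsto_nhds[of "\<lambda>y. \<phi> (G y)" q]
    by (intro order_tendstoD(1)[of _ "\<phi> (G q)"]) (auto simp: isCont_def)
  then have "\<forall>\<^sub>F y in nhds q. \<phi> (G q) / 2 < \<phi> (G y) \<and> y \<in> ball q r"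
    using eventually_nhds_in_open[OF open_ball qQ] by (rule eventually_conj)
  then obtain U where U: "open U" "q \<in> U" "\<And>y. y \<in> U \<Longrightarrow> \<phi> (G q) / 2 < \<phi> (G y) \<and> y \<in> ball q r"
    unfolding eventually_nhds by blast
  obtain \<rho> where \<rho>: "\<rho> > 0" "cbox (q - \<rho> *\<^sub>R One) (q + \<rho> *\<^sub>R One) \<subseteq> U"
  proof -
    obtain \<epsilon> where \<epsilon>: "\<epsilon> > 0" "ball q \<epsilon> \<subseteq> U"
      using U(1,2) open_contains_ball by blast
    \<comment> \<open>The Euclidean norm is at most the sum of the absolute coordinates, so a cube
      with this half side lies in the ball of radius \<epsilon>.\<close>
    define \<rho> where "\<rho> = \<epsilon> / (2 * real (DIM(real ^ 'm)))"
    have dim: "real (DIM(real ^ 'm)) > 0" using DIM_positive[where 'a="real ^ 'm"] by (simp only: of_nat_0_less_iff)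
    have \<rho>: "\<rho> > 0" "real (DIM(real ^ 'm)) * \<rho> = \<epsilon> / 2" using \<epsilon>(1) dim by (auto simp: \<rho>_def)
    have "y \<in> ball q \<epsilon>" if "y \<in> cbox (q - \<rho> *\<^sub>R One) (q + \<rho> *\<^sub>R One)" for y
    proof -
      have "\<bar>(y - q) \<bullet> i\<bar> \<le> \<rho>" if "i \<in> Basis" for i
        using \<open>y \<in> _\<close> that unfolding mem_box by (auto simp: inner_diff_left inner_add_left abs_le_iff algebra_simps)
      then have "norm (y - q) \<le> (\<Sum>i\<in>(Basis :: (real ^ 'm) set). \<rho>)"
        by (intro order.trans[OF norm_le_l1] sum_mono)
      also have "\<dots> < \<epsilon>" using \<rho> \<epsilon>(1) by (simp only: sum_constant)
      finally show ?thesis by (simp add: dist_norm norm_minus_commute)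
    qed
    with that[OF \<rho>(1)] \<epsilon>(2) show ?thesis by blast
  qed
  define X where "X = cbox (q - \<rho> *\<^sub>R One) (q + \<rho> *\<^sub>R One)"
  define c where "c = 2 * (2 * r) ^ (DIM(real ^ 'm) - 1)"
  \<comment> \<open>On the cube \<open>X\<close> the main part of the density is at least
    \<open>b\<close>, and \<open>l\<close> bounds the mass of the layer over \<open>X\<close> from
    below. The tolerance \<delta> below makes the error, \<delta> times the upper mass bound
    \<open>c\<close>, half of the gain \<open>b * l\<close>.\<close>
  define b where "b = a * (\<phi> (G q) / 2)"
  define l where "l = (2 * \<rho>) ^ (DIM(real ^ 'm) - 1) / 2"
  have pos: "c > 0" "b > 0" "l > 0" using r \<rho> jump(1) \<phi>(3) by (auto simp: c_def b_def l_def)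
  define \<delta> where "\<delta> = b * l / 2 / c"
  have \<delta>: "\<delta> > 0" using pos by (simp add: \<delta>_def)
  have ev1: "\<forall>\<^sub>F n in sequentially. \<forall>y\<in>T. layer n (y \<bullet> e) \<noteq> 0 \<longrightarrow> \<bar>?E y\<bar> \<le> \<delta>"
    using T(2) \<delta> by (intro compact_small_near_hyperplane[OF T(1) contE _ E00]) (auto simp: upper_def)
  have ev2: "\<forall>\<^sub>F n in sequentially. l \<le> integral X (\<lambda>y. layer n (y \<bullet> e))"
    using layer_integral_bounds(1)[OF e q _ \<rho>(1)] unfolding X_def l_def
    by (intro eventually_mono[OF eventually_layer_scale[OF \<rho>(1)]])
  have "\<forall>\<^sub>F n in sequentially. b * l / 2 \<le> integral ?Q (\<lambda>y. layer n (y \<bullet> e) * ?D y)"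
    using ev1 ev2 integral_layer_big
  proof eventually_elim
    case (elim n)
    let ?lo1 = "\<lambda>y. if y \<in> X then b * layer n (y \<bullet> e) else 0"
    let ?lo2 = "\<lambda>y. if y \<in> big then \<delta> * layer n (y \<bullet> e) else 0"
    have int: "?lo1 integrable_on UNIV" "?lo2 integrable_on UNIV"
      unfolding integrable_restrict_UNIV big_def X_def
      by (intro integrable_layer)+
    have "b * l - \<delta> * c \<le> b * integral X (\<lambda>y. layer n (y \<bullet> e)) - \<delta> * integral big (\<lambda>y. layer n (y \<bullet> e))"
      using elim pos \<delta> by (intro diff_mono mult_left_mono) (auto simp: c_def)
    also have "\<dots> = integral UNIV ?lo1 - integral UNIV ?lo2"
      by (simp only: integral_restrict_UNIV integral_mult_right)
    also have "\<dots> = integral UNIV (\<lambda>y. ?lo1 y - ?lo2 y)"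
      by (rule integral_diff[OF int, symmetric])
    also have "\<dots> \<le> integral UNIV (\<lambda>y. if y \<in> ?Q then layer n (y \<bullet> e) * ?D y else 0)"
    proof (rule integral_le)
      show "(\<lambda>y. ?lo1 y - ?lo2 y) integrable_on UNIV" by (rule integrable_diff[OF int])
      show "(\<lambda>y. if y \<in> ?Q then layer n (y \<bullet> e) * ?D y else 0) integrable_on UNIV"
        using lim(1) by (simp only: integrable_restrict_UNIV)
      fix y :: "real ^ 'm"
      show "?lo1 y - ?lo2 y \<le> (if y \<in> ?Q then layer n (y \<bullet> e) * ?D y else 0)"
      proof (cases "layer n (y \<bullet> e) = 0")
        case False
        then have lay: "layer n (y \<bullet> e) > 0" "y \<bullet> e > 0"
          using layer_nonneg[of n "y \<bullet> e"] layer_support by auto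
        show ?thesis
        proof (cases "y \<in> ball q r")
          case True
          then have y: "y \<in> upper" "y \<in> big" "y \<in> ?Q" using lay ball_subset_big by (auto simp: upper_def)
          have "\<bar>?E y\<bar> \<le> \<delta>" using elim(1) E0[OF y(1)] False \<delta> by (cases "y \<in> T") auto
          moreover have "(if y \<in> X then b else 0) \<le> \<phi> (G y) * (flux Np y - flux Nm (mirror e y))"
          proof (cases "\<phi> (G y) = 0")
            case True
            then have "y \<notin> X" using U(3)[of y] \<rho>(2) \<phi>(3) by (auto simp: X_def)
            with True show ?thesis by simp
          next
            case False
            then have j: "a \<le> flux Np y - flux Nm (mirror e y)" by (rule jump(2)[OF y(1)])
            have "b \<le> \<phi> (G y) * (flux Np y - flux Nm (mirror e y))" if "y \<in> X"
            proof -
              have "\<phi> (G q) / 2 \<le> \<phi> (G y)" using that U(3)[of y] \<rho>(2) by (auto simp: X_def)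
              from mult_mono[OF j this] show ?thesis
                using \<phi>(2,3) jump(1) j by (simp add: b_def mult.commute)
            qed
            moreover have "0 \<le> \<phi> (G y) * (flux Np y - flux Nm (mirror e y))"
              using \<phi>(2) jump(1) j by simp
            ultimately show ?thesis by simp
          qed
          ultimately have "(if y \<in> X then b else 0) - \<delta> \<le> ?D y"
            unfolding jump_density_def by (simp add: algebra_simps abs_le_iff)
          then have "((if y \<in> X then b else 0) - \<delta>) * layer n (y \<bullet> e) \<le> ?D y * layer n (y \<bullet> e)"
            using lay by (intro mult_right_mono) auto
          then show ?thesis using y by (auto simp: algebra_simps)
        next
          case False
          then have "y \<notin> X" using U(3)[of y] \<rho>(2) by (auto simp: X_def simp del: mem_ball)
          with False show ?thesis using \<delta> lay by simp
        qed
      qed simp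
    qed
    finally show ?case
      unfolding integral_restrict_UNIV using pos by (simp add: \<delta>_def)
  qed
  with lim(2) have "b * l / 2 \<le> - ?L"
    by (intro tendsto_lowerbound[of _ _ sequentially]) auto
  moreover have "b * l / 2 > 0" using pos by simp
  ultimately show ?thesis by simp
qed

end

subsection \<open>Geometry of flat charts\<close>

text \<open>\<open>Ck_on\<close> differentiates within \<open>S\<close>, and \<open>S\<close> may
  fail to be open when it is an open set minus a hypersurface. On an open subset the derivative
  within \<open>S\<close> is the ordinary one.\<close>

lemma Ck_on_1_imp_C1_field_on:
  fixes f :: "'a::euclidean_space \<Rightarrow> 'b::euclidean_space"
  assumes W: "open W" "W \<subseteq> S" and f: "Ck_on 1 f S"
  shows "C1_field_on W f (\<lambda>x. frechet_derivative f (at x within S))"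
  unfolding C1_field_on_def
proof (intro conjI ballI allI)
  fix x assume x: "x \<in> W"
  have "f differentiable (at x within S)" using f x W(2) by (auto simp: differentiable_on_def)
  then have "(f has_derivative frechet_derivative f (at x within S)) (at x within S)"
    by (simp only: frechet_derivative_works)
  moreover have "at x within S = at x"
    by (rule at_within_interior) (meson W x interiorI)
  ultimately show "(f has_derivative frechet_derivative f (at x within S)) (at x)" by simp
next
  show "continuous_on W (\<lambda>x. frechet_derivative f (at x within S) v)" for v
    using f W(2) by (auto intro: continuous_on_subset)
qed

context flat_chart
begin

text \<open>Composing with the reflection exchanges the two sides, so the chart can be oriented at
  will.\<close>

lemma mirrored: "flat_chart V q e r (\<lambda>x. mirror e (\<Psi> x)) (\<lambda>y. G (mirror e y))
    (\<lambda>y. G' (mirror e y) \<circ> mirror e) (\<lambda>x. - Dd x)"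
proof
  show "continuous_on V (\<lambda>x. mirror e (\<Psi> x))"
    by (rule continuous_on_compose2[OF continuous_on_mirror \<Psi>(1)]) auto
  show "(\<lambda>x. mirror e (\<Psi> x)) ` V = ball q r"
  proof (intro equalityI subsetI)
    fix y assume y: "y \<in> ball q r"
    then have "mirror e y \<in> \<Psi> ` V" using \<Psi>(2) mirror_q by simp
    then show "y \<in> (\<lambda>x. mirror e (\<Psi> x)) ` V"
      using mirror_mirror[OF e, of y] by (metis (no_types, lifting) image_iff)
  qed (use \<Psi>Q mirror_q in blast)
  have G'p: "(G has_derivative G' y) (at y)" if "y \<in> ball q r" for y
    using G' that unfolding C1_field_on_def by blast
  show "C1_field_on (ball q r) (\<lambda>y. G (mirror e y)) (\<lambda>y. G' (mirror e y) \<circ> mirror e)"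
    unfolding C1_field_on_def
  proof (intro conjI ballI allI)
    show "((\<lambda>y. G (mirror e y)) has_derivative G' (mirror e y) \<circ> mirror e) (at y)" if "y \<in> ball q r" for y
      unfolding comp_def using that mirror_q
      by (intro has_derivative_compose[OF linear_imp_has_derivative[OF linear_mirror] G'p]) auto
    fix v
    have "continuous_on (ball q r) (\<lambda>y. G' y (mirror e v))"
      using G' unfolding C1_field_on_def by blast
    then have "continuous_on (ball q r) (\<lambda>y. G' (mirror e y) (mirror e v))"
      by (rule continuous_on_compose2[OF _ continuous_on_mirror]) (use mirror_q in blast)
    then show "continuous_on (ball q r) (\<lambda>y. (G' (mirror e y) \<circ> mirror e) v)" by simp
  qed
  show "jacobian (G' (mirror e y) \<circ> mirror e) > 0" if "y \<in> ball q r" for y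
    using that jac[of "mirror e y"] mirror_q G'p[of "mirror e y"] has_derivative_linear
    by (subst jacobian_comp_orthogonal) (auto simp: orthogonal_transformation_mirror e simp del: mem_ball)
  show "surj (G' (mirror e y) \<circ> mirror e)" if "y \<in> ball q r" for y
  proof (rule comp_surj)
    show "surj (mirror e)" using mirror_mirror[OF e] by (rule surjI)
    show "surj (G' (mirror e y))" using that mirror_q surj by blast
  qed
  show "C1_field_on V (\<lambda>x. mirror e (\<Psi> x) \<bullet> e) (\<lambda>x v. - Dd x \<bullet> v)"
    using Dd unfolding C1_field_on_def inner_minus_left mirror_inner[OF e]
    by (intro conjI ballI allI has_derivative_minus continuous_on_minus) auto
qed (use e q r V \<Psi>(3) G\<Psi> mirror_q mirror_mirror[OF e] in \<open>auto simp del: mem_ball\<close>)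

text \<open>The chain rule for the identity
  \<open>\<Psi> (G y) \<bullet> e = y \<bullet> e\<close>.\<close>

lemma gradient_G': 
  assumes "y \<in> ball q r"
  shows "Dd (G y) \<bullet> G' y w = w \<bullet> e"
proof -
  have "((\<lambda>y. \<Psi> (G y) \<bullet> e) has_derivative (\<lambda>w. Dd (G y) \<bullet> G' y w)) (at y)"
    using assms G' Dd GV[OF assms] unfolding C1_field_on_def
    by (intro has_derivative_compose[of G "G' y" y UNIV "\<lambda>x. \<Psi> x \<bullet> e" "\<lambda>v. Dd (G y) \<bullet> v"]) auto
  moreover have "((\<lambda>y. \<Psi> (G y) \<bullet> e) has_derivative (\<lambda>w. w \<bullet> e)) (at y)"
    by (rule has_derivative_transform_within_open[OF has_derivative_inner_left[OF has_derivative_ident] open_ball assms])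
      (simp add: G\<Psi> del: mem_ball)
  ultimately have "(\<lambda>w. Dd (G y) \<bullet> G' y w) = (\<lambda>w. w \<bullet> e)"
    by (rule has_derivative_unique)
  then show ?thesis by metis
qed

text \<open>The curve is the image under \<open>G\<close> of the segment through \<open>y\<close> in
  direction \<open>w\<close>, which stays in the hyperplane and hence in the interface.\<close>

lemma tangent_space_G':
  assumes y: "y \<in> ball q r" "y \<bullet> e = 0" and w: "w \<bullet> e = 0"
    and M: "{x \<in> V. \<Psi> x \<bullet> e = 0} \<subseteq> M"
  shows "G' y w \<in> tangent_space M (G y)"
proof -
  have "open ((\<lambda>t. y + t *\<^sub>R w) -` ball q r)"
    by (intro open_vimage open_ball continuous_intros)
  moreover have "0 \<in> (\<lambda>t. y + t *\<^sub>R w) -` ball q r" using y(1) by simp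
  ultimately obtain \<epsilon> where \<epsilon>: "\<epsilon> > 0" "ball 0 \<epsilon> \<subseteq> (\<lambda>t. y + t *\<^sub>R w) -` ball q r"
    unfolding open_contains_ball by blast
  have in_ball: "y + t *\<^sub>R w \<in> ball q r" if "t \<in> {-\<epsilon><..<\<epsilon>}" for t
    using \<epsilon>(2) that by (auto simp del: mem_ball simp: subset_iff dist_real_def)
  let ?\<gamma> = "\<lambda>t. G (y + t *\<^sub>R w)"
  have der: "(?\<gamma> has_vector_derivative G' (y + t *\<^sub>R w) w) (at t)" if "t \<in> {-\<epsilon><..<\<epsilon>}" for t
  proof -
    have G1: "(G has_derivative G' (y + t *\<^sub>R w)) (at (y + t *\<^sub>R w))"
      using G' in_ball[OF that] unfolding C1_field_on_def by blast
    have "((\<lambda>t. y + t *\<^sub>R w) has_derivative (\<lambda>s. s *\<^sub>R w)) (at t)"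
      by (auto intro!: derivative_eq_intros)
    from has_derivative_compose[OF this G1] show ?thesis
      unfolding has_vector_derivative_def
      by (rule has_derivative_eq_rhs) (simp add: linear_cmul[OF has_derivative_linear[OF G1]])
  qed
  have "continuous_on (ball q r) (\<lambda>z. G' z w)"
    using G' unfolding C1_field_on_def by blast
  then have cont: "continuous_on {-\<epsilon><..<\<epsilon>} (\<lambda>t. G' (y + t *\<^sub>R w) w)"
    by (rule continuous_on_compose2) (auto intro!: continuous_intros in_ball simp del: mem_ball)
  have "?\<gamma> C1_differentiable_on {-\<epsilon><..<\<epsilon>}"
    unfolding C1_differentiable_on_def
    by (intro exI[of _ "\<lambda>t. G' (y + t *\<^sub>R w) w"] conjI ballI der cont)
  moreover have "?\<gamma> ` {-\<epsilon><..<\<epsilon>} \<subseteq> M"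
    using M in_ball GV G\<Psi> y(2) w by (auto simp: inner_add_left simp del: mem_ball)
  ultimately show ?thesis
    unfolding tangent_space_def using \<epsilon>(1) der[of 0] by (intro CollectI exI[of _ ?\<gamma>] exI[of _ \<epsilon>]) auto
qed

text \<open>Both the gradient and the unit normal annihilate the tangent vectors \<^term>\<open>G' y w\<close> with
  \<^term>\<open>w \<bullet> e = 0\<close>, which span a hyperplane.\<close>

lemma gradient_parallel_normal:
  assumes x: "x \<in> V" "\<Psi> x \<bullet> e = 0" and M: "{x \<in> V. \<Psi> x \<bullet> e = 0} \<subseteq> M" and \<nu>: "unit_normal M x \<nu>"
  obtains c where "c \<noteq> 0" "Dd x = c *\<^sub>R \<nu>"
proof -
  define y where "y = \<Psi> x"
  have y: "y \<in> ball q r" "y \<bullet> e = 0" "G y = x"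
    using x \<Psi>Q \<Psi>(3) unfolding y_def by blast+
  \<comment> \<open>Since \<open>Dd x \<bullet> G' y e = 1\<close>, testing against
    \<open>G' y e\<close> shows that \<open>b\<close> is the only possible factor between the normal
    and the gradient.\<close>
  define b where "b = \<nu> \<bullet> G' y e"
  have "linear (G' y)"
    using G' y(1) has_derivative_linear unfolding C1_field_on_def by blast
  have orth: "(\<nu> - b *\<^sub>R Dd x) \<bullet> G' y w = 0" for w
  proof -
    define w' where "w' = w - (w \<bullet> e) *\<^sub>R e"
    have w': "w' \<bullet> e = 0" using e by (simp add: w'_def inner_diff_left)
    have "\<nu> \<bullet> G' y w' = 0"
      using \<nu> tangent_space_G'[OF y(1,2) w' M] unfolding unit_normal_def y(3) by blast
    moreover have "w = w' + (w \<bullet> e) *\<^sub>R e" by (simp add: w'_def)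
    then have "G' y w = G' y w' + (w \<bullet> e) *\<^sub>R G' y e"
      using \<open>linear (G' y)\<close> by (metis linear_add linear_cmul)
    ultimately have "\<nu> \<bullet> G' y w = (w \<bullet> e) * b"
      by (simp add: b_def inner_add_right)
    then show ?thesis
      using gradient_G'[OF y(1), of w] by (simp add: y(3) inner_diff_left)
  qed
  obtain w where "\<nu> - b *\<^sub>R Dd x = G' y w"
    using surj[OF y(1)] by (meson surjD)
  with orth[of w] have eq: "\<nu> = b *\<^sub>R Dd x" by simp
  moreover have "\<nu> \<noteq> 0" using \<nu> by (auto simp: unit_normal_def)
  ultimately have "b \<noteq> 0" by auto
  then show ?thesis using that[of "1 / b"] eq by simp
qed

text \<open>Each side is the continuous image of a convex half ball.\<close>

lemma connected_sides: "connected Vpos" "connected Vneg"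
proof -
  have img: "Vpos = G ` (ball q r \<inter> {y. 0 < e \<bullet> y})" "Vneg = G ` (ball q r \<inter> {y. e \<bullet> y < 0})"
    using GV G\<Psi> \<Psi>(3) \<Psi>Q unfolding Vpos_def Vneg_def by (force simp: image_iff inner_commute[of e])+
  show "connected Vpos" "connected Vneg"
    unfolding img
    by (intro connected_continuous_image convex_connected convex_Int convex_ball convex_halfspace_gt
        convex_halfspace_lt continuous_on_subset[OF continuous_G]; force)+
qed

lemma line_derivative:
  assumes "x \<in> V"
  shows "((\<lambda>t. \<Psi> (x + t *\<^sub>R \<nu>) \<bullet> e) has_real_derivative Dd x \<bullet> \<nu>) (at 0)"
proof -
  have "((\<lambda>x. \<Psi> x \<bullet> e) has_derivative (\<lambda>v. Dd x \<bullet> v)) (at (x + 0 *\<^sub>R \<nu>))"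
    using Dd assms unfolding C1_field_on_def by simp
  moreover have "((\<lambda>t. x + t *\<^sub>R \<nu>) has_derivative (\<lambda>s. s *\<^sub>R \<nu>)) (at 0)"
    by (auto intro!: derivative_eq_intros)
  ultimately have "((\<lambda>t. \<Psi> (x + t *\<^sub>R \<nu>) \<bullet> e) has_derivative (\<lambda>s. Dd x \<bullet> (s *\<^sub>R \<nu>))) (at 0)"
    using has_derivative_compose by blast
  then show ?thesis
    unfolding has_field_derivative_def by (rule has_derivative_eq_rhs) (simp add: fun_eq_iff)
qed

text \<open>A connected side lies in one of the two parts. The normal at \<open>p\<close> crosses
  the interface with nonzero speed, so \<open>p - t *\<^sub>R \<nu>\<close> and
  \<open>p + t *\<^sub>R \<nu>\<close> lie on different sides of the chart for small
  \<open>t\<close>. Outwardness puts the first into \<open>Bp\<close> and keeps the second out of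
  it, hence the sides go to different parts.\<close>

lemma sides:
  assumes p: "p \<in> V" "\<Psi> p \<bullet> e = 0" and M: "\<And>x. x \<in> V \<Longrightarrow> x \<in> M \<longleftrightarrow> \<Psi> x \<bullet> e = 0"
    and B: "V - M \<subseteq> Bp \<union> Bm" "Bp \<inter> Bm = {}" "open Bp" "open Bm"
    and \<nu>: "outward_unit_normal M Bp p \<nu>"
  shows "Vpos \<subseteq> Bp \<and> Vneg \<subseteq> Bm \<or> Vneg \<subseteq> Bp \<and> Vpos \<subseteq> Bm"
proof -
  have dich: "S \<subseteq> Bp \<or> S \<subseteq> Bm" if "connected S" "S \<subseteq> V - M" for S
    using connectedD[OF that(1) B(3,4)] B(1,2) that(2) by blast
  have sub: "Vpos \<subseteq> V - M" "Vneg \<subseteq> V - M" using M by (auto simp: Vpos_def Vneg_def)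
  have d1: "Vpos \<subseteq> Bp \<or> Vpos \<subseteq> Bm" and d2: "Vneg \<subseteq> Bp \<or> Vneg \<subseteq> Bm"
    using dich connected_sides sub by blast+
  have un: "unit_normal M p \<nu>" using \<nu> by (simp add: outward_unit_normal_def)
  obtain c where c: "c \<noteq> 0" "Dd p = c *\<^sub>R \<nu>"
    by (rule gradient_parallel_normal[OF p _ un]) (use M in auto)
  \<comment> \<open>This is the derivative at \<open>p\<close> of the flat coordinate along the
    normal. Its sign decides which half of the chart the normal points into.\<close>
  have s: "Dd p \<bullet> \<nu> = c" using c un by (simp add: unit_normal_def dot_square_norm)
  obtain \<epsilon> where \<epsilon>: "\<epsilon> > 0" "\<And>t. 0 < t \<Longrightarrow> t < \<epsilon> \<Longrightarrow> p - t *\<^sub>R \<nu> \<in> Bp \<and> p + t *\<^sub>R \<nu> \<notin> Bp"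
    using \<nu> by (auto simp: outward_unit_normal_def)
  have "open ((\<lambda>t. p + t *\<^sub>R \<nu>) -` V)"
    by (intro open_vimage V continuous_intros)
  moreover have "0 \<in> (\<lambda>t. p + t *\<^sub>R \<nu>) -` V" using p(1) by simp
  ultimately obtain \<epsilon>' where \<epsilon>': "\<epsilon>' > 0" "ball 0 \<epsilon>' \<subseteq> (\<lambda>t. p + t *\<^sub>R \<nu>) -` V"
    unfolding open_contains_ball by blast
  note der = line_derivative[OF p(1), of \<nu>, unfolded s]
  obtain \<epsilon>'' where \<epsilon>'': "\<epsilon>'' > 0"
    "\<And>t. 0 < t \<Longrightarrow> t < \<epsilon>'' \<Longrightarrow> (0 < c \<longrightarrow> \<Psi> (p - t *\<^sub>R \<nu>) \<bullet> e < 0 \<and> 0 < \<Psi> (p + t *\<^sub>R \<nu>) \<bullet> e) \<and>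
       (c < 0 \<longrightarrow> \<Psi> (p + t *\<^sub>R \<nu>) \<bullet> e < 0 \<and> 0 < \<Psi> (p - t *\<^sub>R \<nu>) \<bullet> e)"
  proof (cases "0 < c")
    case True
    obtain d1 d2 where "d1 > 0" "\<forall>h>0. h < d1 \<longrightarrow> \<Psi> (p + 0 *\<^sub>R \<nu>) \<bullet> e < \<Psi> (p + (0 + h) *\<^sub>R \<nu>) \<bullet> e"
      "d2 > 0" "\<forall>h>0. h < d2 \<longrightarrow> \<Psi> (p + (0 - h) *\<^sub>R \<nu>) \<bullet> e < \<Psi> (p + 0 *\<^sub>R \<nu>) \<bullet> e"
      using DERIV_pos_inc_right[OF der True] DERIV_pos_inc_left[OF der True] by blast
    then show ?thesis using True p(2) by (intro that[of "min d1 d2"]) auto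
  next
    case False
    then have "c < 0" using c by simp
    obtain d1 d2 where "d1 > 0" "\<forall>h>0. h < d1 \<longrightarrow> \<Psi> (p + 0 *\<^sub>R \<nu>) \<bullet> e > \<Psi> (p + (0 + h) *\<^sub>R \<nu>) \<bullet> e"
      "d2 > 0" "\<forall>h>0. h < d2 \<longrightarrow> \<Psi> (p + (0 - h) *\<^sub>R \<nu>) \<bullet> e > \<Psi> (p + 0 *\<^sub>R \<nu>) \<bullet> e"
      using DERIV_neg_dec_right[OF der \<open>c < 0\<close>] DERIV_neg_dec_left[OF der \<open>c < 0\<close>] by blast
    then show ?thesis using False p(2) by (intro that[of "min d1 d2"]) auto
  qed
  define t where "t = min \<epsilon> (min \<epsilon>' \<epsilon>'') / 2"
  have t: "0 < t" "t < \<epsilon>" "t < \<epsilon>'" "t < \<epsilon>''" using \<epsilon>(1) \<epsilon>'(1) \<epsilon>''(1) by (auto simp: t_def)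
  have "t \<in> ball 0 \<epsilon>'" "- t \<in> ball 0 \<epsilon>'" using t by auto
  then have V': "p + t *\<^sub>R \<nu> \<in> V" "p - t *\<^sub>R \<nu> \<in> V"
    using \<epsilon>'(2) by (fastforce dest: subsetD[of "ball 0 \<epsilon>'" _ t] subsetD[of "ball 0 \<epsilon>'" _ "- t"])+
  show ?thesis
  proof (cases "0 < c")
    case True
    then have "p - t *\<^sub>R \<nu> \<in> Vneg" "p + t *\<^sub>R \<nu> \<in> Vpos" using V' \<epsilon>''(2)[OF t(1,4)] by (auto simp: Vpos_def Vneg_def)
    then show ?thesis using \<epsilon>(2)[OF t(1,2)] d1 d2 B(2) by blast
  next
    case False
    then have "c < 0" using c by simp
    then have "p - t *\<^sub>R \<nu> \<in> Vpos" "p + t *\<^sub>R \<nu> \<in> Vneg" using V' \<epsilon>''(2)[OF t(1,4)] by (auto simp: Vpos_def Vneg_def)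
    then show ?thesis using \<epsilon>(2)[OF t(1,2)] d1 d2 B(2) by blast
  qed
qed

text \<open>In the chart, a point with height 0 is approached by shifting it by
  \<open>s / Suc n\<close> along \<open>e\<close>, where the sign \<open>s\<close> chooses the side.
  Thus continuity on the closure of a side includes the values on the interface.\<close>

lemma closure_sides:
  shows "{x \<in> V. 0 \<le> \<Psi> x \<bullet> e} \<subseteq> closure Vpos" "{x \<in> V. \<Psi> x \<bullet> e \<le> 0} \<subseteq> closure Vneg"
proof -
  have A: "G y \<in> closure (G ` {y \<in> ball q r. 0 < s * (y \<bullet> e)})"
    if y: "y \<in> ball q r" "0 \<le> s * (y \<bullet> e)" and s: "s = 1 \<or> s = -1" for y s
  proof -
    define Y where "Y n = y + (s / real (Suc n)) *\<^sub>R e" for n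
    have lim: "Y \<longlonglongrightarrow> y"
    proof -
      have "(\<lambda>n. y + (s * inverse (real (Suc n))) *\<^sub>R e) \<longlonglongrightarrow> y + (s * 0) *\<^sub>R e"
        by (intro tendsto_intros LIMSEQ_inverse_real_of_nat)
      then show ?thesis by (simp add: Y_def[abs_def] divide_inverse)
    qed
    have ev: "\<forall>\<^sub>F n in sequentially. Y n \<in> ball q r"
      using topological_tendstoD[OF lim open_ball y(1)] .
    have pos: "0 < s * (Y n \<bullet> e)" for n
    proof -
      have "s * (Y n \<bullet> e) = s * (y \<bullet> e) + s * s / real (Suc n)"
        using e by (simp add: Y_def inner_add_left algebra_simps)
      moreover have "s * s = 1" using s by auto
      ultimately show ?thesis using y(2) by (simp add: add_nonneg_pos)
    qed
    have "isCont G y"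
      using continuous_G y(1) by (simp add: continuous_on_eq_continuous_at del: mem_ball)
    then have "(\<lambda>n. G (Y n)) \<longlonglongrightarrow> G y"
      using lim by (rule isCont_tendsto_compose)
    then show ?thesis
    proof (rule Lim_in_closed_set[OF closed_closure, rotated 2])
      show "\<forall>\<^sub>F n in sequentially. G (Y n) \<in> closure (G ` {y \<in> ball q r. 0 < s * (y \<bullet> e)})"
        using ev by (rule eventually_mono) (use pos closure_subset in fastforce)
    qed simp
  qed
  have img: "G ` {y \<in> ball q r. 0 < 1 * (y \<bullet> e)} \<subseteq> Vpos" "G ` {y \<in> ball q r. 0 < (-1) * (y \<bullet> e)} \<subseteq> Vneg"
    using GV G\<Psi> unfolding Vpos_def Vneg_def by (auto simp del: mem_ball)
  show "{x \<in> V. 0 \<le> \<Psi> x \<bullet> e} \<subseteq> closure Vpos"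
  proof
    fix x assume x: "x \<in> {x \<in> V. 0 \<le> \<Psi> x \<bullet> e}"
    then have "G (\<Psi> x) \<in> closure (G ` {y \<in> ball q r. 0 < 1 * (y \<bullet> e)})"
      using \<Psi>Q by (intro A) auto
    then show "x \<in> closure Vpos" using closure_mono[OF img(1)] x \<Psi>(3) by auto
  qed
  show "{x \<in> V. \<Psi> x \<bullet> e \<le> 0} \<subseteq> closure Vneg"
  proof
    fix x assume x: "x \<in> {x \<in> V. \<Psi> x \<bullet> e \<le> 0}"
    then have "G (\<Psi> x) \<in> closure (G ` {y \<in> ball q r. 0 < (-1) * (y \<bullet> e)})"
      using \<Psi>Q by (intro A) auto
    then show "x \<in> closure Vneg" using closure_mono[OF img(2)] x \<Psi>(3) by auto
  qed
qed

end

lemma gradient_representation: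
  fixes f :: "'a::euclidean_space \<Rightarrow> real"
  assumes "linear f"
  shows "f v = (\<Sum>i\<in>Basis. f i *\<^sub>R i) \<bullet> v"
proof -
  have "f v = f (\<Sum>i\<in>Basis. (v \<bullet> i) *\<^sub>R i)"
    by (simp add: euclidean_representation)
  also have "\<dots> = (\<Sum>i\<in>Basis. (v \<bullet> i) * f i)"
    unfolding linear_sum[OF assms] linear_cmul[OF assms] by simp
  also have "\<dots> = (\<Sum>i\<in>Basis. f i *\<^sub>R i) \<bullet> v"
    by (simp add: inner_sum_left inner_commute[of v] mult.commute)
  finally show ?thesis .
qed

text \<open>A slice chart restricted to the preimage of a small ball. The derivatives of the chart
  and of its inverse are inverse to each other by the chain rule, which gives the positive Jacobian
  and the surjectivity.\<close>

lemma flat_chart_exists: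
  fixes M B :: "(real ^ 'm::finite) set"
  assumes M: "C1_hypersurface M" and B: "open B" and p: "p \<in> M" "p \<in> B"
  obtains V q e r \<Psi> G G' Dd where "flat_chart V q e r \<Psi> G G' Dd" "p \<in> V" "V \<subseteq> B" "\<Psi> p = q"
    "\<forall>x\<in>V. x \<in> M \<longleftrightarrow> \<Psi> x \<bullet> e = 0"
proof -
  obtain U \<psi> e where e: "e \<in> Basis" and pU: "p \<in> U" and ch: "C1_chart U \<psi>"
    and MU: "\<psi> ` (M \<inter> U) = {y \<in> \<psi> ` U. y \<bullet> e = 0}"
    using M[unfolded C1_hypersurface_def, rule_format, OF p(1)] by blast
  define G where "G = inv_into U \<psi>"
  have U: "open U" "open (\<psi> ` U)" "inj_on \<psi> U" and C: "Ck_on 1 \<psi> U" "Ck_on 1 G (\<psi> ` U)"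
    using ch unfolding C1_chart_def G_def by blast+
  define \<psi>' where "\<psi>' x = frechet_derivative \<psi> (at x within U)" for x
  define G' where "G' y = frechet_derivative G (at y within \<psi> ` U)" for y
  have F: "C1_field_on U \<psi> \<psi>'" "C1_field_on (\<psi> ` U) G G'"
    unfolding \<psi>'_def G'_def using Ck_on_1_imp_C1_field_on[OF _ order_refl] U C by blast+
  have G: "G (\<psi> x) = x" if "x \<in> U" for x using that U(3) by (simp add: G_def)
  have \<psi>': "(\<psi> has_derivative \<psi>' x) (at x)" if "x \<in> U" for x
    using F(1) that unfolding C1_field_on_def by blast
  have G': "(G has_derivative G' y) (at y)" if "y \<in> \<psi> ` U" for y
    using F(2) that unfolding C1_field_on_def by blast
  have cont\<psi>: "continuous_on U \<psi>"
    using F(1) by (rule C1_field_on_continuous)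
  have contG: "continuous_on (\<psi> ` U) G"
    using F(2) by (rule C1_field_on_continuous)
  have "open (\<psi> ` U \<inter> G -` B)"
    using continuous_open_preimage[OF contG U(2) B] .
  moreover have "\<psi> p \<in> \<psi> ` U \<inter> G -` B" using pU p(2) G by auto
  \<comment> \<open>The ball must lie in the image of the chart, and its preimage must lie in
    \<open>B\<close>.\<close>
  ultimately obtain r where r: "r > 0" "ball (\<psi> p) r \<subseteq> \<psi> ` U \<inter> G -` B"
    unfolding open_contains_ball by blast
  define V where "V = U \<inter> \<psi> -` ball (\<psi> p) r"
  have V: "open V"
    unfolding V_def by (rule continuous_open_preimage[OF cont\<psi> U(1) open_ball])
  have img: "\<psi> ` V = ball (\<psi> p) r" using r(2) unfolding V_def by blast
  define Dd where "Dd x = (\<Sum>i\<in>Basis. (\<psi>' x i \<bullet> e) *\<^sub>R i)" for x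
  have Dd: "\<psi>' x v \<bullet> e = Dd x \<bullet> v" if "x \<in> U" for x v
    unfolding Dd_def
    by (rule gradient_representation[OF has_derivative_linear[OF has_derivative_inner_left[OF \<psi>'[OF that]]]])
  have GV: "G y \<in> U" "\<psi> (G y) = y" if "y \<in> \<psi> ` U" for y
    using that G by auto
  have comp1: "\<psi>' (G y) (G' y v) = v" if y: "y \<in> \<psi> ` U" for y v
  proof -
    have "((\<lambda>y. \<psi> (G y)) has_derivative (\<lambda>v. \<psi>' (G y) (G' y v))) (at y)"
      using has_derivative_compose[OF G'[OF y] \<psi>'[OF GV(1)[OF y]]] .
    moreover have "((\<lambda>y. \<psi> (G y)) has_derivative (\<lambda>v. v)) (at y)"
      by (rule has_derivative_transform_within_open[OF has_derivative_ident U(2) y]) (simp add: GV)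
    ultimately show ?thesis by (rule has_derivative_unique[THEN fun_cong])
  qed
  have comp2: "G' y (\<psi>' (G y) v) = v" if y: "y \<in> \<psi> ` U" for y v
  proof -
    have "(G has_derivative G' y) (at (\<psi> (G y)))" using G'[OF y] GV(2)[OF y] by simp
    then have "((\<lambda>x. G (\<psi> x)) has_derivative (\<lambda>v. G' y (\<psi>' (G y) v))) (at (G y))"
      using has_derivative_compose[OF \<psi>'[OF GV(1)[OF y]]] by blast
    moreover have "((\<lambda>x. G (\<psi> x)) has_derivative (\<lambda>v. v)) (at (G y))"
      by (rule has_derivative_transform_within_open[OF has_derivative_ident U(1) GV(1)[OF y]]) (simp add: G)
    ultimately show ?thesis by (rule has_derivative_unique[THEN fun_cong])
  qed
  have sub: "ball (\<psi> p) r \<subseteq> \<psi> ` U" using r(2) by blast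
  have "flat_chart V (\<psi> p) e r \<psi> G G' Dd"
  proof
    show "\<psi> p \<bullet> e = 0" using MU p(1) pU by blast
    show "continuous_on V \<psi>" using cont\<psi> by (rule continuous_on_subset) (simp add: V_def)
    show "C1_field_on (ball (\<psi> p) r) G G'"
      using F(2) sub unfolding C1_field_on_def by (meson continuous_on_subset subsetD)
    show "jacobian (G' y) > 0" if "y \<in> ball (\<psi> p) r" for y
      using that sub comp1[of y] has_derivative_linear[OF G'] has_derivative_linear[OF \<psi>'] GV
      by (intro jacobian_pos[of _ "\<psi>' (G y)"]) blast+
    show "surj (G' y)" if "y \<in> ball (\<psi> p) r" for y
      using comp2[of y] that sub by (metis surjI subsetD)
    show "C1_field_on V (\<lambda>x. \<psi> x \<bullet> e) (\<lambda>x v. Dd x \<bullet> v)"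
      unfolding C1_field_on_def
    proof (intro conjI ballI allI)
      show "((\<lambda>x. \<psi> x \<bullet> e) has_derivative (\<lambda>v. Dd x \<bullet> v)) (at x)" if "x \<in> V" for x
        using has_derivative_inner_left[OF \<psi>'[of x], of e] that Dd by (simp add: V_def)
      have "continuous_on V (\<lambda>x. \<psi>' x v \<bullet> e)" for v
        using F(1) unfolding C1_field_on_def V_def
        by (intro continuous_on_inner continuous_on_const) (blast intro: continuous_on_subset)
      then show "continuous_on V (\<lambda>x. Dd x \<bullet> v)" for v
        by (rule continuous_on_eq) (simp add: Dd V_def)
    qed
  qed (use e r(1) V img G GV sub in \<open>auto simp: V_def simp del: mem_ball\<close>)
  moreover have "p \<in> V" using pU r(1) by (simp add: V_def)
  moreover have "V \<subseteq> B"
  proof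
    fix x assume "x \<in> V"
    then have "G (\<psi> x) \<in> B" "x \<in> U" using r(2) by (auto simp: V_def simp del: mem_ball)
    then show "x \<in> B" using G by simp
  qed
  moreover have "\<forall>x\<in>V. x \<in> M \<longleftrightarrow> \<psi> x \<bullet> e = 0"
  proof (intro ballI iffI)
    fix x assume "x \<in> V"
    then have xU: "x \<in> U" by (simp add: V_def)
    show "\<psi> x \<bullet> e = 0" if "x \<in> M" using MU that xU by blast
    assume "\<psi> x \<bullet> e = 0"
    then have "\<psi> x \<in> \<psi> ` (M \<inter> U)" unfolding MU using xU by blast
    then show "x \<in> M" using U(3) xU by (auto dest: inj_onD)
  qed
  ultimately show ?thesis by (rule that[OF _ _ _ refl])
qed

subsection \<open>Two fields meeting along a hypersurface\<close>

lemma C1_compact_inD: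
  assumes "C1_compact_in S \<phi> D\<phi>"
  shows "(\<phi> has_derivative (\<lambda>v. D\<phi> x \<bullet> v)) (at x)" "continuous_on UNIV D\<phi>" "continuous_on UNIV \<phi>"
  using assms unfolding C1_compact_in_def
  by (auto intro: continuous_at_imp_continuous_on has_derivative_continuous)

lemma C1_compact_in_support:
  assumes "C1_compact_in S \<phi> D\<phi>"
  obtains K where "compact K" "K \<subseteq> S" "\<And>x. x \<notin> K \<Longrightarrow> \<phi> x = 0" "\<And>x. x \<notin> K \<Longrightarrow> D\<phi> x = 0"
proof -
  obtain K where K: "compact K" "K \<subseteq> S" "\<forall>x. x \<notin> K \<longrightarrow> \<phi> x = 0"
    using assms unfolding C1_compact_in_def by blast
  have "D\<phi> x = 0" if "x \<notin> K" for x
    by (rule C1_compact_inD_gradient_0[OF C1_compact_inD(1)[OF assms] K(1) _ that]) (use K in blast)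
  with K that show ?thesis by blast
qed

lemma C1_compact_in_subset: "C1_compact_in S \<phi> D\<phi> \<Longrightarrow> S \<subseteq> T \<Longrightarrow> C1_compact_in T \<phi> D\<phi>"
  unfolding C1_compact_in_def by blast

lemma C1_compact_in_mult:
  assumes \<phi>: "\<And>x. (\<phi> has_derivative (\<lambda>v. D\<phi> x \<bullet> v)) (at x)" "continuous_on UNIV D\<phi>"
    and \<zeta>: "\<And>x. (\<zeta> has_derivative (\<lambda>v. D\<zeta> x \<bullet> v)) (at x)" "continuous_on UNIV D\<zeta>"
    and K: "compact K" "K \<subseteq> S" "\<And>x. x \<notin> K \<Longrightarrow> \<phi> x * \<zeta> x = 0"
  shows "C1_compact_in S (\<lambda>x. \<phi> x * \<zeta> x) (\<lambda>x. \<phi> x *\<^sub>R D\<zeta> x + \<zeta> x *\<^sub>R D\<phi> x)"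
  unfolding C1_compact_in_def
proof (intro conjI allI)
  show "((\<lambda>x. \<phi> x * \<zeta> x) has_derivative (\<lambda>v. (\<phi> x *\<^sub>R D\<zeta> x + \<zeta> x *\<^sub>R D\<phi> x) \<bullet> v)) (at x)" for x
    by (rule has_derivative_eq_rhs[OF has_derivative_mult[OF \<phi>(1) \<zeta>(1)]]) (auto simp: inner_add_left)
  have "continuous_on UNIV \<phi>" "continuous_on UNIV \<zeta>"
    using \<phi>(1) \<zeta>(1) by (meson continuous_at_imp_continuous_on has_derivative_continuous)+
  then show "continuous_on UNIV (\<lambda>x. \<phi> x *\<^sub>R D\<zeta> x + \<zeta> x *\<^sub>R D\<phi> x)"
    using \<phi>(2) \<zeta>(2) by (intro continuous_intros)
  show "\<exists>K. compact K \<and> K \<subseteq> S \<and> (\<forall>x. x \<notin> K \<longrightarrow> \<phi> x * \<zeta> x = 0)"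
    using K by blast
qed

text \<open>A partition of unity argument that splits off one ball of a finite cover at a time, by
  multiplication with a function that is 1 on the half ball.\<close>

lemma local_to_global:
  fixes L :: "('a::euclidean_space \<Rightarrow> real) \<Rightarrow> ('a \<Rightarrow> 'a) \<Rightarrow> real"
  assumes add: "\<And>\<phi> D\<phi> \<zeta> D\<zeta>. C1_compact_in B \<phi> D\<phi> \<Longrightarrow> C1_compact_in B \<zeta> D\<zeta> \<Longrightarrow>
      L (\<lambda>x. \<phi> x + \<zeta> x) (\<lambda>x. D\<phi> x + D\<zeta> x) = L \<phi> D\<phi> + L \<zeta> D\<zeta>"
    and local: "\<And>p. p \<in> B \<Longrightarrow> \<exists>W. open W \<and> p \<in> W \<and> (\<forall>\<phi> D\<phi>. C1_compact_in W \<phi> D\<phi> \<longrightarrow> L \<phi> D\<phi> = 0)"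
    and \<phi>: "C1_compact_in B \<phi> D\<phi>"
  shows "L \<phi> D\<phi> = 0"
proof -
  have "\<forall>p\<in>B. \<exists>\<epsilon>>0. \<forall>\<phi> D\<phi>. C1_compact_in (ball p \<epsilon>) \<phi> D\<phi> \<longrightarrow> L \<phi> D\<phi> = 0"
  proof
    fix p assume "p \<in> B"
    then obtain W where W: "open W" "p \<in> W" "\<forall>\<phi> D\<phi>. C1_compact_in W \<phi> D\<phi> \<longrightarrow> L \<phi> D\<phi> = 0"
      using local by blast
    then obtain \<epsilon> where "\<epsilon> > 0" "ball p \<epsilon> \<subseteq> W" using open_contains_ball by blast
    with W(3) show "\<exists>\<epsilon>>0. \<forall>\<phi> D\<phi>. C1_compact_in (ball p \<epsilon>) \<phi> D\<phi> \<longrightarrow> L \<phi> D\<phi> = 0"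
      using C1_compact_in_subset by blast
  qed
  then obtain \<epsilon> where \<epsilon>: "\<And>p. p \<in> B \<Longrightarrow> \<epsilon> p > 0"
    "\<And>p \<phi> D\<phi>. p \<in> B \<Longrightarrow> C1_compact_in (ball p (\<epsilon> p)) \<phi> D\<phi> \<Longrightarrow> L \<phi> D\<phi> = 0"
    by metis
  have covered: "L \<phi> D\<phi> = 0" if "finite I" "I \<subseteq> B" "C1_compact_in B \<phi> D\<phi>"
    "compact K" "K \<subseteq> B" "\<forall>x. x \<notin> K \<longrightarrow> \<phi> x = 0" "K \<subseteq> (\<Union>p\<in>I. ball p (\<epsilon> p / 2))" for I \<phi> D\<phi> K
    using that
  proof (induction I arbitrary: \<phi> D\<phi> K rule: finite_induct)
    case empty
    then have 0: "\<phi> = (\<lambda>x. 0)" by auto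
    have "D\<phi> x = 0" for x
      by (rule C1_compact_inD_gradient_0[OF C1_compact_inD(1)[OF empty.prems(2)], of "{}"]) (use 0 in auto)
    then have "D\<phi> = (\<lambda>x. 0)" by auto
    \<comment> \<open>Additivity at the zero function says that its value is twice itself.\<close>
    with add[OF empty.prems(2) empty.prems(2)] 0 show ?case by simp
  next
    case (insert p I)
    have p: "p \<in> B" "\<epsilon> p > 0" using insert.prems \<epsilon>(1) by auto
    \<comment> \<open>With this scale the argument of the cutoff is the square of
      \<open>dist x p / (\<epsilon> p / 2)\<close>. It is at most 1 on the half ball and at least
      9/4 beyond three quarters of the radius, where the cutoff has reached 1. The squared distance
      is used because it is smooth at \<open>p\<close>.\<close>
    define k where "k = 4 / (\<epsilon> p)\<^sup>2"
    define \<zeta> where "\<zeta> x = 1 - cutoff (k * ((x - p) \<bullet> (x - p)))" for x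
    define D\<zeta> where "D\<zeta> x = - (cutoff_deriv (k * ((x - p) \<bullet> (x - p))) * (2 * k)) *\<^sub>R (x - p)" for x
    have \<zeta>': "(\<zeta> has_derivative (\<lambda>v. D\<zeta> x \<bullet> v)) (at x)" for x
    proof -
      have "((\<lambda>x. k * ((x - p) \<bullet> (x - p))) has_derivative (\<lambda>v. k * (2 * ((x - p) \<bullet> v)))) (at x)"
        by (auto intro!: derivative_eq_intros simp: inner_commute algebra_simps)
      from has_derivative_compose[OF this DERIV_cutoff[unfolded has_field_derivative_def]]
      have "((\<lambda>x. 1 - cutoff (k * ((x - p) \<bullet> (x - p)))) has_derivative
          (\<lambda>v. 0 - cutoff_deriv (k * ((x - p) \<bullet> (x - p))) * (k * (2 * ((x - p) \<bullet> v))))) (at x)"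
        by (intro has_derivative_diff has_derivative_const)
      then show ?thesis
        unfolding \<zeta>_def by (rule has_derivative_eq_rhs) (auto simp: D\<zeta>_def fun_eq_iff)
    qed
    have D\<zeta>c: "continuous_on UNIV D\<zeta>"
      unfolding D\<zeta>_def by (intro continuous_intros)
    have sq: "k * ((x - p) \<bullet> (x - p)) = (dist x p / (\<epsilon> p / 2))\<^sup>2" for x
      by (simp add: k_def dist_norm power2_norm_eq_inner[symmetric] power_divide)
    have \<zeta>1: "\<zeta> x = 1" if "dist x p \<le> \<epsilon> p / 2" for x
    proof -
      have "(dist x p / (\<epsilon> p / 2))\<^sup>2 \<le> 1\<^sup>2"
        using that p by (intro power_mono) auto
      then show ?thesis by (simp add: \<zeta>_def sq cutoff_eq_0)
    qed
    have \<zeta>0: "\<zeta> x = 0" if "dist x p \<ge> \<epsilon> p * (3/4)" for x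
    proof -
      have "3/2 \<le> dist x p / (\<epsilon> p / 2)" using that p by (simp add: field_simps)
      then have "(3/2)\<^sup>2 \<le> (dist x p / (\<epsilon> p / 2))\<^sup>2" by (rule power_mono) simp
      then show ?thesis by (simp add: \<zeta>_def sq cutoff_eq_1 power2_eq_square)
    qed
    note \<phi>' = C1_compact_inD[OF insert.prems(2)]
    let ?D1 = "\<lambda>x. \<phi> x *\<^sub>R D\<zeta> x + \<zeta> x *\<^sub>R D\<phi> x"
    let ?D2 = "\<lambda>x. \<phi> x *\<^sub>R (- D\<zeta> x) + (1 - \<zeta> x) *\<^sub>R D\<phi> x"
    have K1: "compact (K \<inter> cball p (\<epsilon> p * (3/4)))" using insert.prems(3) by auto
    have z1: "\<phi> x * \<zeta> x = 0" if "x \<notin> K \<inter> cball p (\<epsilon> p * (3/4))" for x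
      using that insert.prems(5) \<zeta>0[of x] by (cases "x \<in> K") (auto simp: dist_commute)
    have 1: "C1_compact_in (B \<inter> ball p (\<epsilon> p)) (\<lambda>x. \<phi> x * \<zeta> x) ?D1"
      by (rule C1_compact_in_mult[OF \<phi>'(1,2) \<zeta>' D\<zeta>c K1 _ z1]) (use insert.prems(4) p in auto)
    have K2: "compact (K - ball p (\<epsilon> p / 2))" using insert.prems(3) by (auto simp: compact_diff)
    have \<zeta>m: "((\<lambda>x. 1 - \<zeta> x) has_derivative (\<lambda>v. - D\<zeta> x \<bullet> v)) (at x)" for x
      by (rule has_derivative_eq_rhs[OF has_derivative_diff[OF has_derivative_const \<zeta>']]) auto
    have z2: "\<phi> x * (1 - \<zeta> x) = 0" if "x \<notin> K - ball p (\<epsilon> p / 2)" for x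
      using that insert.prems(5) \<zeta>1[of x] by (cases "x \<in> K") (auto simp: dist_commute)
    have 2: "C1_compact_in B (\<lambda>x. \<phi> x * (1 - \<zeta> x)) ?D2"
      by (rule C1_compact_in_mult[OF \<phi>'(1,2) \<zeta>m _ K2 _ z2]) (use insert.prems(4) D\<zeta>c in \<open>auto intro: continuous_on_minus\<close>)
    \<comment> \<open>The remainder is supported in \<open>K\<close> minus the half ball around
      \<open>p\<close>, which the balls of the remaining points cover.\<close>
    have "L (\<lambda>x. \<phi> x * (1 - \<zeta> x)) ?D2 = 0"
      by (rule insert.IH[OF _ 2 K2]) (use insert.prems z2 in auto)
    moreover have "L (\<lambda>x. \<phi> x * \<zeta> x) ?D1 = 0"
      using \<epsilon>(2)[OF p(1)] C1_compact_in_subset[OF 1] by blast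
    moreover have "\<phi> = (\<lambda>x. \<phi> x * \<zeta> x + \<phi> x * (1 - \<zeta> x))" "D\<phi> = (\<lambda>x. ?D1 x + ?D2 x)"
      by (auto simp: algebra_simps)
    ultimately show ?case
      using add[OF C1_compact_in_subset[OF 1] 2] by auto
  qed
  obtain K where K: "compact K" "K \<subseteq> B" "\<forall>x. x \<notin> K \<longrightarrow> \<phi> x = 0"
    using \<phi> unfolding C1_compact_in_def by blast
  have "K \<subseteq> (\<Union>p\<in>K. ball p (\<epsilon> p / 2))" using K(2) \<epsilon>(1) by force
  then obtain I where I: "I \<subseteq> K" "finite I" "K \<subseteq> (\<Union>p\<in>I. ball p (\<epsilon> p / 2))"
    using compactE_image[OF K(1), of K "\<lambda>p. ball p (\<epsilon> p / 2)"] by (metis open_ball)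
  show ?thesis
    by (rule covered[OF I(2) _ \<phi> K I(3)]) (use I(1) K(2) in auto)
qed

section \<open>Integrals of functions with compact support\<close>

lemma absolutely_integrable_compact_support:
  fixes f :: "'a::euclidean_space \<Rightarrow> 'b::euclidean_space"
  assumes f: "f absolutely_integrable_on K" and "K \<subseteq> S" "\<And>x. x \<in> S \<Longrightarrow> x \<notin> K \<Longrightarrow> f x = 0"
  shows "f absolutely_integrable_on S"
proof -
  have "(\<lambda>x. indicat_real K x *\<^sub>R f x) = (\<lambda>x. indicat_real S x *\<^sub>R f x)"
    using assms(2,3) by (intro ext) (auto split: split_indicator)
  with f show ?thesis unfolding set_integrable_def by simp
qed

lemma absolutely_integrable_compact:
  fixes f :: "'a::euclidean_space \<Rightarrow> 'b::euclidean_space"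
  assumes "compact K" "continuous_on K f"
  shows "f absolutely_integrable_on K"
proof -
  have i: "integrable lborel (\<lambda>x. indicat_real K x *\<^sub>R f x)"
    by (rule borel_integrable_compact[OF assms])
  then have "integrable lebesgue (\<lambda>x. indicat_real K x *\<^sub>R f x)"
    using borel_measurable_integrable[OF i] by (simp add: integrable_completion)
  then show ?thesis by (simp add: set_integrable_def)
qed

lemma integral_eq_on_support:
  fixes f :: "'a::euclidean_space \<Rightarrow> real"
  assumes "\<And>x. x \<in> S \<Longrightarrow> x \<notin> T \<Longrightarrow> f x = 0" "\<And>x. x \<in> T \<Longrightarrow> x \<notin> S \<Longrightarrow> f x = 0"
  shows "integral S f = integral T f"
proof -
  have "(\<lambda>x. if x \<in> S then f x else 0) = (\<lambda>x. if x \<in> T then f x else 0)"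
    using assms by auto
  then show ?thesis by (metis integral_restrict_UNIV)
qed

text \<open>The transmission problem without reference to \<open>u\<close> and \<open>F\<close>: two
  bounded fields with divergence \<open>H\<close>, each continuous up to the boundary of its own
  part. The values of \<open>Np\<close> and \<open>Nm\<close> on the interface are their one-sided
  limits.\<close>

locale interface =
  fixes M B Bp Bm :: "(real ^ 'm::finite) set"
    and Np Nm \<nu> :: "real ^ 'm \<Rightarrow> real ^ 'm" and Np' Nm' :: "real ^ 'm \<Rightarrow> real ^ 'm \<Rightarrow> real ^ 'm"
    and H :: "real ^ 'm \<Rightarrow> real"
  assumes M: "C1_hypersurface M" and B: "open B" and split: "B - M = Bp \<union> Bm" "Bp \<inter> Bm = {}"
    and sides: "open Bp" "open Bm"
    and Np: "C1_field_on Bp Np Np'" "continuous_on (closure Bp) Np" "\<And>x. x \<in> Bp \<Longrightarrow> norm (Np x) \<le> 1"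
    and Nm: "C1_field_on Bm Nm Nm'" "continuous_on (closure Bm) Nm" "\<And>x. x \<in> Bm \<Longrightarrow> norm (Nm x) \<le> 1"
    and H: "\<And>x. x \<in> Bp \<Longrightarrow> trace_of (Np' x) = H x" "\<And>x. x \<in> Bm \<Longrightarrow> trace_of (Nm' x) = H x"
    and Hbdd: "Linfinity_on H B"
    and \<nu>: "\<And>p. p \<in> M \<inter> B \<Longrightarrow> outward_unit_normal M Bp p (\<nu> p)"
begin

text \<open>The functional tested by the weak formulation. With the gradient as a separate argument,
  additivity is just that of the integral.\<close>

definition defect :: "(real ^ 'm \<Rightarrow> real) \<Rightarrow> (real ^ 'm \<Rightarrow> real ^ 'm) \<Rightarrow> real" where
  "defect \<phi> D\<phi> = integral Bp (\<lambda>x. Np x \<bullet> D\<phi> x + \<phi> x * H x) + integral Bm (\<lambda>x. Nm x \<bullet> D\<phi> x + \<phi> x * H x)"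

text \<open>Both products pair a bounded measurable factor with a continuous factor of compact
  support. For \<open>H\<close> the bound holds only almost everywhere and is first made to hold
  everywhere.\<close>

lemma integrable_term:
  assumes \<phi>: "C1_compact_in B \<phi> D\<phi>" and S: "open S" "S \<subseteq> B"
    and N: "continuous_on S N" "\<And>x. x \<in> S \<Longrightarrow> norm (N x) \<le> 1"
  shows "(\<lambda>x. N x \<bullet> D\<phi> x + \<phi> x * H x) absolutely_integrable_on S"
proof -
  obtain K where K: "compact K" "K \<subseteq> B" "\<And>x. x \<notin> K \<Longrightarrow> \<phi> x = 0" "\<And>x. x \<notin> K \<Longrightarrow> D\<phi> x = 0"
    using C1_compact_in_support[OF \<phi>] by blast
  note \<phi>' = C1_compact_inD[OF \<phi>]
  have int: "f absolutely_integrable_on A" if "continuous_on UNIV f" "\<And>x. x \<notin> K \<Longrightarrow> f x = 0" "A \<in> sets lebesgue"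
    for f :: "real ^ 'm \<Rightarrow> 'b::euclidean_space" and A
  proof -
    have "f absolutely_integrable_on K"
      using K(1) that(1) by (blast intro: absolutely_integrable_compact continuous_on_subset)
    then have "f absolutely_integrable_on UNIV"
      by (rule absolutely_integrable_compact_support) (use that(2) in auto)
    then show ?thesis using that(3) by (rule set_integrable_subset) simp
  qed
  have A: "(\<lambda>x. N x \<bullet> D\<phi> x) absolutely_integrable_on S"
  proof (rule absolutely_integrable_bounded_measurable_product[OF bilinear_conv_bounded_bilinear[THEN iffD2, OF bounded_bilinear_inner]])
    show "N \<in> borel_measurable (lebesgue_on S)"
      using N(1) S(1) by (intro continuous_imp_measurable_on_sets_lebesgue) auto
    show "bounded (N ` S)" using N(2) by (auto simp: bounded_iff)
    show "D\<phi> absolutely_integrable_on S" using S(1) K(4) \<phi>'(2) by (intro int) auto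
  qed (use S in auto)
  obtain C where C: "AE x in lebesgue_on B. \<bar>H x\<bar> \<le> C" and Hm: "H \<in> borel_measurable (lebesgue_on B)"
    using Hbdd unfolding Linfinity_on_def by blast
  \<comment> \<open>Clipping gives a function that is bounded everywhere and agrees with
    \<open>H\<close> wherever the essential bound holds.\<close>
  define H' where "H' x = max (- \<bar>C\<bar>) (min \<bar>C\<bar> (H x))" for x
  have "(\<lambda>x. H' x * \<phi> x) absolutely_integrable_on B"
  proof (rule absolutely_integrable_bounded_measurable_product[OF bilinear_times])
    show "H' \<in> borel_measurable (lebesgue_on B)"
      unfolding H'_def using Hm by (intro borel_measurable_max borel_measurable_min borel_measurable_const)
    show "bounded (H' ` B)" unfolding bounded_iff H'_def by (intro exI[of _ "\<bar>C\<bar>"]) auto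
    show "\<phi> absolutely_integrable_on B" using B K(3) \<phi>'(3) by (intro int) auto
  qed (use B in auto)
  then have B': "(\<lambda>x. H' x * \<phi> x) absolutely_integrable_on S"
    by (rule set_integrable_subset) (use S in auto)
  have "B \<inter> space lebesgue \<in> sets lebesgue" using B by auto
  from AE_restrict_space_iff[OF this, THEN iffD1, OF C]
  obtain Z where Z: "negligible Z" "{x. \<not> (x \<in> B \<longrightarrow> \<bar>H x\<bar> \<le> C)} \<subseteq> Z"
    unfolding eventually_ae_filter_negligible by blast
  have "(\<lambda>x. \<phi> x * H x) absolutely_integrable_on S"
  proof (rule absolutely_integrable_spike[OF B' Z(1)])
    fix x assume "x \<in> S - Z"
    then have "\<bar>H x\<bar> \<le> C" using Z(2) S(2) by blast
    then show "\<phi> x * H x = H' x * \<phi> x" by (simp add: H'_def)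
  qed
  with A show ?thesis by (rule set_integral_add(1))
qed

lemma integrable_sides:
  assumes \<phi>: "C1_compact_in B \<phi> D\<phi>"
  shows "(\<lambda>x. Np x \<bullet> D\<phi> x + \<phi> x * H x) absolutely_integrable_on Bp"
    and "(\<lambda>x. Nm x \<bullet> D\<phi> x + \<phi> x * H x) absolutely_integrable_on Bm"
  using split(1) sides Np Nm continuous_on_subset[OF Np(2) closure_subset] continuous_on_subset[OF Nm(2) closure_subset]
  by (auto intro!: integrable_term[OF \<phi>])

lemma defect_add:
  assumes \<phi>: "C1_compact_in B \<phi> D\<phi>" and \<zeta>: "C1_compact_in B \<zeta> D\<zeta>"
  shows "defect (\<lambda>x. \<phi> x + \<zeta> x) (\<lambda>x. D\<phi> x + D\<zeta> x) = defect \<phi> D\<phi> + defect \<zeta> D\<zeta>"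
proof -
  note I = integrable_sides[THEN set_lebesgue_integral_eq_integral(1)]
  have "integral Bp (\<lambda>x. Np x \<bullet> (D\<phi> x + D\<zeta> x) + (\<phi> x + \<zeta> x) * H x) =
      integral Bp (\<lambda>x. Np x \<bullet> D\<phi> x + \<phi> x * H x) + integral Bp (\<lambda>x. Np x \<bullet> D\<zeta> x + \<zeta> x * H x)"
    by (subst integral_add[OF I(1)[OF \<phi>] I(1)[OF \<zeta>], symmetric]) (simp add: algebra_simps inner_add_right)
  moreover have "integral Bm (\<lambda>x. Nm x \<bullet> (D\<phi> x + D\<zeta> x) + (\<phi> x + \<zeta> x) * H x) =
      integral Bm (\<lambda>x. Nm x \<bullet> D\<phi> x + \<phi> x * H x) + integral Bm (\<lambda>x. Nm x \<bullet> D\<zeta> x + \<zeta> x * H x)"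
    by (subst integral_add[OF I(2)[OF \<phi>] I(2)[OF \<zeta>], symmetric]) (simp add: algebra_simps inner_add_right)
  ultimately show ?thesis by (simp add: defect_def)
qed

lemma defect_minus: "defect (\<lambda>x. - \<phi> x) (\<lambda>x. - D\<phi> x) = - defect \<phi> D\<phi>"
proof -
  have "integral S (\<lambda>x. N x \<bullet> - D\<phi> x + - \<phi> x * H x) = - integral S (\<lambda>x. N x \<bullet> D\<phi> x + \<phi> x * H x)"
    for S and N :: "real ^ 'm \<Rightarrow> real ^ 'm"
    by (subst integral_neg[symmetric]) simp
  then show ?thesis unfolding defect_def by simp
qed

text \<open>The two sides of a chart are distributed over \<open>Bp\<close> and \<open>Bm\<close> in
  one of two ways, and a reflection turns one way into the other.\<close>

lemma oriented_chart:
  assumes "p \<in> M" "p \<in> B"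
  obtains V q e r \<Psi> G G' Dd where "flat_chart V q e r \<Psi> G G' Dd" "p \<in> V" "V \<subseteq> B" "\<Psi> p = q"
    "\<forall>x\<in>V. x \<in> M \<longleftrightarrow> \<Psi> x \<bullet> e = 0"
    "{x \<in> V. 0 < \<Psi> x \<bullet> e} \<subseteq> Bp" "{x \<in> V. \<Psi> x \<bullet> e < 0} \<subseteq> Bm"
proof -
  obtain V q e r \<Psi> G G' Dd where ch: "flat_chart V q e r \<Psi> G G' Dd" and hV: "p \<in> V" "V \<subseteq> B" "\<Psi> p = q"
    and MV': "\<forall>x\<in>V. x \<in> M \<longleftrightarrow> \<Psi> x \<bullet> e = 0"
    by (rule flat_chart_exists[OF M B assms]) (rule that)
  have MV: "x \<in> M \<longleftrightarrow> \<Psi> x \<bullet> e = 0" if "x \<in> V" for x using MV' that by blast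
  interpret flat_chart V q e r \<Psi> G G' Dd by (rule ch)
  have p0: "\<Psi> p \<bullet> e = 0" using MV hV(1) assms(1) by blast
  have sub: "V - M \<subseteq> Bp \<union> Bm" using hV(2) split(1) by blast
  have "Vpos \<subseteq> Bp \<and> Vneg \<subseteq> Bm \<or> Vneg \<subseteq> Bp \<and> Vpos \<subseteq> Bm"
    using sides[OF hV(1) p0 MV sub split(2) interface.sides[OF interface_axioms]] \<nu> assms by blast
  then show ?thesis
  proof
    assume "Vpos \<subseteq> Bp \<and> Vneg \<subseteq> Bm"
    then show ?thesis using that[OF ch hV] MV unfolding Vpos_def Vneg_def by blast
  next
    assume *: "Vneg \<subseteq> Bp \<and> Vpos \<subseteq> Bm"
    have "mirror e (\<Psi> p) = q" using hV(3) q by (simp add: mirror_fixed)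
    moreover have "\<forall>x\<in>V. x \<in> M \<longleftrightarrow> mirror e (\<Psi> x) \<bullet> e = 0"
      using MV by (simp add: mirror_inner[OF e])
    moreover have "{x \<in> V. 0 < mirror e (\<Psi> x) \<bullet> e} \<subseteq> Bp" "{x \<in> V. mirror e (\<Psi> x) \<bullet> e < 0} \<subseteq> Bm"
      using * unfolding Vpos_def Vneg_def by (auto simp: mirror_inner[OF e])
    ultimately show ?thesis using that[OF mirrored hV(1,2)] by blast
  qed
qed

text \<open>Inside \<open>V\<close> the parts \<open>Bp\<close> and \<open>Bm\<close> are exactly
  the two sides of the chart, and the integrands vanish outside \<open>V\<close>. On each part
  \<open>H\<close> is the divergence, which gives the form in which the layer argument
  applies.\<close>

lemma defect_in_chart:
  assumes ch: "flat_chart V q e r \<Psi> G G' Dd" and hV: "V \<subseteq> B"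
    and MV: "\<forall>x\<in>V. x \<in> M \<longleftrightarrow> \<Psi> x \<bullet> e = 0"
    and or: "{x \<in> V. 0 < \<Psi> x \<bullet> e} \<subseteq> Bp" "{x \<in> V. \<Psi> x \<bullet> e < 0} \<subseteq> Bm"
    and \<phi>: "C1_compact_in V \<phi> D\<phi>"
  shows "defect \<phi> D\<phi> = integral {x \<in> V. 0 < \<Psi> x \<bullet> e} (weak_term Np Np' \<phi> D\<phi>) +
      integral {x \<in> V. \<Psi> x \<bullet> e < 0} (weak_term Nm Nm' \<phi> D\<phi>)"
    and "(weak_term Np Np' \<phi> D\<phi>) absolutely_integrable_on {x \<in> V. 0 < \<Psi> x \<bullet> e}"
    and "(weak_term Nm Nm' \<phi> D\<phi>) absolutely_integrable_on {x \<in> V. \<Psi> x \<bullet> e < 0}"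
proof -
  interpret flat_chart V q e r \<Psi> G G' Dd by (rule ch)
  obtain K where K: "compact K" "K \<subseteq> V" "\<And>x. x \<notin> K \<Longrightarrow> \<phi> x = 0" "\<And>x. x \<notin> K \<Longrightarrow> D\<phi> x = 0"
    using C1_compact_in_support[OF \<phi>] by blast
  let ?P = "{x \<in> V. 0 < \<Psi> x \<bullet> e}" and ?N = "{x \<in> V. \<Psi> x \<bullet> e < 0}"
  have dich: "x \<in> Bp \<longleftrightarrow> x \<in> ?P" "x \<in> Bm \<longleftrightarrow> x \<in> ?N" if "x \<in> V" for x
    using that MV[rule_format, OF that] split or by (auto simp: set_eq_iff subset_iff)
  have op: "open ?P" "open ?N"
  proof -
    have "continuous_on V (\<lambda>x. \<Psi> x \<bullet> e)" using \<Psi>(1) by (intro continuous_intros)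
    note pre = continuous_open_preimage[OF this flat_chart.V[OF ch]]
    show "open ?P" "open ?N"
      using pre[OF open_greaterThan[of 0]] pre[OF open_lessThan[of 0]] by (simp_all add: vimage_def Int_def)
  qed
  note int = integrable_sides[OF C1_compact_in_subset[OF \<phi> hV]]
  have intP: "(\<lambda>x. Np x \<bullet> D\<phi> x + \<phi> x * H x) absolutely_integrable_on ?P"
    by (rule set_integrable_subset[OF int(1)]) (use or op in auto)
  have intN: "(\<lambda>x. Nm x \<bullet> D\<phi> x + \<phi> x * H x) absolutely_integrable_on ?N"
    by (rule set_integrable_subset[OF int(2)]) (use or op in auto)
  have eqP: "Np x \<bullet> D\<phi> x + \<phi> x * H x = Np x \<bullet> D\<phi> x + \<phi> x * trace_of (Np' x)" if "x \<in> ?P" for x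
    using H(1) that or by auto
  have eqN: "Nm x \<bullet> D\<phi> x + \<phi> x * H x = Nm x \<bullet> D\<phi> x + \<phi> x * trace_of (Nm' x)" if "x \<in> ?N" for x
    using H(2) that or by auto
  show "(weak_term Np Np' \<phi> D\<phi>) absolutely_integrable_on ?P"
    by (rule set_integrable_cong[THEN iffD1, OF refl refl eqP intP])
  show "(weak_term Nm Nm' \<phi> D\<phi>) absolutely_integrable_on ?N"
    by (rule set_integrable_cong[THEN iffD1, OF refl refl eqN intN])
  have zero: "N x \<bullet> D\<phi> x + \<phi> x * h = 0" if "x \<notin> V" for x h and N :: "real ^ 'm \<Rightarrow> real ^ 'm"
    using K that by (metis subsetD inner_zero_right mult_zero_left add_0)
  have "integral Bp (\<lambda>x. Np x \<bullet> D\<phi> x + \<phi> x * H x) = integral ?P (\<lambda>x. Np x \<bullet> D\<phi> x + \<phi> x * H x)"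
    by (rule integral_eq_on_support) (use zero dich in blast)+
  moreover have "\<dots> = integral ?P (weak_term Np Np' \<phi> D\<phi>)"
    by (rule integral_cong) (rule eqP)
  moreover have "integral Bm (\<lambda>x. Nm x \<bullet> D\<phi> x + \<phi> x * H x) = integral ?N (\<lambda>x. Nm x \<bullet> D\<phi> x + \<phi> x * H x)"
    by (rule integral_eq_on_support) (use zero dich in blast)+
  moreover have "\<dots> = integral ?N (weak_term Nm Nm' \<phi> D\<phi>)"
    by (rule integral_cong) (rule eqN)
  ultimately show "defect \<phi> D\<phi> = integral ?P (weak_term Np Np' \<phi> D\<phi>) +
      integral ?N (weak_term Nm Nm' \<phi> D\<phi>)"
    by (simp add: defect_def)
qed

end

section \<open>Gradients and test functions\<close>

lemma C1_field_on_gradient: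
  fixes f :: "'a::euclidean_space \<Rightarrow> real"
  assumes W: "open W" "W \<subseteq> S" and f: "Ck_on 1 f S"
  shows "C1_field_on W f (\<lambda>x v. grad_within S f x \<bullet> v)" "continuous_on W (grad_within S f)"
proof -
  have F: "C1_field_on W f (\<lambda>x. frechet_derivative f (at x within S))"
    by (rule Ck_on_1_imp_C1_field_on[OF W f])
  have eq: "frechet_derivative f (at x within S) v = grad_within S f x \<bullet> v" if "x \<in> W" for x v
    unfolding grad_within_def using F that unfolding C1_field_on_def
    by (intro gradient_representation has_derivative_linear) blast
  show "C1_field_on W f (\<lambda>x v. grad_within S f x \<bullet> v)"
    unfolding C1_field_on_def
  proof (intro conjI ballI allI)
    show "(f has_derivative (\<lambda>v. grad_within S f x \<bullet> v)) (at x)" if "x \<in> W" for x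
      using F that unfolding C1_field_on_def by (metis (no_types, lifting) eq[OF that] ext)
    fix v
    have "continuous_on W (\<lambda>x. frechet_derivative f (at x within S) v)"
      using F unfolding C1_field_on_def by blast
    then show "continuous_on W (\<lambda>x. grad_within S f x \<bullet> v)"
      by (rule continuous_on_eq) (rule eq)
  qed
  show "continuous_on W (grad_within S f)"
    unfolding grad_within_def using F unfolding C1_field_on_def
    by (intro continuous_on_sum continuous_on_scaleR continuous_on_const) blast
qed

lemma test_function_C1_compact_in:
  assumes "\<phi> \<in> test_functions S"
  shows "C1_compact_in S \<phi> (grad \<phi>)"
proof -
  have \<phi>: "Ck_on 1 \<phi> UNIV" "compact (closure {x. \<phi> x \<noteq> 0})" "closure {x. \<phi> x \<noteq> 0} \<subseteq> S"
    using assms unfolding test_functions_def by blast+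
  note g = C1_field_on_gradient[OF open_UNIV order_refl \<phi>(1)]
  show ?thesis
    unfolding C1_compact_in_def
  proof (intro conjI allI impI exI[of _ "closure {x. \<phi> x \<noteq> 0}"])
    show "(\<phi> has_derivative (\<lambda>v. grad \<phi> x \<bullet> v)) (at x)" for x
      using g(1) unfolding C1_field_on_def by blast
    fix x assume "x \<notin> closure {x. \<phi> x \<noteq> 0}"
    then have "x \<notin> {x. \<phi> x \<noteq> 0}" by (rule contra_subsetD[OF closure_subset])
    then show "\<phi> x = 0" by simp
  qed (rule g(2) \<phi>(2,3))+
qed

text \<open>An inequality for all test functions becomes an equation by passing to the
  negative.\<close>

lemma test_functions_minus:
  assumes "\<phi> \<in> test_functions S"
  shows "(\<lambda>x. - \<phi> x) \<in> test_functions S" "grad (\<lambda>x. - \<phi> x) = (\<lambda>x. - grad \<phi> x)"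
proof -
  have neg: "Ck_on k f UNIV \<Longrightarrow> Ck_on k (\<lambda>x. - f x) UNIV" for k and f :: "'a \<Rightarrow> real"
  proof (induction k arbitrary: f)
    case 0
    then show ?case by (auto intro: continuous_on_minus)
  next
    case (Suc k)
    have d: "(f has_derivative frechet_derivative f (at x)) (at x)" for x
      by (rule frechet_derivative_works[THEN iffD1]) (use Suc.prems in \<open>simp add: differentiable_on_def\<close>)
    have "frechet_derivative (\<lambda>x. - f x) (at x) = (\<lambda>v. - frechet_derivative f (at x) v)" for x
      by (rule frechet_derivative_at[symmetric]) (rule has_derivative_minus[OF d])
    with Suc show ?case
      by (auto intro: differentiable_on_minus)
  qed
  show "(\<lambda>x. - \<phi> x) \<in> test_functions S"
    using assms neg unfolding test_functions_def by simp
  have "(\<phi> has_derivative (\<lambda>v. grad \<phi> x \<bullet> v)) (at x)" for x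
    using C1_compact_inD(1)[OF test_function_C1_compact_in[OF assms]] .
  from has_derivative_minus[OF this]
  have "frechet_derivative (\<lambda>x. - \<phi> x) (at x) = (\<lambda>v. - (grad \<phi> x \<bullet> v))" for x
    by (rule frechet_derivative_at[symmetric])
  then have "grad (\<lambda>x. - \<phi> x) x = - (\<Sum>i\<in>Basis. (grad \<phi> x \<bullet> i) *\<^sub>R i)" for x
    by (simp add: grad_within_def[of UNIV "\<lambda>x. - \<phi> x"] sum_negf)
  then show "grad (\<lambda>x. - \<phi> x) = (\<lambda>x. - grad \<phi> x)"
    by (simp add: euclidean_representation fun_eq_iff)
qed

section \<open>The jump criterion\<close>

context interface
begin

text \<open>The half of the chart with the interface included lies in the closure of the
  corresponding part, where the field is continuous by assumption.\<close>

lemma fields_up_to_interface: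
  assumes ch: "flat_chart V q e r \<Psi> G G' Dd"
    and or: "{x \<in> V. 0 < \<Psi> x \<bullet> e} \<subseteq> Bp" "{x \<in> V. \<Psi> x \<bullet> e < 0} \<subseteq> Bm"
  shows "C1_field_on {x \<in> V. 0 < \<Psi> x \<bullet> e} Np Np'" "C1_field_on {x \<in> V. \<Psi> x \<bullet> e < 0} Nm Nm'"
    "continuous_on {x \<in> V. 0 \<le> \<Psi> x \<bullet> e} Np" "continuous_on {x \<in> V. \<Psi> x \<bullet> e \<le> 0} Nm"
proof -
  interpret flat_chart V q e r \<Psi> G G' Dd by (rule ch)
  show "C1_field_on {x \<in> V. 0 < \<Psi> x \<bullet> e} Np Np'" "C1_field_on {x \<in> V. \<Psi> x \<bullet> e < 0} Nm Nm'"
    using Np(1) Nm(1) or unfolding C1_field_on_def by (blast intro: continuous_on_subset)+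
  have "closure Vpos \<subseteq> closure Bp" "closure Vneg \<subseteq> closure Bm"
    using or by (auto simp only: Vpos_def Vneg_def intro!: closure_mono)
  then show "continuous_on {x \<in> V. 0 \<le> \<Psi> x \<bullet> e} Np" "continuous_on {x \<in> V. \<Psi> x \<bullet> e \<le> 0} Nm"
    using closure_sides by (meson continuous_on_subset Np(2) Nm(2) order_trans)+
qed

text \<open>The claim is local. Near a point off the interface it is the divergence theorem; near a
  point of the interface the jump vanishes along \<open>Dd\<close> because the gradient is parallel
  to the normal, and the layer argument applies.\<close>

lemma defect_eq_0_if_no_jump:
  assumes jump: "\<And>p. p \<in> M \<inter> B \<Longrightarrow> (Np p - Nm p) \<bullet> \<nu> p = 0"
    and \<phi>: "C1_compact_in B \<phi> D\<phi>"
  shows "defect \<phi> D\<phi> = 0"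
proof (rule local_to_global[of B defect, OF defect_add _ \<phi>])
  \<comment> \<open>A test function supported in one part contributes nothing on the other part, and
    on its own part the divergence theorem gives 0.\<close>
  have half: "integral S (\<lambda>x. N x \<bullet> D\<phi> x + \<phi> x * H x) = 0"
    if \<phi>: "C1_compact_in A \<phi> D\<phi>" and A: "A = S \<or> A \<inter> S = {}" and S: "open S" "C1_field_on S N N'"
      and NH: "\<And>x. x \<in> S \<Longrightarrow> trace_of (N' x) = H x"
    for A S N N' \<phi> D\<phi>
  proof (cases "A = S")
    case True
    have "integral S (\<lambda>x. N x \<bullet> D\<phi> x + \<phi> x * H x) = integral S (weak_term N N' \<phi> D\<phi>)"
      using NH by (intro integral_cong) simp
    then show ?thesis
      using interior_divergence[OF S \<phi>[unfolded True]] by (simp add: integral_unique)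
  next
    case False
    obtain K where K: "compact K" "K \<subseteq> A" "\<And>x. x \<notin> K \<Longrightarrow> \<phi> x = 0" "\<And>x. x \<notin> K \<Longrightarrow> D\<phi> x = 0"
      using C1_compact_in_support[OF \<phi>] by blast
    have "x \<notin> K" if "x \<in> S" for x using that K(2) A False by blast
    then have "integral S (\<lambda>x. N x \<bullet> D\<phi> x + \<phi> x * H x) = integral S (\<lambda>x. 0)"
      using K(3,4) by (intro integral_cong) simp
    then show ?thesis by simp
  qed
  fix p assume p: "p \<in> B"
  consider "p \<in> Bp" | "p \<in> Bm" | "p \<in> M" using p split by blast
  then show "\<exists>W. open W \<and> p \<in> W \<and> (\<forall>\<phi> D\<phi>. C1_compact_in W \<phi> D\<phi> \<longrightarrow> defect \<phi> D\<phi> = 0)"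
  proof cases
    case 1
    have "defect \<phi> D\<phi> = 0" if "C1_compact_in Bp \<phi> D\<phi>" for \<phi> D\<phi>
      using half[OF that _ sides(1) Np(1) H(1)] half[OF that _ sides(2) Nm(1) H(2)] split(2)
      by (simp add: defect_def)
    with 1 sides show ?thesis by blast
  next
    case 2
    have "defect \<phi> D\<phi> = 0" if "C1_compact_in Bm \<phi> D\<phi>" for \<phi> D\<phi>
      using half[OF that _ sides(1) Np(1) H(1)] half[OF that _ sides(2) Nm(1) H(2)] split(2)
      by (simp add: defect_def Int_commute)
    with 2 sides show ?thesis by blast
  next
    case 3
    obtain V q e r \<Psi> G G' Dd where ch: "flat_chart V q e r \<Psi> G G' Dd" and hV: "p \<in> V" "V \<subseteq> B" "\<Psi> p = q"
      and MV': "\<forall>x\<in>V. x \<in> M \<longleftrightarrow> \<Psi> x \<bullet> e = 0"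
      and or: "{x \<in> V. 0 < \<Psi> x \<bullet> e} \<subseteq> Bp" "{x \<in> V. \<Psi> x \<bullet> e < 0} \<subseteq> Bm"
      by (rule oriented_chart[OF 3 p]) (rule that)
    have MV: "x \<in> M \<longleftrightarrow> \<Psi> x \<bullet> e = 0" if "x \<in> V" for x using MV' that by blast
    interpret flat_chart V q e r \<Psi> G G' Dd by (rule ch)
    note N = fields_up_to_interface[OF ch or]
    have jump': "(Np x - Nm x) \<bullet> Dd x = 0" if x: "x \<in> V" "\<Psi> x \<bullet> e = 0" for x
    proof -
      have xM: "x \<in> M \<inter> B" using x MV hV by blast
      then have "unit_normal M x (\<nu> x)" using \<nu> by (simp add: outward_unit_normal_def)
      then obtain c where "Dd x = c *\<^sub>R \<nu> x"
        using gradient_parallel_normal[OF x, of M "\<nu> x"] MV by blast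
      then show ?thesis using jump[OF xM] by simp
    qed
    have "defect \<phi> D\<phi> = 0" if \<phi>: "C1_compact_in V \<phi> D\<phi>" for \<phi> D\<phi>
    proof -
      note d = defect_in_chart[OF ch hV(2) MV' or \<phi>]
      show ?thesis
        unfolding d(1)
        by (rule no_jump_imp_zero[OF _ N(3) _ N(4) \<phi>, unfolded Vpos_def Vneg_def, OF N(1,2) d(2,3) jump'])
    qed
    with hV(1) flat_chart.V[OF ch] show ?thesis by blast
  qed
qed

text \<open>The flux difference is continuous up to the hyperplane and nonzero at \<open>q\<close>,
  so it keeps its sign near \<open>q\<close> with at least half of its size there. A bump supported
  in that region meets the hypotheses of the estimate with a jump.\<close>

lemma jump_detected:
  assumes p: "p \<in> M \<inter> B" and jump: "(Np p - Nm p) \<bullet> \<nu> p \<noteq> 0"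
  shows "\<exists>\<phi>\<in>test_functions B. defect \<phi> (grad \<phi>) \<noteq> 0"
proof -
  obtain V q e r \<Psi> G G' Dd where ch: "flat_chart V q e r \<Psi> G G' Dd" and hV: "p \<in> V" "V \<subseteq> B" "\<Psi> p = q"
    and MV': "\<forall>x\<in>V. x \<in> M \<longleftrightarrow> \<Psi> x \<bullet> e = 0"
    and or: "{x \<in> V. 0 < \<Psi> x \<bullet> e} \<subseteq> Bp" "{x \<in> V. \<Psi> x \<bullet> e < 0} \<subseteq> Bm"
    by (rule oriented_chart[OF IntD1[OF p] IntD2[OF p]]) (rule that)
  have MV: "x \<in> M \<longleftrightarrow> \<Psi> x \<bullet> e = 0" if "x \<in> V" for x using MV' that by blast
  interpret flat_chart V q e r \<Psi> G G' Dd by (rule ch)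
  note N = fields_up_to_interface[OF ch or]
  have un: "unit_normal M p (\<nu> p)" using \<nu> p by (simp add: outward_unit_normal_def)
  have p0: "\<Psi> p \<bullet> e = 0" using MV hV p by blast
  obtain c where c: "c \<noteq> 0" "Dd p = c *\<^sub>R \<nu> p"
    by (rule gradient_parallel_normal[OF hV(1) p0 _ un]) (use MV in auto)
  have qQ: "q \<in> ball q r" using r by simp
  have Gq: "G q = p" using \<Psi>(3)[OF hV(1)] hV(3) by simp
  define A where "A y = flux Np y - flux Nm (mirror e y)" for y
  have "A q = jacobian (G' q) * ((Np p - Nm p) \<bullet> Dd p)"
    using q by (simp add: A_def flux_def mirror_fixed Gq inner_diff_left right_diff_distrib)
  then have "A q \<noteq> 0" using jac[OF qQ] jump c by simp
  \<comment> \<open>Multiplying both fields by the sign of the jump reduces to a positive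
    jump.\<close>
  define \<sigma> where "\<sigma> = sgn (A q)"
  have \<sigma>: "\<sigma> * A q = \<bar>A q\<bar>" "\<bar>A q\<bar> > 0" "\<sigma> \<noteq> 0" using \<open>A q \<noteq> 0\<close> by (auto simp: \<sigma>_def sgn_real_def)
  have contA: "continuous_on upper A"
    unfolding A_def by (intro continuous_on_diff continuous_flux_upper[OF N(3,4)])
  have qu: "q \<in> upper" using qQ q by (simp add: upper_def)
  obtain \<delta> where \<delta>: "\<delta> > 0" "\<And>y. y \<in> upper \<Longrightarrow> dist y q < \<delta> \<Longrightarrow> dist (A y) (A q) < \<bar>A q\<bar> / 2"
    using contA[unfolded continuous_on_iff, rule_format, OF qu, of "\<bar>A q\<bar> / 2"] \<sigma>(2) by auto
  have A: "\<bar>A q\<bar> / 2 \<le> \<sigma> * A y" if "y \<in> upper" "dist y q < \<delta>" for y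
  proof -
    have "\<bar>\<sigma> * A y - \<sigma> * A q\<bar> < \<bar>A q\<bar> / 2"
      using \<delta>(2)[OF that] \<open>A q \<noteq> 0\<close> unfolding right_diff_distrib[symmetric] abs_mult
      by (simp add: \<sigma>_def abs_sgn_eq dist_real_def)
    then show ?thesis using \<sigma>(1) by linarith
  qed
  \<comment> \<open>The bump has to be supported where the chart maps into the region in which the
    flux difference keeps its sign.\<close>
  define V' where "V' = V \<inter> \<Psi> -` ball q \<delta>"
  have V': "open V'" unfolding V'_def by (rule continuous_open_preimage[OF \<Psi>(1) flat_chart.V[OF ch] open_ball])
  have "p \<in> V'" using hV \<delta>(1) by (simp add: V'_def)
  obtain a b where ab: "cbox a b \<subseteq> V'" "p \<in> box a b"
    using open_contains_cbox[OF V' \<open>p \<in> V'\<close>] by metis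
  let ?\<phi> = "box_bump a b 0"
  have \<phi>V: "C1_compact_in V ?\<phi> (grad ?\<phi>)"
    by (rule test_function_C1_compact_in[OF box_bump_test_function]) (use ab in \<open>auto simp: V'_def\<close>)
  have \<phi>pos: "0 \<le> ?\<phi> x" "?\<phi> (G q) > 0" for x
    using ab(2) by (auto simp: box_bump_bounds box_bump_pos Gq)
  have far: "\<bar>A q\<bar> / 2 \<le> flux (\<lambda>x. \<sigma> *\<^sub>R Np x) y - flux (\<lambda>x. \<sigma> *\<^sub>R Nm x) (mirror e y)"
    if y: "y \<in> upper" "?\<phi> (G y) \<noteq> 0" for y
  proof -
    have "G y \<in> box a b" using y(2) box_bump_eq_0 by blast
    then have "G y \<in> V'" using ab(1) box_subset_cbox by blast
    moreover have "\<Psi> (G y) = y" using y(1) G\<Psi> by (simp add: upper_def)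
    ultimately have "dist y q < \<delta>" by (simp add: V'_def dist_commute)
    from A[OF y(1) this] show ?thesis
      by (simp add: A_def flux_def right_diff_distrib mult.left_commute)
  qed
  note d = defect_in_chart[OF ch hV(2) MV' or \<phi>V]
  have scaled: "(\<lambda>x. (\<sigma> *\<^sub>R N x) \<bullet> grad ?\<phi> x + ?\<phi> x * trace_of (\<lambda>v. \<sigma> *\<^sub>R N' x v)) =
      (\<lambda>x. \<sigma> * (N x \<bullet> grad ?\<phi> x + ?\<phi> x * trace_of (N' x)))" for N :: "real ^ 'm \<Rightarrow> real ^ 'm" and N'
    by (auto simp: trace_of_def sum_distrib_left algebra_simps)
  have C1: "C1_field_on S (\<lambda>x. \<sigma> *\<^sub>R N x) (\<lambda>x v. \<sigma> *\<^sub>R N' x v)" if "C1_field_on S N N'"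
    for S and N :: "real ^ 'm \<Rightarrow> real ^ 'm" and N'
    using that unfolding C1_field_on_def
    by (intro conjI ballI allI has_derivative_scaleR_right continuous_on_scaleR continuous_on_const) auto
  have int: "(\<lambda>x. (\<sigma> *\<^sub>R Np x) \<bullet> grad ?\<phi> x + ?\<phi> x * trace_of (\<lambda>v. \<sigma> *\<^sub>R Np' x v)) absolutely_integrable_on {x \<in> V. 0 < \<Psi> x \<bullet> e}"
    "(\<lambda>x. (\<sigma> *\<^sub>R Nm x) \<bullet> grad ?\<phi> x + ?\<phi> x * trace_of (\<lambda>v. \<sigma> *\<^sub>R Nm' x v)) absolutely_integrable_on {x \<in> V. \<Psi> x \<bullet> e < 0}"
    unfolding scaled using d(2,3) by (auto intro: set_integrable_mult_right)
  have "\<sigma> * defect ?\<phi> (grad ?\<phi>) =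
     integral {x \<in> V. 0 < \<Psi> x \<bullet> e} (\<lambda>x. (\<sigma> *\<^sub>R Np x) \<bullet> grad ?\<phi> x + ?\<phi> x * trace_of (\<lambda>v. \<sigma> *\<^sub>R Np' x v)) +
     integral {x \<in> V. \<Psi> x \<bullet> e < 0} (\<lambda>x. (\<sigma> *\<^sub>R Nm x) \<bullet> grad ?\<phi> x + ?\<phi> x * trace_of (\<lambda>v. \<sigma> *\<^sub>R Nm' x v))"
    unfolding scaled d(1) integral_mult_right by (rule distrib_left)
  also have "\<dots> < 0"
  proof (rule jump_imp_nonzero[unfolded Vpos_def Vneg_def, OF C1[OF N(1)] _ C1[OF N(2)] _ \<phi>V \<phi>pos int _ far])
    show "continuous_on {x \<in> V. 0 \<le> \<Psi> x \<bullet> e} (\<lambda>x. \<sigma> *\<^sub>R Np x)" "continuous_on {x \<in> V. \<Psi> x \<bullet> e \<le> 0} (\<lambda>x. \<sigma> *\<^sub>R Nm x)"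
      by (intro continuous_on_scaleR continuous_on_const N)+
  qed (use \<sigma>(2) in simp)
  finally have "defect ?\<phi> (grad ?\<phi>) \<noteq> 0" by auto
  moreover have "?\<phi> \<in> test_functions B"
    by (rule box_bump_test_function) (use ab hV(2) in \<open>auto simp: V'_def\<close>)
  ultimately show ?thesis by blast
qed

end

subsection \<open>Weak gradients and the normalized field\<close>

text \<open>Locally the hypersurface is the image of a piece of a hyperplane under a differentiable
  map, and such maps preserve negligible sets.\<close>

lemma negligible_hypersurface:
  fixes M :: "(real ^ 'm::finite) set"
  assumes "C1_hypersurface M"
  shows "negligible M"
proof (rule locally_negligible_alt[THEN iffD2], rule ballI)
  fix p assume p: "p \<in> M"
  obtain V q e r \<Psi> G G' Dd where ch: "flat_chart V q e r \<Psi> G G' Dd" and hV: "p \<in> V" "V \<subseteq> UNIV" "\<Psi> p = q"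
    and MV: "\<forall>x\<in>V. x \<in> M \<longleftrightarrow> \<Psi> x \<bullet> e = 0"
    by (rule flat_chart_exists[OF assms open_UNIV p UNIV_I]) (rule that)
  interpret flat_chart V q e r \<Psi> G G' Dd by (rule ch)
  define Y where "Y = {y \<in> ball q r. e \<bullet> y = 0}"
  have "negligible {y. e \<bullet> y = 0}" using e by (intro negligible_hyperplane) (auto simp: nonzero_Basis)
  then have "negligible Y" by (rule negligible_subset) (auto simp: Y_def)
  moreover have "G differentiable_on Y"
    using G' unfolding C1_field_on_def differentiable_on_def Y_def differentiable_def
    by (blast intro: has_derivative_at_withinI)
  ultimately have "negligible (G ` Y)"
    by (intro negligible_differentiable_image_negligible) auto
  moreover have "M \<inter> V \<subseteq> G ` Y"
  proof
    fix x assume x: "x \<in> M \<inter> V"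
    then have "\<Psi> x \<in> Y" using \<Psi>Q MV by (auto simp: Y_def inner_commute[of e] simp del: mem_ball)
    then show "x \<in> G ` Y" using \<Psi>(3) x by (metis IntD2 imageI)
  qed
  ultimately have "negligible (M \<inter> V)" by (rule negligible_subset)
  moreover have "openin (top_of_set M) (M \<inter> V)"
    using flat_chart.V[OF ch] by (rule openin_open_Int)
  ultimately show "\<exists>U. openin (top_of_set M) U \<and> p \<in> U \<and> negligible U"
    using p hV(1) by (intro exI[of _ "M \<inter> V"]) simp
qed

text \<open>Completeness of Lebesgue measure supplies the measurability of the second integrand.
  Thus the measurability of the singular set of an arbitrary weak gradient never has to be
  discussed.\<close>

lemma set_lebesgue_integral_AE_eq:
  fixes f h :: "'a::euclidean_space \<Rightarrow> 'b::euclidean_space"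
  assumes f: "f absolutely_integrable_on S"
    and ae: "AE x in lebesgue. indicat_real S x *\<^sub>R f x = indicat_real T x *\<^sub>R h x"
  shows "(LINT x:T|lebesgue. h x) = (LINT x:S|lebesgue. f x)"
proof -
  have m: "(\<lambda>x. indicat_real S x *\<^sub>R f x) \<in> borel_measurable lebesgue"
    using f by (simp add: set_integrable_def borel_measurable_integrable)
  have "(\<lambda>x. indicat_real T x *\<^sub>R h x) \<in> borel_measurable lebesgue"
    by (rule borel_measurable_AE[OF m ae])
  then show ?thesis
    unfolding set_lebesgue_integral_def using ae m by (intro integral_cong_AE) auto
qed

text \<open>The classical gradient satisfies the same integration by parts against test functions in
  \<open>W\<close>, so the difference of the two gradients is orthogonal to all of them.\<close>

lemma weak_gradient_AE:
  fixes u :: "'a::euclidean_space \<Rightarrow> real"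
  assumes g: "has_weak_gradient B u g" and W: "open W" "W \<subseteq> B"
    and u: "C1_field_on W u (\<lambda>x v. Du x \<bullet> v)" "continuous_on W Du"
  shows "AE x in lebesgue. x \<in> W \<longrightarrow> g x = Du x"
proof -
  have contu: "continuous_on W u"
    using u(1) by (rule C1_field_on_continuous)
  have gint: "g absolutely_integrable_on K" if "compact K" "K \<subseteq> W" for K
    using g that W(2) unfolding has_weak_gradient_def locally_integrable_on_def by blast
  have Duint: "Du absolutely_integrable_on K" if "compact K" "K \<subseteq> W" for K
    using absolutely_integrable_compact that u(2) continuous_on_subset by blast
  have "AE x in lebesgue. x \<in> W \<longrightarrow> g x - Du x = 0"
  proof (rule fundamental_lemma_of_variations[OF W(1)])
    show "locally_integrable_on (\<lambda>x. g x - Du x) W"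
      unfolding locally_integrable_on_def using gint Duint set_integral_diff(1) by blast
    fix \<phi> :: "'a \<Rightarrow> real" assume t: "\<phi> \<in> test_functions W"
    then have tB: "\<phi> \<in> test_functions B" using W(2) unfolding test_functions_def by blast
    note \<phi> = test_function_C1_compact_in[OF t]
    note \<phi>' = C1_compact_inD[OF \<phi>]
    obtain K where K: "compact K" "K \<subseteq> W" "\<And>x. x \<notin> K \<Longrightarrow> \<phi> x = 0" "\<And>x. x \<notin> K \<Longrightarrow> grad \<phi> x = 0"
      using C1_compact_in_support[OF \<phi>] by blast
    have sc: "(\<lambda>x. \<phi> x *\<^sub>R h x) absolutely_integrable_on W" if "h absolutely_integrable_on K" for h :: "'a \<Rightarrow> 'a"
    proof (rule absolutely_integrable_compact_support[OF _ K(2)])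
      show "(\<lambda>x. \<phi> x *\<^sub>R h x) absolutely_integrable_on K"
      proof (rule absolutely_integrable_bounded_measurable_product
          [OF bilinear_conv_bounded_bilinear[THEN iffD2, OF bounded_bilinear_scaleR] _ _ _ that])
        have c: "continuous_on K \<phi>" using \<phi>'(3) continuous_on_subset by blast
        show "K \<in> sets lebesgue" using K(1) by (simp add: compact_imp_closed)
        with c show "\<phi> \<in> borel_measurable (lebesgue_on K)" by (rule continuous_imp_measurable_on_sets_lebesgue)
        show "bounded (\<phi> ` K)" using compact_continuous_image[OF c K(1)] by (rule compact_imp_bounded)
      qed
    qed (use K in simp)
    have int1: "(\<lambda>x. \<phi> x *\<^sub>R g x) absolutely_integrable_on W" by (rule sc[OF gint[OF K(1,2)]])
    have int2: "(\<lambda>x. \<phi> x *\<^sub>R Du x) absolutely_integrable_on W" by (rule sc[OF Duint[OF K(1,2)]])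
    have int3: "(\<lambda>x. u x *\<^sub>R grad \<phi> x) absolutely_integrable_on W"
    proof (rule absolutely_integrable_compact_support[OF absolutely_integrable_compact K(2)])
      show "continuous_on K (\<lambda>x. u x *\<^sub>R grad \<phi> x)"
        using contu \<phi>'(2) K(2) by (intro continuous_on_scaleR) (blast intro: continuous_on_subset)+
    qed (use K in simp_all)
    have i1: "(LINT x:B|lebesgue. \<phi> x *\<^sub>R g x) = (LINT x:W|lebesgue. \<phi> x *\<^sub>R g x)"
      using K W(2) by (intro set_lebesgue_integral_AE_eq int1 AE_I2) (auto simp: indicator_def subset_iff)
    have i3: "(LINT x:B|lebesgue. u x *\<^sub>R grad \<phi> x) = (LINT x:W|lebesgue. u x *\<^sub>R grad \<phi> x)"
      using K W(2) by (intro set_lebesgue_integral_AE_eq int3 AE_I2) (auto simp: indicator_def subset_iff)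
    \<comment> \<open>In each coordinate this is the divergence theorem for \<phi> times the field
      \<open>u x *\<^sub>R i\<close>.\<close>
    have byparts: "((\<lambda>x. u x *\<^sub>R grad \<phi> x + \<phi> x *\<^sub>R Du x) has_integral 0) W"
    proof (subst has_integral_componentwise_iff, intro ballI)
      fix i :: 'a assume i: "i \<in> Basis"
      have C1: "C1_field_on W (\<lambda>x. u x *\<^sub>R i) (\<lambda>x v. (Du x \<bullet> v) *\<^sub>R i)"
        using u(1) unfolding C1_field_on_def
        by (intro conjI ballI allI has_derivative_scaleR_left continuous_on_scaleR continuous_on_const) auto
      have tr: "trace_of (\<lambda>v. (a \<bullet> v) *\<^sub>R i) = a \<bullet> i" for a :: 'a
        using i unfolding trace_of_def by (simp add: inner_Basis if_distrib cong: if_cong)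
      have "((\<lambda>x. (u x *\<^sub>R i) \<bullet> grad \<phi> x + \<phi> x * (Du x \<bullet> i)) has_integral 0) W"
        using interior_divergence[OF W(1) C1 \<phi>] unfolding tr .
      then show "((\<lambda>x. (u x *\<^sub>R grad \<phi> x + \<phi> x *\<^sub>R Du x) \<bullet> i) has_integral 0 \<bullet> i) W"
        by (simp add: inner_add_left inner_commute[of i])
    qed
    have "(LINT x:W|lebesgue. u x *\<^sub>R grad \<phi> x) + (LINT x:W|lebesgue. \<phi> x *\<^sub>R Du x) =
        (LINT x:W|lebesgue. u x *\<^sub>R grad \<phi> x + \<phi> x *\<^sub>R Du x)"
      by (rule set_integral_add(2)[OF int3 int2, symmetric])
    also have "\<dots> = 0"
      using set_lebesgue_integral_eq_integral(2)[OF set_integral_add(1)[OF int3 int2]] byparts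
      by (simp add: integral_unique)
    finally have "(LINT x:W|lebesgue. \<phi> x *\<^sub>R Du x) = - (LINT x:W|lebesgue. u x *\<^sub>R grad \<phi> x)"
      by (simp add: add_eq_0_iff)
    also have "\<dots> = (LINT x:W|lebesgue. \<phi> x *\<^sub>R g x)"
      using g tB unfolding has_weak_gradient_def i1[symmetric] i3[symmetric] by simp
    finally have "(LINT x:W|lebesgue. \<phi> x *\<^sub>R g x) - (LINT x:W|lebesgue. \<phi> x *\<^sub>R Du x) = 0" by simp
    then show "(LINT x:W|lebesgue. \<phi> x *\<^sub>R (g x - Du x)) = 0"
      unfolding scaleR_diff_right set_integral_diff(2)[OF int1 int2] .
  qed
  then show ?thesis by eventually_elim auto
qed

section \<open>Regularity of the normalized field\<close>

lemma C1_field_on_normalized: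
  fixes w :: "'a::euclidean_space \<Rightarrow> 'a"
  assumes w: "C1_field_on W w w'" and nz: "\<And>x. x \<in> W \<Longrightarrow> w x \<noteq> 0"
  shows "\<exists>N'. C1_field_on W (\<lambda>x. w x /\<^sub>R norm (w x)) N'"
proof -
  have w': "(w has_derivative w' x) (at x)" if "x \<in> W" for x
    using w that unfolding C1_field_on_def by blast
  have cont: "continuous_on W w"
    using w by (rule C1_field_on_continuous)
  \<comment> \<open>The quotient rule, with \<open>sgn (w x)\<close> as the gradient of the norm at
    \<open>w x\<close>.\<close>
  let ?N' = "\<lambda>x v. inverse (norm (w x)) *\<^sub>R w' x v - (inverse (norm (w x)) ^ 2 * (w' x v \<bullet> sgn (w x))) *\<^sub>R w x"
  have "((\<lambda>x. w x /\<^sub>R norm (w x)) has_derivative ?N' x) (at x)" if x: "x \<in> W" for x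
  proof -
    have "((\<lambda>x. norm (w x)) has_derivative (\<lambda>v. w' x v \<bullet> sgn (w x))) (at x)"
      using has_derivative_compose[OF w'[OF x] has_derivative_norm[OF nz[OF x]]] .
    then have "((\<lambda>x. inverse (norm (w x))) has_derivative
        (\<lambda>v. - (inverse (norm (w x)) * (w' x v \<bullet> sgn (w x)) * inverse (norm (w x))))) (at x)"
      using nz[OF x] by (intro Deriv.has_derivative_inverse) auto
    from has_derivative_scaleR[OF this w'[OF x]] show ?thesis
      by (rule has_derivative_eq_rhs) (auto simp: fun_eq_iff power2_eq_square mult.commute mult.left_commute)
  qed
  moreover have "continuous_on W (\<lambda>x. ?N' x v)" for v
    using w cont nz unfolding C1_field_on_def sgn_div_norm by (intro continuous_intros) auto
  ultimately show ?thesis unfolding C1_field_on_def by (intro exI[of _ ?N'] conjI ballI allI)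
qed

lemma C1_field_on_cong:
  assumes S: "open S" and f: "C1_field_on S f f'" and eq: "\<And>x. x \<in> S \<Longrightarrow> g x = f x"
  shows "C1_field_on S g f'"
  unfolding C1_field_on_def
proof (intro conjI ballI allI)
  show "(g has_derivative f' x) (at x)" if "x \<in> S" for x
    by (rule has_derivative_transform_within_open[OF _ S that, of f])
      (use f that eq in \<open>auto simp: C1_field_on_def\<close>)
qed (use f in \<open>simp add: C1_field_on_def\<close>)

lemma C1_field_on_subset: "C1_field_on S f f' \<Longrightarrow> T \<subseteq> S \<Longrightarrow> C1_field_on T f f'"
  unfolding C1_field_on_def by (blast intro: continuous_on_subset)

text \<open>Every partial derivative of a C2 function is C1, and the gradient is their combination
  over the basis.\<close>

lemma C1_field_on_grad_plus:
  fixes u :: "'a::euclidean_space \<Rightarrow> real"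
  assumes W: "open W" "W \<subseteq> S" "W \<subseteq> \<Omega>" and u: "Ck_on 2 u S" and F: "Ck_on 1 F \<Omega>"
  shows "\<exists>w'. C1_field_on W (\<lambda>x. grad_within S u x + F x) w'"
proof -
  have "Ck_on 1 (\<lambda>x. frechet_derivative u (at x within S) i) S" for i
    using u by (simp add: numeral_2_eq_2)
  then have D: "C1_field_on W (\<lambda>x. frechet_derivative u (at x within S) i)
      (\<lambda>x. frechet_derivative (\<lambda>x. frechet_derivative u (at x within S) i) (at x within S))" for i
    by (rule Ck_on_1_imp_C1_field_on[OF W(1,2)])
  have F': "C1_field_on W F (\<lambda>x. frechet_derivative F (at x within \<Omega>))"
    by (rule Ck_on_1_imp_C1_field_on[OF W(1,3) F])
  have "C1_field_on W (\<lambda>x. grad_within S u x + F x)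
      (\<lambda>x v. (\<Sum>i\<in>Basis. frechet_derivative (\<lambda>x. frechet_derivative u (at x within S) i) (at x within S) v *\<^sub>R i) +
         frechet_derivative F (at x within \<Omega>) v)"
    unfolding C1_field_on_def grad_within_def
    by (intro conjI ballI allI has_derivative_add has_derivative_sum has_derivative_scaleR_left
        continuous_on_add continuous_on_sum continuous_on_scaleR continuous_on_const)
      (use D F' in \<open>simp_all add: C1_field_on_def\<close>)
  then show ?thesis by (intro exI)
qed

theorem proposition6p2:
  fixes \<Omega> \<Gamma> B Bp Bm :: "(real ^ 'm) set"
    and F Np Nm \<nu>p \<nu>m :: "real ^ 'm \<Rightarrow> real ^ 'm"
    and u H :: "real ^ 'm \<Rightarrow> real"
  assumes "open \<Omega>" "connected \<Omega>" "\<Omega> \<noteq> {}"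
    and "\<Gamma> \<subseteq> \<Omega>" "C1_hypersurface \<Gamma>" "orientable_hypersurface \<Gamma>"
    and "open B" "B \<inter> \<Gamma> \<noteq> {}" "compact (closure B)" "closure B \<subseteq> \<Omega>" "C1_boundary B"
    and "B - \<Gamma> = Bp \<union> Bm" "Bp \<inter> Bm = {}"
    and "open Bp" "connected Bp" "Bp \<noteq> {}"
    and "open Bm" "connected Bm" "Bm \<noteq> {}"
    and "Ck_on 1 F \<Omega>"
    and "Ck_on 2 u (\<Omega> - \<Gamma>)"
    and "singular_set F (grad_within (\<Omega> - \<Gamma>) u) \<inter> (\<Omega> - \<Gamma>) = {}"
    and "u \<in> W1 B"
    and "continuous_on (closure Bp) Np" "\<forall>x\<in>Bp. Np x = N_field F (grad_within (\<Omega> - \<Gamma>) u) x"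
    and "continuous_on (closure Bm) Nm" "\<forall>x\<in>Bm. Nm x = N_field F (grad_within (\<Omega> - \<Gamma>) u) x"
    and "continuous_on (B - \<Gamma>) H" "Linfinity_on H B"
    and "\<forall>x\<in>Bp. divergence Np x = H x"
    and "\<forall>x\<in>Bm. divergence Nm x = H x"
    and "\<forall>p\<in>\<Gamma> \<inter> B. outward_unit_normal \<Gamma> Bp p (\<nu>p p)"
    and "\<forall>p\<in>\<Gamma> \<inter> B. outward_unit_normal \<Gamma> Bm p (\<nu>m p)"
    and "\<forall>p\<in>\<Gamma> \<inter> B. \<nu>m p = - \<nu>p p"
  shows "weak_solution F H B u \<longleftrightarrow>
    (\<forall>p\<in>\<Gamma> \<inter> B. (Np p - Nm p) \<bullet> \<nu>p p = (Np p - Nm p) \<bullet> \<nu>m p \<and> (Np p - Nm p) \<bullet> \<nu>m p = 0)"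
proof -
  let ?S = "\<Omega> - \<Gamma>" and ?W = "Bp \<union> Bm"
  let ?Du = "grad_within ?S u"
  let ?N = "N_field F ?Du"
  note split = \<open>B - \<Gamma> = Bp \<union> Bm\<close> \<open>Bp \<inter> Bm = {}\<close>
  have BO: "B \<subseteq> \<Omega>" using \<open>closure B \<subseteq> \<Omega>\<close> closure_subset by (rule order_trans[rotated])
  have W: "open ?W" "?W \<subseteq> ?S" "?W \<subseteq> \<Omega>" "?W \<subseteq> B"
    using \<open>open Bp\<close> \<open>open Bm\<close> split BO by auto
  have nonsing: "?Du x + F x \<noteq> 0" if "x \<in> ?W" for x
    using \<open>singular_set F ?Du \<inter> ?S = {}\<close> W(2) that by (auto simp: singular_set_def)
  obtain w' where w': "C1_field_on ?W (\<lambda>x. ?Du x + F x) w'"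
    using C1_field_on_grad_plus[OF W(1,2,3) \<open>Ck_on 2 u ?S\<close> \<open>Ck_on 1 F \<Omega>\<close>] by blast
  \<comment> \<open>One derivative serves both sides, since on the open set
    \<open>Bp \<union> Bm\<close> both fields are restrictions of the same normalized field.\<close>
  obtain N' where N': "C1_field_on ?W ?N N'"
    using C1_field_on_normalized[OF w' nonsing] unfolding N_field_def[abs_def] by blast
  have Np': "C1_field_on Bp Np N'"
    by (rule C1_field_on_cong[OF \<open>open Bp\<close> C1_field_on_subset[OF N']])
      (use \<open>\<forall>x\<in>Bp. Np x = ?N x\<close> in auto)
  have Nm': "C1_field_on Bm Nm N'"
    by (rule C1_field_on_cong[OF \<open>open Bm\<close> C1_field_on_subset[OF N']])
      (use \<open>\<forall>x\<in>Bm. Nm x = ?N x\<close> in auto)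
  have norm_N: "norm (?N x) \<le> 1" for x
    by (cases "?Du x + F x = 0") (auto simp: N_field_def)
  have tr: "trace_of (K' x) = divergence K x" if "C1_field_on A K K'" "x \<in> A"
    for A K' x and K :: "real ^ 'm \<Rightarrow> real ^ 'm"
  proof -
    have "(K has_derivative K' x) (at x)" using that unfolding C1_field_on_def by blast
    then have "K' x = frechet_derivative K (at x)" by (rule frechet_derivative_at)
    then show ?thesis by (simp add: trace_of_def divergence_def)
  qed
  interpret interface \<Gamma> B Bp Bm Np Nm \<nu>p N' N' H
  proof
    show "norm (Np x) \<le> 1" if "x \<in> Bp" for x
      using \<open>\<forall>x\<in>Bp. Np x = ?N x\<close> norm_N that by simp
    show "norm (Nm x) \<le> 1" if "x \<in> Bm" for x
      using \<open>\<forall>x\<in>Bm. Nm x = ?N x\<close> norm_N that by simp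
    show "trace_of (N' x) = H x" if "x \<in> Bp" for x
      using \<open>\<forall>x\<in>Bp. divergence Np x = H x\<close> tr[OF Np' that] that by simp
    show "trace_of (N' x) = H x" if "x \<in> Bm" for x
      using \<open>\<forall>x\<in>Bm. divergence Nm x = H x\<close> tr[OF Nm' that] that by simp
    show "outward_unit_normal \<Gamma> Bp p (\<nu>p p)" if "p \<in> \<Gamma> \<inter> B" for p
      using \<open>\<forall>p\<in>\<Gamma> \<inter> B. outward_unit_normal \<Gamma> Bp p (\<nu>p p)\<close> that by blast
  qed fact+
  have null: "AE x in lebesgue. x \<notin> \<Gamma>"
    using negligible_hypersurface[OF \<open>C1_hypersurface \<Gamma>\<close>]
    unfolding negligible_iff_null_sets by (rule AE_not_in)
  \<comment> \<open>The right-hand side does not involve \<open>g\<close>, so the quantification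
    over all weak gradients in \<open>weak_solution\<close> collapses.\<close>
  have weak_form: "(LINT x:singular_set F g \<inter> B|lebesgue. norm (grad \<phi> x)) +
        (LINT x:B - singular_set F g|lebesgue. N_field F g x \<bullet> grad \<phi> x) +
        (LINT x:B|lebesgue. H x * \<phi> x) = defect \<phi> (grad \<phi>)"
    if g: "has_weak_gradient B u g" and t: "\<phi> \<in> test_functions B" for g \<phi>
  proof -
    note \<phi> = test_function_C1_compact_in[OF t]
    have "Ck_on 1 u ?S"
      using \<open>Ck_on 2 u ?S\<close> by (auto simp: numeral_2_eq_2 differentiable_imp_continuous_on)
    from C1_field_on_gradient[OF W(1,2) this]
    have "AE x in lebesgue. x \<in> ?W \<longrightarrow> g x = ?Du x"
      by (rule weak_gradient_AE[OF g W(1,4)])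
    \<comment> \<open>Almost every point of \<open>B\<close> lies in \<open>Bp\<close> or
      \<open>Bm\<close>, where the weak gradient is the classical one and there are no singular
      points. The term over the singular set therefore vanishes.\<close>
    with null have ae: "AE x in lebesgue. x \<in> B \<longrightarrow> x \<in> ?W \<and> g x = ?Du x \<and> x \<notin> singular_set F g"
    proof eventually_elim
      case (elim x)
      have "x \<in> ?W" if "x \<in> B" using that elim(1) split(1) by blast
      with elim(2) nonsing[of x] show ?case by (auto simp: singular_set_def)
    qed
    have contN: "continuous_on ?W ?N"
      using N' by (rule C1_field_on_continuous)
    have h: "(\<lambda>x. ?N x \<bullet> grad \<phi> x + \<phi> x * H x) absolutely_integrable_on ?W"
      by (rule integrable_term[OF \<phi> W(1,4) contN norm_N])
    have h2: "(\<lambda>x. \<phi> x * H x) absolutely_integrable_on ?W"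
      using integrable_term[OF \<phi> W(1,4), of "\<lambda>x. 0"] by simp
    have h1: "(\<lambda>x. ?N x \<bullet> grad \<phi> x) absolutely_integrable_on ?W"
      using set_integral_diff(1)[OF h h2] by simp
    have "(LINT x:singular_set F g \<inter> B|lebesgue. norm (grad \<phi> x)) = (LINT x:{}|lebesgue. norm (grad \<phi> x))"
    proof (rule set_lebesgue_integral_AE_eq)
      show "AE x in lebesgue. indicat_real {} x *\<^sub>R norm (grad \<phi> x) =
          indicat_real (singular_set F g \<inter> B) x *\<^sub>R norm (grad \<phi> x)"
        using ae by eventually_elim auto
    qed (simp add: set_integrable_def)
    moreover have "(LINT x:B - singular_set F g|lebesgue. N_field F g x \<bullet> grad \<phi> x) = (LINT x:?W|lebesgue. ?N x \<bullet> grad \<phi> x)"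
    proof (rule set_lebesgue_integral_AE_eq[OF h1])
      show "AE x in lebesgue. indicat_real ?W x *\<^sub>R (?N x \<bullet> grad \<phi> x) =
          indicat_real (B - singular_set F g) x *\<^sub>R (N_field F g x \<bullet> grad \<phi> x)"
        using ae by eventually_elim (use W(4) in \<open>auto simp: indicator_def N_field_def\<close>)
    qed
    moreover have "(LINT x:B|lebesgue. H x * \<phi> x) = (LINT x:?W|lebesgue. \<phi> x * H x)"
    proof (rule set_lebesgue_integral_AE_eq[OF h2])
      show "AE x in lebesgue. indicat_real ?W x *\<^sub>R (\<phi> x * H x) = indicat_real B x *\<^sub>R (H x * \<phi> x)"
        using ae by eventually_elim (use W(4) in \<open>auto simp: indicator_def\<close>)
    qed
    moreover have "(LINT x:?W|lebesgue. ?N x \<bullet> grad \<phi> x) + (LINT x:?W|lebesgue. \<phi> x * H x) =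
        (LINT x:?W|lebesgue. ?N x \<bullet> grad \<phi> x + \<phi> x * H x)"
      by (rule set_integral_add(2)[OF h1 h2, symmetric])
    moreover have "\<dots> = (LINT x:Bp|lebesgue. ?N x \<bullet> grad \<phi> x + \<phi> x * H x) + (LINT x:Bm|lebesgue. ?N x \<bullet> grad \<phi> x + \<phi> x * H x)"
      using split(2) \<open>open Bp\<close> \<open>open Bm\<close>
      by (intro set_integral_Un set_integrable_subset[OF h]) auto
    moreover have "(LINT x:Bp|lebesgue. ?N x \<bullet> grad \<phi> x + \<phi> x * H x) = integral Bp (\<lambda>x. Np x \<bullet> grad \<phi> x + \<phi> x * H x)"
    proof -
      have "(LINT x:Bp|lebesgue. ?N x \<bullet> grad \<phi> x + \<phi> x * H x) = integral Bp (\<lambda>x. ?N x \<bullet> grad \<phi> x + \<phi> x * H x)"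
        by (rule set_lebesgue_integral_eq_integral(2)[OF set_integrable_subset[OF h]]) (use \<open>open Bp\<close> in auto)
      also have "\<dots> = integral Bp (\<lambda>x. Np x \<bullet> grad \<phi> x + \<phi> x * H x)"
        using \<open>\<forall>x\<in>Bp. Np x = ?N x\<close> by (intro integral_cong) simp
      finally show ?thesis .
    qed
    moreover have "(LINT x:Bm|lebesgue. ?N x \<bullet> grad \<phi> x + \<phi> x * H x) = integral Bm (\<lambda>x. Nm x \<bullet> grad \<phi> x + \<phi> x * H x)"
    proof -
      have "(LINT x:Bm|lebesgue. ?N x \<bullet> grad \<phi> x + \<phi> x * H x) = integral Bm (\<lambda>x. ?N x \<bullet> grad \<phi> x + \<phi> x * H x)"
        by (rule set_lebesgue_integral_eq_integral(2)[OF set_integrable_subset[OF h]]) (use \<open>open Bm\<close> in auto)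
      also have "\<dots> = integral Bm (\<lambda>x. Nm x \<bullet> grad \<phi> x + \<phi> x * H x)"
        using \<open>\<forall>x\<in>Bm. Nm x = ?N x\<close> by (intro integral_cong) simp
      finally show ?thesis .
    qed
    ultimately show ?thesis by (simp add: defect_def set_lebesgue_integral_def)
  qed
  \<comment> \<open>\<open>weak_solution\<close> speaks about every weak gradient. An existing one
    is needed to extract the inequality from it.\<close>
  obtain g where g: "has_weak_gradient B u g" using \<open>u \<in> W1 B\<close> unfolding W1_def by blast
  have "weak_solution F H B u \<longleftrightarrow> (\<forall>p\<in>\<Gamma> \<inter> B. (Np p - Nm p) \<bullet> \<nu>p p = 0)"
  proof
    assume weak: "weak_solution F H B u"
    have nonneg: "0 \<le> defect \<phi> (grad \<phi>)" if "\<phi> \<in> test_functions B" for \<phi>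
      using weak g that weak_form[OF g that] unfolding weak_solution_def by fastforce
    \<comment> \<open>The inequality holds for \<phi> and for its negative, and the functional is
      odd.\<close>
    have "defect \<phi> (grad \<phi>) = 0" if "\<phi> \<in> test_functions B" for \<phi>
      using nonneg[OF that] nonneg[OF test_functions_minus(1)[OF that]]
      by (simp add: test_functions_minus(2)[OF that] defect_minus)
    then show "\<forall>p\<in>\<Gamma> \<inter> B. (Np p - Nm p) \<bullet> \<nu>p p = 0"
      using jump_detected by blast
  next
    assume jump: "\<forall>p\<in>\<Gamma> \<inter> B. (Np p - Nm p) \<bullet> \<nu>p p = 0"
    have "defect \<phi> (grad \<phi>) = 0" if "\<phi> \<in> test_functions B" for \<phi>
      by (rule defect_eq_0_if_no_jump[OF _ test_function_C1_compact_in[OF that]]) (use jump in blast)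
    then show "weak_solution F H B u"
      using \<open>u \<in> W1 B\<close> by (simp add: weak_solution_def weak_form)
  qed
  also have "\<dots> \<longleftrightarrow> (\<forall>p\<in>\<Gamma> \<inter> B. (Np p - Nm p) \<bullet> \<nu>p p = (Np p - Nm p) \<bullet> \<nu>m p \<and> (Np p - Nm p) \<bullet> \<nu>m p = 0)"
    using \<open>\<forall>p\<in>\<Gamma> \<inter> B. \<nu>m p = - \<nu>p p\<close> by simp
  finally show ?thesis .
qed

end
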